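(* For all $t,y\in [0,1]$, $\varepsilon\in (0,y)$ and $j\in\{-1,1\}$, $$\lim_{s\to\infty}\mathbb{P}\left(\sqrt{\frac{\log \cot |\Lambda_s| }{\log s}}\leq t,\ j\Lambda_s \leq 0\ \Big|\ Y_s\in (y-\varepsilon,y ]\right) = \begin{cases} t\,(1-y+\varepsilon/2),&\text{if } j=1,\\ t\,(y-\varepsilon/2),& \text{if } j=-1. \end{cases}$$
   Context: Let $\{\Theta_n\}_{n\ge 1}$ be i.i.d. random variables with density $\frac12\cos\theta$ on $(-\pi/2,\pi/2)$ (and $0$ elsewhere), let $X_n=\tan\Theta_n$, $S_0=0$, $S_n=S_{n-1}+X_n$ for $n\ge1$. For $s>0$ let $N_s=\inf\{n>0: S_n>s\}$ (finite almost surely). Consider the semi-infinite strip $D=\{(x,y)\in\mathbb{R}^2: x\le 0,\ 0\le y\le 1\}$. A light ray starts at $(-s,0)$ and follows the consecutive line segments from $\left(-s+S_{n-1},\frac{1-(-1)^{n-1}}{2}\right)$ to $\left(-s+S_{n},\frac{1-(-1)^{n}}{2}\right)$, $n=1,2,\dots,N_s$; the last of these segments (with $n=N_s$) crosses the right edge $\{0\}\times[0,1]$. Let $(0,Y_s)$ be the point where this last segment crosses the right edge, and let $\Lambda_s\in(-\pi/2,\pi/2)$ be the signed angle between this last segment and the normal (horizontal direction) to the right edge, positive if the exiting ray is travelling upward ($N_s$ odd) and negative if it is travelling downward ($N_s$ even); thus $\cot|\Lambda_s|=X_{N_s}$. Convention: if $\log\cot|\Lambda_s|/\log s<0$ (with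 $s>1$) the square root is read as $0$, so that the event $\{\sqrt{\log\cot|\Lambda_s|/\log s}\le t\}$ is $\{\cot|\Lambda_s|\le s^{t^2}\}$. *)

theory Defs
  imports "HOL-Probability.Probability"
begin

text \<open>Everything about the ray is a function of one realisation \<^term>\<open>\<theta> :: nat \<Rightarrow> real\<close> of the
  angles; only the indices \<^term>\<open>n \<ge> (1::nat)\<close> are used. The plane is identified with the complex
  numbers.\<close>

definition cosine_density :: "real \<Rightarrow> real" where
  "cosine_density \<theta> = (if - pi / 2 < \<theta> \<and> \<theta> < pi / 2 then cos \<theta> / 2 else 0)"

definition walk :: "(nat \<Rightarrow> real) \<Rightarrow> nat \<Rightarrow> real" where
  "walk \<theta> n = (\<Sum>k = 1..n. tan (\<theta> k))"

text \<open>On the null event that the walk never exceeds \<^term>\<open>s :: real\<close>, this infimum of the empty set of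
  naturals is \<^term>\<open>0 :: nat\<close>.\<close>

definition crossing_index :: "(nat \<Rightarrow> real) \<Rightarrow> real \<Rightarrow> nat" where
  "crossing_index \<theta> s = Inf {n. n > 0 \<and> walk \<theta> n > s}"

definition ray_vertex :: "(nat \<Rightarrow> real) \<Rightarrow> real \<Rightarrow> nat \<Rightarrow> complex" where
  "ray_vertex \<theta> s n = Complex (- s + walk \<theta> n) ((1 - (-1) ^ n) / 2)"

definition exit_height :: "(nat \<Rightarrow> real) \<Rightarrow> real \<Rightarrow> real" where
  "exit_height \<theta> s =
     (let n = crossing_index \<theta> s
      in THE h. Complex 0 h \<in> closed_segment (ray_vertex \<theta> s (n - 1)) (ray_vertex \<theta> s n))"

text \<open>The last segment travels to the right, so the argument of its direction vector is the signed
  angle with the horizontal, in \<open>(-\<pi>/2, \<pi>/2)\<close>, positive exactly when the ray travels upward.\<close>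

definition exit_angle :: "(nat \<Rightarrow> real) \<Rightarrow> real \<Rightarrow> real" where
  "exit_angle \<theta> s =
     (let n = crossing_index \<theta> s
      in Arg (ray_vertex \<theta> s n - ray_vertex \<theta> s (n - 1)))"

end

theory Submission
  imports Defs "HOL-Real_Asymp.Real_Asymp"
begin

text \<open>
  Put \<open>X = tan \<Theta>\<close>. Then \<open>X\<close> is symmetric with density \<open>1 / (2 (1 + x\<^sup>2)\<^sup>3\<^sup>/\<^sup>2)\<close>, so its tail is
  \<open>tail z \<approx> 1 / (4 z\<^sup>2)\<close> and its truncated variance grows like \<open>ln\<close>. The ray leaves through the right edge
  with the first jump of the walk \<open>S\<close> over the level \<open>s\<close>. If \<open>Z\<close> is the distance to the level before that
  jump (the undershoot), \<open>X\<close> the jump and \<open>N\<close> its index, then \<open>cot \<bar>\<Lambda>\<bar> = X\<close>, and the exit height is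
  \<open>Z / X\<close> for odd \<open>N\<close> (upward ray) and \<open>1 - Z / X\<close> for even \<open>N\<close>. Three facts give the claim.

  \<^item> \<open>ln Z / ln s\<close> converges in law to the square of a uniform variable
    (\<open>undershoot_limit_law\<close>). Let \<open>h(z) = (ln (1 + z))\<^sup>k\<close> be evaluated at the distance to the level, and
    let the walk be killed when it passes the level. One step changes the mean of \<open>h\<close> by
    \<open>- (2 k + 1) tail(z) h(z)\<close> up to a term that is smaller by a factor \<open>ln z\<close>: the killing contributes
    \<open>1\<close>, and the second derivative of \<open>h\<close> times the logarithmic truncated variance contributes \<open>2 k\<close>
    (\<open>step_log_power_expansion\<close>). Since \<open>tail(z)\<close> is the probability of passing the level with the next
    jump, summation over time turns this into
    \<open>(2 k + 1) E (ln (1 + Z))\<^sup>k = (ln (1 + s))\<^sup>k + lower order\<close>. The numbers \<open>1 / (2 k + 1)\<close> are the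
    moments of the square of a uniform variable (\<open>square_root_law_from_moments\<close>). The same identity for
    \<open>k = 1\<close> shows that the walk passes every level almost surely.

  \<^item> Given \<open>Z = z\<close>, the ratio \<open>Z / X\<close> is at most \<open>b\<close> with probability
    \<open>tail (z / b) / tail z \<longlonglongrightarrow> b\<^sup>2\<close> as \<open>z\<close> grows, so \<open>Z / X\<close> has the limit density \<open>2 b\<close> and is independent
    of \<open>ln Z / ln s\<close>; moreover \<open>ln X\<close> and \<open>ln Z\<close> agree on the scale \<open>ln s\<close> (\<open>total_reward_limit\<close>).

  \<^item> The parity of \<open>N\<close> is asymptotically a fair coin, independent of the rest
    (\<open>alternating_reward_limit\<close>). If \<open>r(z)\<close> is the probability that the next jump leaves in the
    prescribed way, and \<open>x\<^sub>n\<close> is the mean of \<open>r\<close> at time \<open>n\<close>, then the two parities differ by the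
    alternating sum of \<open>x\<^sub>n\<close>. As \<open>r\<close> varies slowly, one step changes it only by \<open>O(1 / (1 + z)\<^sup>3)\<close>, so that
    consecutive \<open>x\<^sub>n\<close> nearly cancel, with a total error of the order of the mean of \<open>1 / (1 + Z)\<close>, which
    tends to \<open>0\<close>.

  Hence \<open>Z / X \<in> (a, b)\<close>, \<open>X \<le> s\<^sup>u\<close> and a prescribed parity have together the limit probability
  \<open>(b\<^sup>2 - a\<^sup>2) \<surd>u / 2\<close>. With \<open>u = t\<^sup>2\<close> and the two intervals of ratios that correspond to a height
  in \<open>(y - \<epsilon>, y]\<close>, the upward and the downward part of the numerator tend to \<open>\<epsilon> t (y - \<epsilon>/2)\<close> and
  \<open>\<epsilon> t (1 - y + \<epsilon>/2)\<close>, and the probability of the condition tends to \<open>\<epsilon>\<close>.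
\<close>

section \<open>The law of a single jump\<close>

definition jump_density :: "real \<Rightarrow> real" where
  "jump_density x = 1 / (2 * sqrt (1 + x\<^sup>2) ^ 3)"

definition jump_law :: "real measure" where
  "jump_law = density lborel (\<lambda>x. ennreal (jump_density x))"

definition tail :: "real \<Rightarrow> real" where
  "tail x = (1 - x / sqrt (1 + x\<^sup>2)) / 2"

lemma one_plus_square_pos [simp]: "0 < 1 + (x::real)\<^sup>2" "1 + (x::real)\<^sup>2 \<noteq> 0"
  by (auto simp: add_pos_nonneg) (smt (verit) zero_le_power2)

lemma sqrt_ge_abs: "\<bar>x\<bar> < sqrt (1 + x\<^sup>2)"
  using real_sqrt_less_mono[of "x\<^sup>2" "1 + x\<^sup>2"] by simp

lemma jump_density_measurable [measurable]: "jump_density \<in> borel_measurable borel"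
  unfolding jump_density_def by measurable

lemma tail_measurable [measurable]: "tail \<in> borel_measurable borel"
  unfolding tail_def by measurable

lemma sets_jump_law [simp, measurable_cong]: "sets jump_law = sets borel"
  by (simp add: jump_law_def)

lemma space_jump_law [simp]: "space jump_law = UNIV"
  by (simp add: jump_law_def)

lemma jump_density_pos: "0 < jump_density x"
  by (simp add: jump_density_def)

lemma jump_density_minus [simp]: "jump_density (- x) = jump_density x"
  by (simp add: jump_density_def)

lemma DERIV_tail: "(tail has_real_derivative - jump_density x) (at x)"
proof -
  define q where "q = sqrt (1 + x\<^sup>2)"
  have q: "q > 0" "q\<^sup>2 = 1 + x\<^sup>2" by (auto simp: q_def)
  have "((\<lambda>x. sqrt (1 + x\<^sup>2)) has_real_derivative x / q) (at x)"
  proof -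
    have d: "((\<lambda>x. 1 + x\<^sup>2) has_real_derivative 2 * x) (at x)"
      by (auto intro!: derivative_eq_intros)
    have "((\<lambda>x. sqrt (1 + x\<^sup>2)) has_real_derivative inverse (sqrt (1 + x\<^sup>2)) / 2 * (2 * x)) (at x)"
      by (rule DERIV_chain2[OF DERIV_real_sqrt d]) (rule one_plus_square_pos)
    then show ?thesis by (simp add: q_def inverse_eq_divide)
  qed
  from DERIV_divide[OF DERIV_ident this]
  have "((\<lambda>x. x / sqrt (1 + x\<^sup>2)) has_real_derivative (q - x * (x / q)) / (q * q)) (at x)"
    using q by (simp add: q_def[symmetric])
  from DERIV_cdivide[OF DERIV_diff[OF DERIV_const[of 1] this], of 2]
  have "((\<lambda>x. (1 - x / sqrt (1 + x\<^sup>2)) / 2) has_real_derivative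
      - ((q - x * (x / q)) / (q * q)) / 2) (at x)"
    by simp
  moreover have "- ((q - x * (x / q)) / (q * q)) / 2 = - jump_density x"
  proof -
    have "(q - x * (x / q)) / (q * q) = (q\<^sup>2 - x\<^sup>2) / q ^ 3"
      using q by (simp add: field_simps power2_eq_square power3_eq_cube)
    then show ?thesis
      using q by (simp add: jump_density_def q_def)
  qed
  ultimately show ?thesis unfolding tail_def by simp
qed

lemma tail_alt: "tail x = 1 / (2 * sqrt (1 + x\<^sup>2) * (sqrt (1 + x\<^sup>2) + x))"
proof -
  define q where "q = sqrt (1 + x\<^sup>2)"
  have q: "q > 0" "q\<^sup>2 = 1 + x\<^sup>2" "q + x > 0" using sqrt_ge_abs[of x] by (auto simp: q_def)
  have "(q - x) * (q + x) = 1" using q(2) by (simp add: algebra_simps power2_eq_square)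
  then have qx: "q - x = 1 / (q + x)" using q by (simp add: field_simps)
  have "tail x = (q - x) / (2 * q)"
    unfolding tail_def q_def[symmetric] using q by (simp add: diff_divide_distrib)
  then have "tail x = (1 / (q + x)) / (2 * q)" unfolding qx .
  then show ?thesis by (simp add: q_def mult.commute)
qed

lemma tail_pos: "0 < tail x"
  using sqrt_ge_abs[of x] unfolding tail_alt by (auto intro!: mult_pos_pos)

lemma tail_antimono: "x \<le> y \<Longrightarrow> tail y \<le> tail x"
proof (erule DERIV_nonpos_imp_nonincreasing)
  show "\<exists>d. (tail has_real_derivative d) (at u) \<and> d \<le> 0" for u
    using DERIV_tail[of u] jump_density_pos[of u] by (intro exI[of _ "- jump_density u"]) auto
qed

lemma tail_upper: "0 < x \<Longrightarrow> tail x \<le> 1 / (4 * x\<^sup>2)"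
proof -
  assume x: "0 < x"
  have "x * (x + x) \<le> sqrt (1 + x\<^sup>2) * (sqrt (1 + x\<^sup>2) + x)"
    using sqrt_ge_abs[of x] x by (intro mult_mono) auto
  then show ?thesis using x unfolding tail_alt
    by (intro divide_left_mono) (simp_all add: power2_eq_square mult_pos_pos add_nonneg_pos add_pos_pos)
qed

lemma tail_lower: "0 \<le> x \<Longrightarrow> 1 / (4 * (1 + x\<^sup>2)) \<le> tail x"
proof -
  assume x: "0 \<le> x"
  have "sqrt (1 + x\<^sup>2) * (sqrt (1 + x\<^sup>2) + x) \<le> sqrt (1 + x\<^sup>2) * (sqrt (1 + x\<^sup>2) + sqrt (1 + x\<^sup>2))"
    using sqrt_ge_abs[of x] x by (intro mult_left_mono) auto
  also have "\<dots> = 2 * (1 + x\<^sup>2)" by (simp add: algebra_simps)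
  finally show ?thesis using x unfolding tail_alt
    by (intro divide_left_mono) (auto intro!: mult_pos_pos add_pos_nonneg)
qed

lemma tail_le_weight: "0 \<le> x \<Longrightarrow> tail x \<le> 1 / (1 + x)\<^sup>2"
proof -
  assume x: "0 \<le> x"
  define q where "q = sqrt (1 + x\<^sup>2)"
  have q: "q > 0" "q\<^sup>2 = 1 + x\<^sup>2" by (auto simp: q_def)
  have "(1 + x)\<^sup>2 \<le> 2 * q\<^sup>2" unfolding q using zero_le_power2[of "1 - x"] by (simp add: power2_eq_square algebra_simps)
  also have "\<dots> \<le> 2 * q * (q + x)" using mult_nonneg_nonneg[of x q] x q(1) by (simp add: power2_eq_square distrib_left)
  finally show ?thesis using x q unfolding tail_alt q_def[symmetric]
    by (intro divide_left_mono) (auto intro!: mult_pos_pos add_pos_nonneg)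
qed

lemma weight_le_tail: "0 \<le> x \<Longrightarrow> 1 / (1 + x)\<^sup>2 \<le> 4 * tail x"
proof -
  assume x: "0 \<le> x"
  have "1 / (1 + x)\<^sup>2 \<le> 1 / (1 + x\<^sup>2)" using x
    by (intro divide_left_mono) (auto simp: power2_eq_square algebra_simps intro!: mult_pos_pos add_pos_nonneg)
  also have "\<dots> = 4 * (1 / (4 * (1 + x\<^sup>2)))" 
    by (metis (no_types) mult.right_neutral mult_divide_mult_cancel_left times_divide_eq_right zero_neq_numeral)
  also have "\<dots> \<le> 4 * tail x" by (intro mult_left_mono tail_lower x) simp
  finally show ?thesis .
qed

lemma jump_density_bound: "jump_density x \<le> 2 / (1 + \<bar>x\<bar>) ^ 3"
proof -
  have "(1 + \<bar>x\<bar>)\<^sup>2 \<le> 2 * (1 + x\<^sup>2)"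
    using zero_le_power2[of "1 - \<bar>x\<bar>"] by (simp add: power2_eq_square algebra_simps)
  also have "\<dots> \<le> (sqrt 2 * sqrt (1 + x\<^sup>2))\<^sup>2" by (simp add: power_mult_distrib)
  finally have "(1 + \<bar>x\<bar>)\<^sup>2 \<le> (sqrt 2 * sqrt (1 + x\<^sup>2))\<^sup>2" .
  then have le: "1 + \<bar>x\<bar> \<le> sqrt 2 * sqrt (1 + x\<^sup>2)"
    by (rule power2_le_imp_le) auto
  have "(1 + \<bar>x\<bar>) ^ 3 \<le> (sqrt 2 * sqrt (1 + x\<^sup>2)) ^ 3" by (intro power_mono le) auto
  also have "\<dots> = 2 * sqrt 2 * sqrt (1 + x\<^sup>2) ^ 3"
    by (simp only: power_mult_distrib power3_eq_cube[of "sqrt 2"] mult.assoc) simp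
  also have "\<dots> \<le> 4 * sqrt (1 + x\<^sup>2) ^ 3"
    by (intro mult_right_mono) (auto simp: real_le_lsqrt)
  finally have "(1 + \<bar>x\<bar>) ^ 3 \<le> 4 * sqrt (1 + x\<^sup>2) ^ 3" .
  then have "2 / (4 * sqrt (1 + x\<^sup>2) ^ 3) \<le> 2 / (1 + \<bar>x\<bar>) ^ 3"
    by (intro divide_left_mono) (auto intro!: mult_pos_pos zero_less_power add_pos_nonneg)
  then show ?thesis unfolding jump_density_def by simp
qed

lemma jump_density_cube: "\<bar>x\<bar> ^ 3 * jump_density x \<le> 1 / 2"
proof -
  have "\<bar>x\<bar> ^ 3 \<le> sqrt (1 + x\<^sup>2) ^ 3" using sqrt_ge_abs[of x] by (intro power_mono) auto
  then show ?thesis unfolding jump_density_def by (simp add: divide_simps)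
qed

lemma nn_integral_jump_law:
  "g \<in> borel_measurable borel \<Longrightarrow> (\<integral>\<^sup>+x. g x \<partial>jump_law) = (\<integral>\<^sup>+x. ennreal (jump_density x) * g x \<partial>lborel)"
  unfolding jump_law_def by (rule nn_integral_density) auto

lemma nn_integral_jump_law_minus:
  assumes [measurable]: "g \<in> borel_measurable borel"
  shows "(\<integral>\<^sup>+x. g (- x) \<partial>jump_law) = (\<integral>\<^sup>+x. g x \<partial>jump_law)"
  using nn_integral_real_affine[of "\<lambda>x. ennreal (jump_density x) * g x" "-1" 0]
  by (simp add: nn_integral_jump_law)

lemma distr_jump_law_minus: "distr jump_law borel uminus = jump_law"
proof (rule measure_eqI)
  fix A assume "A \<in> sets (distr jump_law borel uminus)"
  then have [measurable]: "A \<in> sets borel" by simp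
  have "emeasure (distr jump_law borel uminus) A = (\<integral>\<^sup>+x. indicator A x \<partial>distr jump_law borel uminus)"
    by simp
  also have "\<dots> = (\<integral>\<^sup>+x. indicator A (-x) \<partial>jump_law)"
    by (rule nn_integral_distr) auto
  also have "\<dots> = emeasure jump_law A" by (subst nn_integral_jump_law_minus) auto
  finally show "emeasure (distr jump_law borel uminus) A = emeasure jump_law A" .
qed simp

lemma emeasure_jump_law_greater: "emeasure jump_law {z<..} = ennreal (tail z)"
proof -
  have "emeasure jump_law {z<..} = (\<integral>\<^sup>+x. ennreal (jump_density x) * indicator {z<..} x \<partial>lborel)"
    unfolding jump_law_def by (subst emeasure_density) auto
  also have "\<dots> = (\<integral>\<^sup>+x. ennreal (jump_density x) * indicator {z..} x \<partial>lborel)"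
    by (intro nn_integral_cong_AE) (use AE_lborel_singleton[of z] in \<open>eventually_elim, auto simp: indicator_def\<close>)
  also have "\<dots> = ennreal (0 - (- tail z))"
  proof (rule nn_integral_FTC_atLeast)
    show "((\<lambda>x. - tail x) has_real_derivative jump_density x) (at x)" for x
      using DERIV_minus[OF DERIV_tail[of x]] by simp
    show "((\<lambda>x. - tail x) \<longlongrightarrow> 0) at_top"
      unfolding tail_def by real_asymp
  qed (auto intro: less_imp_le jump_density_pos)
  finally show ?thesis by simp
qed

lemma tail_minus: "tail (- z) = 1 - tail z"
  by (simp add: tail_def field_simps)

lemma emeasure_jump_law_singleton [simp]: "emeasure jump_law {z} = 0"
proof -
  have "emeasure jump_law {z} = (\<integral>\<^sup>+x. ennreal (jump_density x) * indicator {z} x \<partial>lborel)"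
    unfolding jump_law_def by (subst emeasure_density) auto
  also have "\<dots> = (\<integral>\<^sup>+x. 0 \<partial>(lborel :: real measure))"
    by (rule nn_integral_cong_AE, rule AE_mp[OF AE_lborel_singleton[of z]]) (auto simp: indicator_def)
  finally show ?thesis by simp
qed

lemma emeasure_jump_law_atLeast: "emeasure jump_law {z..} = ennreal (tail z)"
proof -
  have "emeasure jump_law {z..} = emeasure jump_law ({z} \<union> {z<..})" by (rule arg_cong[where f="emeasure jump_law"]) auto
  also have "\<dots> = emeasure jump_law {z} + emeasure jump_law {z<..}" by (subst plus_emeasure) auto
  finally show ?thesis by (simp add: emeasure_jump_law_greater)
qed

lemma emeasure_jump_law_atMost: "emeasure jump_law {..z} = ennreal (1 - tail z)"
proof -
  have "emeasure jump_law {..z} = emeasure (distr jump_law borel uminus) {..z}" by (simp add: distr_jump_law_minus)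
  also have "\<dots> = emeasure jump_law {-z..}"
    by (subst emeasure_distr) (auto intro!: arg_cong[where f="emeasure jump_law"])
  finally show ?thesis by (simp add: emeasure_jump_law_atLeast tail_minus)
qed

lemma prob_space_jump_law: "prob_space jump_law"
proof
  have "emeasure jump_law UNIV = emeasure jump_law ({..0} \<union> {0<..})" by (rule arg_cong[where f="emeasure jump_law"]) auto
  also have "\<dots> = emeasure jump_law {..0} + emeasure jump_law {0<..}" by (subst plus_emeasure) auto
  also have "\<dots> = ennreal ((1 - tail 0) + tail 0)"
    unfolding emeasure_jump_law_greater emeasure_jump_law_atMost
    by (subst ennreal_plus) (auto simp: tail_def)
  also have "\<dots> = 1" by simp
  finally show "emeasure jump_law (space jump_law) = 1" by simp
qed

interpretation jump_law: prob_space jump_law by (rule prob_space_jump_law)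

lemma measure_jump_law [simp]:
  "measure jump_law {z<..} = tail z" "measure jump_law {..z} = 1 - tail z"
  using tail_pos[of z] tail_pos[of "-z"]
  by (auto simp: measure_def emeasure_jump_law_greater emeasure_jump_law_atMost tail_minus)

lemma nn_integral_inverse_square:
  assumes "0 \<le> A"
  shows "(\<integral>\<^sup>+x. ennreal (1 / (1 + x)\<^sup>2) * indicator {A..} x \<partial>lborel) = ennreal (1 / (1 + A))"
proof -
  have "(\<integral>\<^sup>+x. ennreal (1 / (1 + x)\<^sup>2) * indicator {A..} x \<partial>lborel) = ennreal (0 - (- 1 / (1 + A)))"
  proof (rule nn_integral_FTC_atLeast)
    show "((\<lambda>x. - 1 / (1 + x)) has_real_derivative 1 / (1 + x)\<^sup>2) (at x)" if "A \<le> x" for x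
      using that assms by (auto intro!: derivative_eq_intros simp: power2_eq_square divide_simps)
    show "((\<lambda>x::real. - 1 / (1 + x)) \<longlongrightarrow> 0) at_top" by real_asymp
  qed auto
  then show ?thesis by simp
qed

text \<open>The function \<open>arsinh x - x / sqrt (1 + x\<^sup>2)\<close> is twice a primitive of \<open>x\<^sup>2 * jump_density x\<close>. Its
  logarithmic growth is the source of every logarithm in the limit theorem.\<close>

lemma truncated_second_moment:
  assumes A: "0 \<le> A"
  shows "has_bochner_integral jump_law (\<lambda>x. indicator {-A..A} x * x\<^sup>2) (arsinh A - A / sqrt (1 + A\<^sup>2))"
proof -
  have d: "((\<lambda>x. (arsinh x - x / sqrt (1 + x\<^sup>2)) / 2) has_real_derivative x\<^sup>2 * jump_density x) (at x)" for x :: real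
  proof -
    define q where "q = sqrt (1 + x\<^sup>2)"
    have q: "q > 0" "q\<^sup>2 = 1 + x\<^sup>2" by (auto simp: q_def)
    have "((\<lambda>x. arsinh x / 2 + tail x) has_real_derivative (1 / sqrt (1 + x\<^sup>2)) / 2 + (- jump_density x)) (at x)"
      by (intro derivative_intros DERIV_tail DERIV_cdivide) (auto intro!: derivative_eq_intros simp: add.commute)
    moreover have "(1 / sqrt (1 + x\<^sup>2)) / 2 + (- jump_density x) = x\<^sup>2 * jump_density x"
    proof -
      have "q\<^sup>2 - 1 = x\<^sup>2" using q by simp
      then have "x\<^sup>2 * (1 / (2 * q ^ 3)) = (q\<^sup>2 - 1) / (2 * q ^ 3)" by simp
      also have "\<dots> = (1 / q) / 2 + (- (1 / (2 * q^3)))" using q(1) by (simp add: divide_simps power3_eq_cube power2_eq_square)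
      finally show ?thesis unfolding jump_density_def q_def by simp
    qed
    moreover have "(\<lambda>x. arsinh x / 2 + tail x) = (\<lambda>x. (arsinh x - x / sqrt (1 + x\<^sup>2)) / 2 + 1/2)"
      by (auto simp: tail_def field_simps)
    ultimately have "((\<lambda>x. (arsinh x - x / sqrt (1 + x\<^sup>2)) / 2 + 1/2) has_real_derivative x\<^sup>2 * jump_density x) (at x)" by simp
    from DERIV_diff[OF this DERIV_const[of "1/2"]] show ?thesis by simp
  qed
  have "has_bochner_integral lborel (\<lambda>x. (x\<^sup>2 * jump_density x) * indicator {-A..A} x)
     ((arsinh A - A / sqrt (1 + A\<^sup>2)) / 2 - (arsinh (-A) - (-A) / sqrt (1 + (-A)\<^sup>2)) / 2)"
  proof (rule has_bochner_integral_FTC_Icc_real)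
    show "isCont (\<lambda>x. x\<^sup>2 * jump_density x) x" for x
      unfolding jump_density_def by (intro continuous_intros) auto
  qed (use A d in auto)
  also have "(arsinh A - A / sqrt (1 + A\<^sup>2)) / 2 - (arsinh (-A) - (-A) / sqrt (1 + (-A)\<^sup>2)) / 2 = arsinh A - A / sqrt (1 + A\<^sup>2)"
    unfolding arsinh_minus_real power2_minus by argo
  finally show ?thesis unfolding jump_law_def
    by (intro has_bochner_integral_density) (auto simp: mult_ac less_imp_le[OF jump_density_pos])
qed

text \<open>With \<open>A = z / 2\<close>, \<open>arsinh A\<close> is the logarithm of \<open>A + sqrt (1 + A\<^sup>2)\<close>, which lies between \<open>(1 + z) / 2\<close> and \<open>1 + z\<close>.\<close>

lemma truncated_second_moment_bounds:
  assumes "0 \<le> z"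
  defines "A \<equiv> z / 2"
  shows "\<bar>arsinh A - A / sqrt (1 + A\<^sup>2) - ln (1 + z)\<bar> \<le> 2"
proof -
  define q where "q = sqrt (1 + A\<^sup>2)"
  have q: "q > 0" "q\<^sup>2 = 1 + A\<^sup>2" by (auto simp: q_def)
  have A: "0 \<le> A" using assms by simp
  have "A < q" using sqrt_ge_abs[of A] by (auto simp: q_def)
  have "q \<le> 1 + A" unfolding q_def using A by (intro real_le_lsqrt) (auto simp: power2_eq_square algebra_simps)
  have "1 \<le> q" unfolding q_def by simp
  have ar: "arsinh A = ln (A + q)" by (simp add: arsinh_real_def q_def add.commute)
  have "ln (A + q) \<le> ln (1 + z)" using A \<open>q \<le> 1 + A\<close> \<open>1 \<le> q\<close> by (subst ln_le_cancel_iff) (auto simp: A_def)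
  moreover have "ln ((1 + z) / 2) \<le> ln (A + q)" using A \<open>1 \<le> q\<close> \<open>A < q\<close> assms
    by (subst ln_le_cancel_iff) (auto simp: A_def)
  moreover have "ln ((1 + z) / 2) = ln (1 + z) - ln 2" using assms by (simp add: ln_div)
  moreover have "0 \<le> A / q" "A / q \<le> 1" using \<open>A < q\<close> A by auto
  moreover have "ln 2 \<le> (1::real)" using ln_2_less_1 by simp
  ultimately show ?thesis unfolding ar q_def[symmetric] by linarith
qed

text \<open>Only the finiteness of the mean of \<open>\<bar>X\<bar>\<close> matters: it controls how much a Lipschitz reward changes in
  one step.\<close>

lemma integrable_abs_jump_law: "integrable jump_law (\<lambda>x. \<bar>x\<bar>)"
proof -
  have "(\<integral>\<^sup>+x. ennreal \<bar>x\<bar> \<partial>jump_law) = (\<integral>\<^sup>+x. ennreal (jump_density x) * ennreal \<bar>x\<bar> \<partial>lborel)"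
    by (intro nn_integral_jump_law) auto
  also have "\<dots> \<le> (\<integral>\<^sup>+x. 2 * (ennreal (1 / (1 + x)\<^sup>2) * indicator {0..} x) + 2 * (ennreal (1 / (1 + (-x))\<^sup>2) * indicator {0..} (-x)) \<partial>lborel)"
  proof (rule nn_integral_mono)
    fix x :: real
    have "jump_density x * \<bar>x\<bar> \<le> 2 / (1 + \<bar>x\<bar>)^3 * (1 + \<bar>x\<bar>)"
      by (intro mult_mono jump_density_bound) auto
    also have "\<dots> = 2 * (1 / (1 + \<bar>x\<bar>)\<^sup>2)"
      by (simp add: power3_eq_cube power2_eq_square divide_simps)
    finally have "ennreal (jump_density x) * ennreal \<bar>x\<bar> \<le> 2 * ennreal (1 / (1 + \<bar>x\<bar>)\<^sup>2)"
      by (simp add: ennreal_mult'[symmetric] ennreal_mult''[symmetric] ennreal_numeral[symmetric] less_imp_le[OF jump_density_pos] ennreal_leI del: ennreal_numeral)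
    also have "\<dots> \<le> 2 * (ennreal (1 / (1 + x)\<^sup>2) * indicator {0..} x) + 2 * (ennreal (1 / (1 + (-x))\<^sup>2) * indicator {0..} (-x))"
      by (cases "x \<ge> 0") (auto simp: indicator_def)
    finally show "ennreal (jump_density x) * ennreal \<bar>x\<bar> \<le> 2 * (ennreal (1 / (1 + x)\<^sup>2) * indicator {0..} x) + 2 * (ennreal (1 / (1 + (-x))\<^sup>2) * indicator {0..} (-x))" .
  qed
  also have "\<dots> = 2 * (\<integral>\<^sup>+x. ennreal (1 / (1 + x)\<^sup>2) * indicator {0..} x \<partial>lborel) + 2 * (\<integral>\<^sup>+x. (ennreal (1 / (1 + (-x))\<^sup>2) * indicator {0..} (-x)) \<partial>lborel)"
    by (subst nn_integral_add) (auto simp: nn_integral_cmult)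
  also have "(\<integral>\<^sup>+x. (ennreal (1 / (1 + (-x))\<^sup>2) * indicator {0..} (-x)) \<partial>lborel) = (\<integral>\<^sup>+x. ennreal (1 / (1 + x)\<^sup>2) * indicator {0..} x \<partial>lborel)"
    using nn_integral_real_affine[of "\<lambda>x. (ennreal (1 / (1 + x)\<^sup>2) * indicator {0..} x)" "-1" 0] by simp
  also have "2 * (\<integral>\<^sup>+x. ennreal (1 / (1 + x)\<^sup>2) * indicator {0..} x \<partial>lborel) + 2 * (\<integral>\<^sup>+x. ennreal (1 / (1 + x)\<^sup>2) * indicator {0..} x \<partial>lborel) < \<infinity>"
    by (subst (1 2) nn_integral_inverse_square) (auto simp: ennreal_mult_less_top)
  finally show ?thesis by (intro integrableI_bounded) auto
qed

lemma tail_tendsto_0: "(tail \<longlongrightarrow> 0) at_top"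
  unfolding tail_def[abs_def] by real_asymp

text \<open>The sine of the angle is uniform on \<open>(-1, 1)\<close>, so the tangent has the distribution function
  \<open>(1 + sin (arctan x)) / 2\<close>.\<close>

lemma distr_tan_cosine_density:
  assumes "prob_space M" and D: "distributed M lborel T (\<lambda>\<theta>. ennreal (cosine_density \<theta>))"
  shows "distr M borel (\<lambda>\<omega>. tan (T \<omega>)) = jump_law"
proof -
  interpret prob_space M by fact
  have tan_m [measurable]: "(tan :: real \<Rightarrow> real) \<in> borel_measurable borel"
    unfolding tan_def[abs_def] by measurable
  have T [measurable]: "T \<in> borel_measurable M" using D by (simp add: distributed_def)
  have [measurable]: "cosine_density \<in> borel_measurable borel"
    unfolding cosine_density_def[abs_def] by measurable
  have rd1: "real_distribution (distr M borel (\<lambda>\<omega>. tan (T \<omega>)))"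
    by (rule real_distribution_distr) measurable
  have rd2: "real_distribution jump_law"
    by (intro real_distribution.intro prob_space_jump_law real_distribution_axioms.intro) simp_all
  show ?thesis
  proof (rule cdf_unique[OF rd1 rd2], rule ext)
    fix x :: real
    have "emeasure (distr M borel (\<lambda>\<omega>. tan (T \<omega>))) {..x} = emeasure M (T -` {\<theta>. tan \<theta> \<le> x} \<inter> space M)"
      by (subst emeasure_distr) (auto intro!: arg_cong[where f="emeasure M"])
    also have "\<dots> = (\<integral>\<^sup>+\<theta>. ennreal (cosine_density \<theta>) * indicator {\<theta>. tan \<theta> \<le> x} \<theta> \<partial>lborel)"
      by (rule distributed_emeasure[OF D]) simp
    also have "\<dots> = (\<integral>\<^sup>+\<theta>. ennreal (cos \<theta> / 2) * indicator {- pi / 2..arctan x} \<theta> \<partial>lborel)"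
    proof (rule nn_integral_cong)
      fix \<theta> :: real
      have b: "arctan x < pi / 2" by (rule arctan_ubound)
      show "ennreal (cosine_density \<theta>) * indicator {\<theta>. tan \<theta> \<le> x} \<theta> = ennreal (cos \<theta> / 2) * indicator {- pi / 2..arctan x} \<theta>"
      proof (cases "- pi / 2 < \<theta> \<and> \<theta> < pi / 2")
        case True
        then have "tan \<theta> \<le> x \<longleftrightarrow> \<theta> \<le> arctan x"
          using arctan_le_iff[of "tan \<theta>" x] arctan_tan[of \<theta>] by simp
        then show ?thesis using True by (auto simp: cosine_density_def indicator_def)
      next
        case False
        then consider "\<theta> = - (pi / 2)" | "\<theta> \<notin> {- pi / 2..arctan x}" using b by force
        then show ?thesis
          by cases (use False in \<open>auto simp: cosine_density_def\<close>)
      qed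
    qed
    also have "\<dots> = ennreal (sin (arctan x) / 2 - sin (- pi / 2) / 2)"
    proof (rule nn_integral_FTC_Icc)
      fix \<theta> assume \<theta>: "\<theta> \<in> {- pi / 2..arctan x}"
      show "((\<lambda>\<theta>. sin \<theta> / 2) has_real_derivative cos \<theta> / 2) (at \<theta>)"
        by (auto intro!: derivative_eq_intros)
      show "0 \<le> cos \<theta> / 2" using \<theta> arctan_ubound[of x] by (auto intro!: cos_ge_zero)
    qed (use arctan_lbound[of x] in auto)
    also have "sin (arctan x) / 2 - sin (- pi / 2) / 2 = 1 - tail x"
      by (simp add: tail_def sin_arctan field_simps)
    finally have "emeasure (distr M borel (\<lambda>\<omega>. tan (T \<omega>))) {..x} = emeasure jump_law {..x}"
      by (simp add: emeasure_jump_law_atMost)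
    then show "cdf (distr M borel (\<lambda>\<omega>. tan (T \<omega>))) x = cdf jump_law x"
      by (simp add: cdf_def measure_def)
  qed
qed

section \<open>Logarithmic moments of one jump\<close>

lemma power_le_fact_exp: "0 \<le> u \<Longrightarrow> u ^ j \<le> fact j * exp (u::real)"
proof -
  assume u: "0 \<le> u"
  have s: "(\<lambda>n. u ^ n /\<^sub>R fact n) sums exp u" by (rule exp_converges)
  have "(\<Sum>n\<in>{j}. u ^ n /\<^sub>R fact n) \<le> exp u"
    unfolding sums_unique[OF s] by (rule sum_le_suminf[OF sums_summable[OF s]]) (use u in auto)
  then show ?thesis by (simp add: field_simps)
qed

lemma abs_ln_power_small:
  assumes "0 < t" "t \<le> (1::real)"
  shows "\<bar>ln t\<bar> ^ j \<le> fact j * 2 ^ j / sqrt t"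
proof -
  have "(\<bar>ln t\<bar> / 2) ^ j \<le> fact j * exp (\<bar>ln t\<bar> / 2)" by (rule power_le_fact_exp) auto
  also have "exp (\<bar>ln t\<bar> / 2) = 1 / sqrt t"
  proof -
    have "\<bar>ln t\<bar> / 2 = - ln (sqrt t)" using assms by (simp add: ln_sqrt ln_le_zero_iff)
    then show ?thesis using assms by (simp add: exp_minus inverse_eq_divide)
  qed
  finally show ?thesis by (simp add: power_divide field_simps)
qed

lemma ln_power_large:
  assumes "0 \<le> (y::real)"
  shows "ln (1 + y) ^ j \<le> fact j * (1 + y)"
  using power_le_fact_exp[of "ln (1 + y)" j] assms by simp

lemma integral_jump_law_minus:
  fixes g :: "real \<Rightarrow> real"
  assumes [measurable]: "g \<in> borel_measurable borel"
  shows "(\<integral>x. g (- x) \<partial>jump_law) = (\<integral>x. g x \<partial>jump_law)"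
proof -
  have "(\<integral>x. g x \<partial>jump_law) = (\<integral>x. g x \<partial>distr jump_law borel uminus)"
    by (simp add: distr_jump_law_minus)
  also have "\<dots> = (\<integral>x. g (- x) \<partial>jump_law)" by (rule integral_distr) auto
  finally show ?thesis by simp
qed

text \<open>With \<open>a = 1 + z\<close> one has \<open>ln (1 + (z - x)) = ln a + ln (1 - x / a)\<close>, so powers of the logarithm after a
  jump expand binomially into powers of \<open>ln a\<close> and these functions of the jump.\<close>

definition log_jump :: "nat \<Rightarrow> real \<Rightarrow> real \<Rightarrow> real" where
  "log_jump j z x = ln (1 - x / (1 + z)) ^ j"

lemma log_jump_measurable [measurable]: "log_jump j z \<in> borel_measurable borel"
  unfolding log_jump_def by measurable

text \<open>For jumps away from the level, powers of the logarithm grow at most linearly, while the density decays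
  like the inverse cube.\<close>

lemma log_jump_left:
  assumes z: "0 \<le> z"
  shows "(\<integral>\<^sup>+x. indicator {..<- (z / 2)} x * ennreal \<bar>log_jump j z x\<bar> \<partial>jump_law) \<le> ennreal (12 * fact j / (1 + z)\<^sup>2)"
proof -
  define A where "A = z / 2"
  have A: "0 \<le> A" "1 + z = 1 + 2 * A" using z by (auto simp: A_def)
  have "(\<integral>\<^sup>+x. indicator {..<- A} x * ennreal \<bar>log_jump j z x\<bar> \<partial>jump_law)
      = (\<integral>\<^sup>+x. indicator {..<- A} (- x) * ennreal \<bar>log_jump j z (- x)\<bar> \<partial>jump_law)"
    by (subst nn_integral_jump_law_minus) auto
  also have "\<dots> = (\<integral>\<^sup>+x. ennreal (jump_density x) * (indicator {..<- A} (- x) * ennreal \<bar>log_jump j z (- x)\<bar>) \<partial>lborel)"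
    by (rule nn_integral_jump_law) auto
  also have "\<dots> \<le> (\<integral>\<^sup>+x. ennreal (6 * fact j / (1 + z)) * (ennreal (1 / (1 + x)\<^sup>2) * indicator {A..} x) \<partial>lborel)"
  proof (rule nn_integral_mono)
    fix x :: real
    show "ennreal (jump_density x) * (indicator {..<- A} (- x) * ennreal \<bar>log_jump j z (- x)\<bar>)
       \<le> ennreal (6 * fact j / (1 + z)) * (ennreal (1 / (1 + x)\<^sup>2) * indicator {A..} x)"
    proof (cases "A < x")
      case True
      have "\<bar>log_jump j z (- x)\<bar> = ln (1 + x / (1 + z)) ^ j"
        using True A z by (simp add: log_jump_def)
      also have "\<dots> \<le> fact j * (1 + x / (1 + z))" using True A z by (intro ln_power_large) auto
      also have "\<dots> \<le> fact j * (3 * (1 + x) / (1 + z))"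
      proof (rule mult_left_mono)
        have "1 + x / (1 + z) = (1 + z + x) / (1 + z)" using z by (simp add: add_divide_distrib)
        also have "\<dots> \<le> 3 * (1 + x) / (1 + z)" using True A z by (intro divide_right_mono) auto
        finally show "1 + x / (1 + z) \<le> 3 * (1 + x) / (1 + z)" .
      qed auto
      finally have 1: "\<bar>log_jump j z (- x)\<bar> \<le> fact j * (3 * (1 + x) / (1 + z))" .
      have "jump_density x * \<bar>log_jump j z (- x)\<bar> \<le> 2 / (1 + x) ^ 3 * (fact j * (3 * (1 + x) / (1 + z)))"
        using jump_density_bound[of x] True A z by (intro mult_mono 1) auto
      also have "\<dots> = 6 * fact j / (1 + z) * (1 / (1 + x)\<^sup>2)"
      proof -
        have *: "2 / w ^ 3 * (c * (3 * w / b)) = 6 * c / b * (1 / w\<^sup>2)" if "w \<noteq> 0" for w c b :: real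
          using that by (simp add: power3_eq_cube power2_eq_square)
        show ?thesis by (rule *) (use True A in auto)
      qed
      finally show ?thesis using True z A
        by (simp add: ennreal_mult'[symmetric] less_imp_le[OF jump_density_pos] ennreal_leI)
    qed auto
  qed
  also have "\<dots> = ennreal (6 * fact j / (1 + z)) * ennreal (1 / (1 + A))"
    using A by (subst nn_integral_cmult) (auto simp: nn_integral_inverse_square)
  also have "\<dots> \<le> ennreal (12 * fact j / (1 + z)\<^sup>2)"
  proof -
    have "1 / (1 + A) \<le> 2 / (1 + z)" using A by (simp add: field_simps)
    then have "6 * fact j / (1 + z) * (1 / (1 + A)) \<le> 6 * fact j / (1 + z) * (2 / (1 + z))"
      using z by (intro mult_left_mono) auto
    then show ?thesis using z A by (simp add: ennreal_mult'[symmetric] ennreal_leI power2_eq_square)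
  qed
  finally show ?thesis unfolding A_def .
qed

text \<open>For jumps that end close to the level the logarithm is singular, but the singularity is integrable and
  the density is bounded by a multiple of \<open>1 / (1 + z)\<^sup>3\<close> there.\<close>

lemma log_jump_right:
  assumes z: "0 \<le> z"
  shows "(\<integral>\<^sup>+x. indicator {z / 2<..z} x * ennreal \<bar>log_jump j z x\<bar> \<partial>jump_law) \<le> ennreal (32 * fact j * 2 ^ j / (1 + z)\<^sup>2)"
proof -
  define a A where "a = 1 + z" and "A = z / 2"
  have A: "0 \<le> A" "a = 1 + 2 * A" "A \<le> z" "1 \<le> a" using z by (auto simp: A_def a_def)
  define c where "c = 16 / a ^ 3 * (fact j * 2 ^ j * sqrt a)"
  have c: "c \<ge> 0" using A by (auto simp: c_def)
  have "(\<integral>\<^sup>+x. indicator {A<..z} x * ennreal \<bar>log_jump j z x\<bar> \<partial>jump_law)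
      = (\<integral>\<^sup>+x. ennreal (jump_density x) * (indicator {A<..z} x * ennreal \<bar>log_jump j z x\<bar>) \<partial>lborel)"
    by (rule nn_integral_jump_law) auto
  also have "\<dots> \<le> (\<integral>\<^sup>+x. ennreal c * (ennreal (1 / sqrt (a - x)) * indicator {A..z} x) \<partial>lborel)"
  proof (rule nn_integral_mono)
    fix x :: real
    show "ennreal (jump_density x) * (indicator {A<..z} x * ennreal \<bar>log_jump j z x\<bar>)
       \<le> ennreal c * (ennreal (1 / sqrt (a - x)) * indicator {A..z} x)"
    proof (cases "A < x \<and> x \<le> z")
      case True
      then have ax: "0 < a - x" "0 \<le> x" using A by (auto simp: a_def)
      have "\<bar>log_jump j z x\<bar> = \<bar>ln ((a - x) / a)\<bar> ^ j"
        using A by (simp add: log_jump_def a_def[symmetric] power_abs diff_divide_distrib)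
      also have "\<dots> \<le> fact j * 2 ^ j / sqrt ((a - x) / a)"
        using ax A by (intro abs_ln_power_small) (auto simp: field_simps)
      also have "\<dots> = fact j * 2 ^ j * sqrt a * (1 / sqrt (a - x))" using A by (simp add: real_sqrt_divide)
      finally have 1: "\<bar>log_jump j z x\<bar> \<le> fact j * 2 ^ j * sqrt a * (1 / sqrt (a - x))" .
      have "(a / 2) ^ 3 \<le> (1 + x) ^ 3" using True A by (intro power_mono) auto
      then have "2 / (1 + x) ^ 3 \<le> 2 / (a / 2) ^ 3" using True A
        by (intro divide_left_mono) auto
      then have 2: "jump_density x \<le> 16 / a ^ 3" using jump_density_bound[of x] ax
        by (simp add: power_divide)
      have "jump_density x * \<bar>log_jump j z x\<bar> \<le> 16 / a ^ 3 * (fact j * 2 ^ j * sqrt a * (1 / sqrt (a - x)))"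
        using A by (intro mult_mono 1 2) auto
      also have "\<dots> = c * (1 / sqrt (a - x))" by (simp add: c_def)
      finally show ?thesis using True ax c
        by (simp add: ennreal_mult'[symmetric] ennreal_mult''[symmetric] less_imp_le[OF jump_density_pos] ennreal_leI)
    qed auto
  qed
  also have "\<dots> = ennreal c * (\<integral>\<^sup>+x. ennreal (1 / sqrt (a - x)) * indicator {A..z} x \<partial>lborel)"
    by (rule nn_integral_cmult) auto
  also have "(\<integral>\<^sup>+x. ennreal (1 / sqrt (a - x)) * indicator {A..z} x \<partial>lborel) = ennreal (- 2 * sqrt (a - z) - (- 2 * sqrt (a - A)))"
  proof (rule nn_integral_FTC_Icc)
    fix x assume "x \<in> {A..z}"
    then have "0 < a - x" by (auto simp: a_def)
    then show "((\<lambda>x. - 2 * sqrt (a - x)) has_real_derivative 1 / sqrt (a - x)) (at x)"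
      by (auto intro!: derivative_eq_intros simp: inverse_eq_divide)
    show "0 \<le> 1 / sqrt (a - x)" using \<open>0 < a - x\<close> by simp
  qed (use A in auto)
  also have "ennreal c * ennreal (- 2 * sqrt (a - z) - (- 2 * sqrt (a - A))) \<le> ennreal (c * (2 * sqrt a))"
  proof -
    have "sqrt (a - A) \<le> sqrt a" "0 \<le> sqrt (a - z)" using A by (auto simp: a_def)
    then have "c * (- 2 * sqrt (a - z) - (- 2 * sqrt (a - A))) \<le> c * (2 * sqrt a)"
      using c by (intro mult_left_mono) linarith+
    then show ?thesis using c by (simp add: ennreal_mult'[symmetric] ennreal_leI)
  qed
  also have "c * (2 * sqrt a) = 32 * fact j * 2 ^ j * (sqrt a * sqrt a) / a ^ 3" by (simp add: c_def)
  also have "\<dots> = 32 * fact j * 2 ^ j / a\<^sup>2"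
    using A by (simp add: power3_eq_cube power2_eq_square)
  finally show ?thesis unfolding A_def a_def .
qed

text \<open>Jumps of more than half the distance to the level that do not pass it. Dividing at half the distance
  keeps \<open>x / (1 + z)\<close> within \<open>1 / 2\<close> for all remaining jumps, where the logarithm has its Taylor expansion.\<close>

definition outer_jump :: "real \<Rightarrow> real set" where
  "outer_jump z = {..<- (z / 2)} \<union> {z / 2<..z}"

lemma outer_jump_measurable [measurable]: "outer_jump z \<in> sets borel"
  unfolding outer_jump_def by measurable

lemma log_jump_outer:
  assumes z: "0 \<le> z"
  shows "integrable jump_law (\<lambda>x. indicator (outer_jump z) x * log_jump j z x)" (is "integrable _ ?f")
    and "\<bar>\<integral>x. indicator (outer_jump z) x * log_jump j z x \<partial>jump_law\<bar> \<le> 44 * fact j * 2 ^ j / (1 + z)\<^sup>2"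
proof -
  have "(\<integral>\<^sup>+x. ennreal (norm (?f x)) \<partial>jump_law) =
     (\<integral>\<^sup>+x. indicator {..<- (z / 2)} x * ennreal \<bar>log_jump j z x\<bar> + indicator {z / 2<..z} x * ennreal \<bar>log_jump j z x\<bar> \<partial>jump_law)"
    using z by (intro nn_integral_cong) (auto simp: outer_jump_def indicator_def)
  also have "\<dots> = (\<integral>\<^sup>+x. indicator {..<- (z / 2)} x * ennreal \<bar>log_jump j z x\<bar> \<partial>jump_law) + (\<integral>\<^sup>+x. indicator {z / 2<..z} x * ennreal \<bar>log_jump j z x\<bar> \<partial>jump_law)"
    by (rule nn_integral_add) auto
  also have "\<dots> \<le> ennreal (12 * fact j / (1 + z)\<^sup>2) + ennreal (32 * fact j * 2 ^ j / (1 + z)\<^sup>2)"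
    by (intro add_mono log_jump_left log_jump_right z)
  also have "\<dots> = ennreal (12 * fact j / (1 + z)\<^sup>2 + 32 * fact j * 2 ^ j / (1 + z)\<^sup>2)"
    by (rule ennreal_plus[symmetric]) auto
  also have "\<dots> \<le> ennreal (44 * fact j * 2 ^ j / (1 + z)\<^sup>2)"
  proof (rule ennreal_leI)
    have "12 * fact j * 1 \<le> 12 * fact j * (2::real) ^ j" by (intro mult_left_mono) auto
    then have "(12 * fact j + 32 * fact j * 2 ^ j) / (1 + z)\<^sup>2 \<le> (44 * fact j * 2 ^ j) / (1 + z)\<^sup>2"
      by (intro divide_right_mono) auto
    then show "12 * fact j / (1 + z)\<^sup>2 + 32 * fact j * 2 ^ j / (1 + z)\<^sup>2 \<le> 44 * fact j * 2 ^ j / (1 + z)\<^sup>2"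
      by (simp add: add_divide_distrib)
  qed
  finally have *: "(\<integral>\<^sup>+x. ennreal (norm (?f x)) \<partial>jump_law) \<le> ennreal (44 * fact j * 2 ^ j / (1 + z)\<^sup>2)" .
  show i: "integrable jump_law ?f"
    by (rule integrableI_bounded) (use * in \<open>auto intro: le_less_trans\<close>)
  have "ennreal (norm (\<integral>x. ?f x \<partial>jump_law)) \<le> ennreal (44 * fact j * 2 ^ j / (1 + z)\<^sup>2)"
    by (rule order_trans[OF integral_norm_bound_ennreal[OF i] *])
  then show "\<bar>\<integral>x. ?f x \<partial>jump_law\<bar> \<le> 44 * fact j * 2 ^ j / (1 + z)\<^sup>2"
    by (subst (asm) ennreal_le_iff) auto
qed

lemma abs_ln_one_minus_le:
  assumes "\<bar>y\<bar> \<le> 1 / 2"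
  shows "\<bar>ln (1 - y)\<bar> \<le> 2 * \<bar>y::real\<bar>"
proof -
  have "\<bar>ln (1 + (- y)) - (- y)\<bar> \<le> 2 * (- y)\<^sup>2" by (rule abs_ln_one_plus_x_minus_x_bound) (use assms in auto)
  moreover have "2 * (- y)\<^sup>2 = 2 * \<bar>y\<bar> * \<bar>y\<bar>" by (simp add: power2_eq_square)
  moreover have "2 * \<bar>y\<bar> * \<bar>y\<bar> \<le> 1 * \<bar>y\<bar>" using assms by (intro mult_right_mono) auto
  ultimately show ?thesis by auto
qed

lemma inner_jump_integrable:
  fixes g :: "real \<Rightarrow> real"
  assumes [measurable]: "g \<in> borel_measurable borel" and "\<And>x. \<bar>x\<bar> \<le> A \<Longrightarrow> \<bar>g x\<bar> \<le> B"
  shows "integrable jump_law (\<lambda>x. indicator {-A..A} x * g x)"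
proof (rule jump_law.integrable_const_bound[of _ "\<bar>B\<bar>"])
  have "norm (indicator {-A..A} x * g x) \<le> \<bar>B\<bar>" for x
    using assms(2)[of x] by (auto simp: indicator_def abs_le_iff)
  then show "AE x in jump_law. norm (indicator {-A..A} x * g x) \<le> \<bar>B\<bar>" by simp
qed simp

lemma log_jump_inner_abs:
  assumes z: "0 \<le> z" and x: "\<bar>x\<bar> \<le> z / 2"
  shows "\<bar>log_jump j z x\<bar> \<le> 1" "2 \<le> j \<Longrightarrow> \<bar>log_jump j z x\<bar> \<le> 4 / (1 + z)\<^sup>2 * x\<^sup>2"
proof -
  define y where "y = x / (1 + z)"
  have y: "\<bar>y\<bar> \<le> 1 / 2" using x z by (auto simp: y_def field_simps)
  have l: "\<bar>ln (1 - y)\<bar> \<le> 2 * \<bar>y\<bar>" by (rule abs_ln_one_minus_le[OF y])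
  have l1: "\<bar>ln (1 - y)\<bar> \<le> 1" using l y by linarith
  have e: "\<bar>log_jump j z x\<bar> = \<bar>ln (1 - y)\<bar> ^ j" by (simp add: log_jump_def y_def power_abs)
  show "\<bar>log_jump j z x\<bar> \<le> 1" unfolding e using l1 by (simp add: power_le_one)
  assume "2 \<le> j"
  then have "\<bar>ln (1 - y)\<bar> ^ j \<le> \<bar>ln (1 - y)\<bar> ^ 2" using l1 by (intro power_decreasing) auto
  also have "\<dots> \<le> (2 * \<bar>y\<bar>) ^ 2" by (intro power_mono l) auto
  finally show "\<bar>log_jump j z x\<bar> \<le> 4 / (1 + z)\<^sup>2 * x\<^sup>2" unfolding e
    by (simp add: y_def power_mult_distrib power_divide)
qed

lemma log_jump_split:
  "0 \<le> z \<Longrightarrow> indicator {..z} x * log_jump j z x = indicator {-(z/2)..z/2} x * log_jump j z x + indicator (outer_jump z) x * log_jump j z x"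
  by (auto simp: outer_jump_def indicator_def)

lemma log_jump_inner_integrable:
  assumes z: "0 \<le> z"
  shows "integrable jump_law (\<lambda>x. indicator {-(z/2)..z/2} x * log_jump j z x)"
  by (rule inner_jump_integrable[where B=1]) (use log_jump_inner_abs[OF z] in auto)

lemma log_jump_integrable:
  assumes z: "0 \<le> z"
  shows "integrable jump_law (\<lambda>x. indicator {..z} x * log_jump j z x)"
  unfolding log_jump_split[OF z] by (intro Bochner_Integration.integrable_add log_jump_outer log_jump_inner_integrable z)

text \<open>Small jumps contribute at most a multiple of the truncated variance over \<open>(1 + z)\<^sup>2\<close>, hence the
  additional factor \<open>ln (1 + z)\<close>; large jumps contribute \<open>O((1 + z)\<^sup>-\<^sup>2)\<close>.\<close>

lemma log_jump_higher_moment: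
  assumes z: "0 \<le> z" and j: "2 \<le> j"
  shows "\<bar>\<integral>x. indicator {..z} x * log_jump j z x \<partial>jump_law\<bar> \<le> (8 + 44 * fact j * 2 ^ j) * (1 + ln (1 + z)) / (1 + z)\<^sup>2"
proof -
  define m where "m = arsinh (z/2) - (z/2) / sqrt (1 + (z/2)\<^sup>2)"
  have m: "has_bochner_integral jump_law (\<lambda>x. indicator {-(z/2)..z/2} x * x\<^sup>2) m"
    unfolding m_def by (rule truncated_second_moment) (use z in auto)
  have m2: "m \<le> ln (1 + z) + 2" using truncated_second_moment_bounds[OF z] unfolding m_def by linarith
  have "\<bar>\<integral>x. indicator {-(z/2)..z/2} x * log_jump j z x \<partial>jump_law\<bar> \<le> (\<integral>x. 4 / (1 + z)\<^sup>2 * (indicator {-(z/2)..z/2} x * x\<^sup>2) \<partial>jump_law)"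
    using log_jump_inner_abs(2)[OF z _ j]
    by (intro integral_abs_bound_integral log_jump_inner_integrable z integrable_mult_right integrable.intros[OF m])
       (auto simp: indicator_def)
  also have "\<dots> = 4 / (1 + z)\<^sup>2 * m" using has_bochner_integral_integral_eq[OF m] by simp
  also have "\<dots> \<le> 4 / (1 + z)\<^sup>2 * (ln (1 + z) + 2)" by (intro mult_left_mono m2) auto
  finally have 1: "\<bar>\<integral>x. indicator {-(z/2)..z/2} x * log_jump j z x \<partial>jump_law\<bar> \<le> 4 * (ln (1 + z) + 2) / (1 + z)\<^sup>2"
    by simp
  have l: "0 \<le> ln (1 + z)" using z by simp
  have "\<bar>\<integral>x. indicator {..z} x * log_jump j z x \<partial>jump_law\<bar> \<le> 4 * (ln (1 + z) + 2) / (1 + z)\<^sup>2 + 44 * fact j * 2 ^ j / (1 + z)\<^sup>2"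
    unfolding log_jump_split[OF z]
    by (subst Bochner_Integration.integral_add[OF log_jump_inner_integrable[OF z] log_jump_outer(1)[OF z]])
       (intro order_trans[OF abs_triangle_ineq] add_mono 1 log_jump_outer z)
  also have "\<dots> = (4 * (ln (1 + z) + 2) + 44 * fact j * 2 ^ j) / (1 + z)\<^sup>2" by (simp add: add_divide_distrib)
  also have "\<dots> \<le> (8 * (1 + ln (1 + z)) + 44 * fact j * 2 ^ j * (1 + ln (1 + z))) / (1 + z)\<^sup>2"
    using l by (intro divide_right_mono add_mono) auto
  finally show ?thesis by (simp add: algebra_simps)
qed

text \<open>For small jumps the symmetry of the law allows \<open>ln (1 - y)\<close> to be replaced by \<open>ln (1 - y\<^sup>2) / 2\<close>, whose
  leading term \<open>- y\<^sup>2 / 2\<close> produces the truncated variance. The exact constant of the logarithm here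
  determines the exponent of the limit law.\<close>

lemma log_jump_first_moment:
  assumes z: "0 \<le> z"
  shows "\<bar>(\<integral>x. indicator {..z} x * log_jump 1 z x \<partial>jump_law) + ln (1 + z) / (2 * (1 + z)\<^sup>2)\<bar> \<le> 90 / (1 + z)\<^sup>2"
proof -
  define a A where "a = 1 + z" and "A = z / 2"
  have A: "0 \<le> A" "a = 1 + 2 * A" "1 \<le> a" using z by (auto simp: A_def a_def)
  define m where "m = arsinh A - A / sqrt (1 + A\<^sup>2)"
  have m: "has_bochner_integral jump_law (\<lambda>x. indicator {-A..A} x * x\<^sup>2) m"
    unfolding m_def by (rule truncated_second_moment) (use A in auto)
  have m2: "\<bar>m - ln a\<bar> \<le> 2" using truncated_second_moment_bounds[OF z] unfolding m_def A_def a_def by linarith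
  define I where "I = (\<integral>x. indicator {-A..A} x * log_jump 1 z x \<partial>jump_law)"
  have int: "integrable jump_law (\<lambda>x. indicator {-A..A} x * log_jump 1 z x)"
    unfolding A_def by (rule log_jump_inner_integrable[OF z])
  have int': "integrable jump_law (\<lambda>x. indicator {-A..A} x * log_jump 1 z (-x))"
    by (rule inner_jump_integrable[where B=1]) (use log_jump_inner_abs[OF z, of "- _"] in \<open>auto simp: A_def\<close>)
  have "I = (\<integral>x. indicator {-A..A} (-x) * log_jump 1 z (-x) \<partial>jump_law)"
    unfolding I_def by (subst integral_jump_law_minus) auto
  also have "\<dots> = (\<integral>x. indicator {-A..A} x * log_jump 1 z (-x) \<partial>jump_law)"
    by (intro Bochner_Integration.integral_cong) (auto simp: indicator_def)
  finally have "2 * I = (\<integral>x. indicator {-A..A} x * log_jump 1 z x \<partial>jump_law) + (\<integral>x. indicator {-A..A} x * log_jump 1 z (-x) \<partial>jump_law)"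
    unfolding I_def by simp
  also have "\<dots> = (\<integral>x. indicator {-A..A} x * log_jump 1 z x + indicator {-A..A} x * log_jump 1 z (-x) \<partial>jump_law)"
    by (rule Bochner_Integration.integral_add[OF int int', symmetric])
  finally have I2: "2 * I = \<dots>" .
  have "2 * I + m / a\<^sup>2 = (\<integral>x. (indicator {-A..A} x * log_jump 1 z x + indicator {-A..A} x * log_jump 1 z (-x)) + indicator {-A..A} x * x\<^sup>2 / a\<^sup>2 \<partial>jump_law)"
    unfolding I2 Bochner_Integration.integral_add[OF Bochner_Integration.integrable_add[OF int int'] integrable_divide[OF integrable.intros[OF m]]]
    by (simp add: has_bochner_integral_integral_eq[OF m])
  then have "ennreal (norm (2 * I + m / a\<^sup>2)) \<le> (\<integral>\<^sup>+x. norm ((indicator {-A..A} x * log_jump 1 z x + indicator {-A..A} x * log_jump 1 z (-x)) + indicator {-A..A} x * x\<^sup>2 / a\<^sup>2) \<partial>jump_law)"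
    by (simp only:) (intro integral_norm_bound_ennreal Bochner_Integration.integrable_add int int' integrable_divide integrable.intros[OF m])
  also have "\<dots> \<le> (\<integral>\<^sup>+x. ennreal (indicator {-A..A} x * (2 / a ^ 4 * x ^ 4)) \<partial>jump_law)"
  proof (intro nn_integral_mono ennreal_leI)
    fix x
    show "norm ((indicator {-A..A} x * log_jump 1 z x + indicator {-A..A} x * log_jump 1 z (-x)) + indicator {-A..A} x * x\<^sup>2 / a\<^sup>2) \<le> indicator {-A..A} x * (2 / a ^ 4 * x ^ 4)"
    proof (cases "x \<in> {-A..A}")
      case True
      define y where "y = x / a"
      have y: "\<bar>y\<bar> \<le> 1 / 2" using True A by (auto simp: y_def field_simps abs_le_iff)
      have y2: "y\<^sup>2 \<le> (1/2)\<^sup>2" using power_mono[OF y, of 2] by simp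
      have "log_jump 1 z x + log_jump 1 z (-x) = ln (1 - y) + ln (1 + y)" by (simp add: log_jump_def y_def a_def)
      also have "\<dots> = ln ((1 - y) * (1 + y))" using y by (subst ln_mult_pos) auto
      also have "(1 - y) * (1 + y) = 1 + (- y\<^sup>2)" by (simp add: algebra_simps power2_eq_square)
      finally have "\<bar>(log_jump 1 z x + log_jump 1 z (-x)) - (- y\<^sup>2)\<bar> \<le> 2 * (- y\<^sup>2)\<^sup>2"
        using abs_ln_one_plus_x_minus_x_bound[of "- y\<^sup>2"] y2 by (simp add: power2_eq_square)
      then show ?thesis using True by (simp add: y_def power_divide)
    qed auto
  qed
  also have "\<dots> = (\<integral>\<^sup>+x. ennreal (jump_density x) * ennreal (indicator {-A..A} x * (2 / a ^ 4 * x ^ 4)) \<partial>lborel)"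
    by (rule nn_integral_jump_law) auto
  also have "\<dots> \<le> (\<integral>\<^sup>+x. ennreal (A / a ^ 4) * indicator {-A..A} x \<partial>lborel)"
  proof (rule nn_integral_mono)
    fix x
    show "ennreal (jump_density x) * ennreal (indicator {-A..A} x * (2 / a ^ 4 * x ^ 4)) \<le> ennreal (A / a ^ 4) * indicator {-A..A} x"
    proof (cases "x \<in> {-A..A}")
      case True
      have x4: "x ^ 4 = \<bar>x\<bar> ^ 3 * \<bar>x\<bar>" using power_even_abs[of 4 x] by (simp add: eval_nat_numeral)
      have "jump_density x * (2 / a ^ 4 * x ^ 4) = 2 / a ^ 4 * ((\<bar>x\<bar> ^ 3 * jump_density x) * \<bar>x\<bar>)"
        unfolding x4 by simp
      also have "\<dots> \<le> 2 / a ^ 4 * ((1 / 2) * A)"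
        using True A by (intro mult_left_mono mult_mono jump_density_cube) (auto simp: abs_le_iff)
      finally show ?thesis using True
        by (simp add: ennreal_mult'[symmetric] less_imp_le[OF jump_density_pos] ennreal_leI)
    qed auto
  qed
  also have "\<dots> = ennreal (A / a ^ 4) * ennreal (2 * A)"
    using A by (subst nn_integral_cmult_indicator) auto
  also have "\<dots> \<le> ennreal (2 / a\<^sup>2)"
  proof -
    have "A / a ^ 4 * (2 * A) = 2 * A\<^sup>2 / a ^ 4" by (simp add: power2_eq_square)
    also have "\<dots> \<le> 2 * a\<^sup>2 / a ^ 4" using A by (intro divide_right_mono mult_left_mono power_mono) auto
    also have "\<dots> = 2 / a\<^sup>2" using A(3) by (simp add: power2_eq_square eval_nat_numeral)
    finally show ?thesis using A by (simp add: ennreal_mult'[symmetric] ennreal_leI)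
  qed
  finally have "norm (2 * I + m / a\<^sup>2) \<le> 2 / a\<^sup>2" by (subst (asm) ennreal_le_iff) auto
  then have i1: "\<bar>I + m / (2 * a\<^sup>2)\<bar> \<le> 1 / a\<^sup>2" by (auto simp: abs_le_iff field_simps)
  have "\<bar>(m - ln a) / (2 * a\<^sup>2)\<bar> = \<bar>m - ln a\<bar> / (2 * a\<^sup>2)" by (simp add: abs_divide)
  also have "\<dots> \<le> 2 / (2 * a\<^sup>2)" by (intro divide_right_mono m2) auto
  finally have i2: "\<bar>(m - ln a) / (2 * a\<^sup>2)\<bar> \<le> 1 / a\<^sup>2" by simp
  define J where "J = (\<integral>x. indicator (outer_jump z) x * log_jump 1 z x \<partial>jump_law)"
  have i3: "\<bar>J\<bar> \<le> 88 / a\<^sup>2" using log_jump_outer(2)[OF z, of 1] unfolding J_def a_def by simp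
  have "(\<integral>x. indicator {..z} x * log_jump 1 z x \<partial>jump_law) = I + J"
    unfolding log_jump_split[OF z] I_def J_def A_def
    by (rule Bochner_Integration.integral_add[OF log_jump_inner_integrable[OF z] log_jump_outer(1)[OF z]])
  moreover have "I + J + ln a / (2 * a\<^sup>2) = (I + m / (2 * a\<^sup>2)) - (m - ln a) / (2 * a\<^sup>2) + J" by (simp add: diff_divide_distrib)
  moreover have "1 / a\<^sup>2 + 1 / a\<^sup>2 + 88 / a\<^sup>2 = 90 / a\<^sup>2" by (simp add: add_divide_distrib[symmetric])
  ultimately show ?thesis using i1 i2 i3 unfolding a_def[symmetric] by linarith
qed

text \<open>The mean of \<open>g\<close> after one jump for a walk at distance \<open>z\<close> below the level, where the walk is
  killed if it passes the level.\<close>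

definition step :: "(real \<Rightarrow> real) \<Rightarrow> real \<Rightarrow> real" where
  "step g z = (\<integral>x. indicator {..z} x * g (z - x) \<partial>jump_law)"

abbreviation log_pow :: "nat \<Rightarrow> real \<Rightarrow> real" where
  "log_pow k \<equiv> \<lambda>z. ln (1 + z) ^ k"

text \<open>What one step does to a power of the logarithm beyond the leading term.\<close>

abbreviation step_error :: "nat \<Rightarrow> real \<Rightarrow> real" where
  "step_error k z \<equiv> log_pow k z - step (log_pow k) z - (2 * real k + 1) * (tail z * log_pow k z)"

lemma tail_expansion:
  assumes "0 \<le> z"
  shows "\<bar>tail z - 1 / (4 * (1 + z)\<^sup>2)\<bar> \<le> 2 / (1 + z) ^ 3"
proof -
  define a where "a = 1 + z"
  have a: "1 \<le> a" using assms by (simp add: a_def)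
  have lo: "1 / (4 * a\<^sup>2) \<le> tail z" using weight_le_tail[OF assms] by (simp add: a_def)
  have "tail z \<le> 1 / (4 * a\<^sup>2) + 2 / a ^ 3"
  proof (cases "1 \<le> z")
    case False
    have "tail z \<le> 1 / a\<^sup>2" using tail_le_weight[OF assms] by (simp add: a_def)
    also have "\<dots> = a / a ^ 3" using a by (simp add: power3_eq_cube power2_eq_square)
    also have "\<dots> \<le> 2 / a ^ 3" using False a by (intro divide_right_mono) (auto simp: a_def)
    also have "\<dots> \<le> 1 / (4 * a\<^sup>2) + 2 / a ^ 3" by simp
    finally show ?thesis .
  next
    case True
    have "tail z \<le> 1 / (4 * z\<^sup>2)" by (rule tail_upper) (use True in auto)
    also have "\<dots> = 1 / (4 * a\<^sup>2) + (1 + 2 * z) / (4 * z\<^sup>2 * a\<^sup>2)"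
    proof -
      have "1 / (4 * z\<^sup>2) = a\<^sup>2 / (4 * z\<^sup>2 * a\<^sup>2)" using a by simp
      also have "a\<^sup>2 = z\<^sup>2 + (1 + 2 * z)" by (simp add: a_def power2_eq_square algebra_simps)
      also have "(z\<^sup>2 + (1 + 2 * z)) / (4 * z\<^sup>2 * (z\<^sup>2 + (1 + 2 * z))) = z\<^sup>2 / (4 * z\<^sup>2 * (z\<^sup>2 + (1 + 2 * z))) + (1 + 2 * z) / (4 * z\<^sup>2 * (z\<^sup>2 + (1 + 2 * z)))"
        by (rule add_divide_distrib)
      also have "z\<^sup>2 / (4 * z\<^sup>2 * (z\<^sup>2 + (1 + 2 * z))) = 1 / (4 * (z\<^sup>2 + (1 + 2 * z)))" using True by simp
      also have "z\<^sup>2 + (1 + 2 * z) = a\<^sup>2" by (simp add: a_def power2_eq_square algebra_simps)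
      finally show ?thesis .
    qed
    also have "(1 + 2 * z) / (4 * z\<^sup>2 * a\<^sup>2) \<le> (2 * a) / (a\<^sup>2 * a\<^sup>2)"
    proof (rule frac_le)
      have "a\<^sup>2 \<le> (2 * z)\<^sup>2" using True by (intro power_mono) (auto simp: a_def)
      then show "a\<^sup>2 * a\<^sup>2 \<le> 4 * z\<^sup>2 * a\<^sup>2" by (intro mult_right_mono) (auto simp: power_mult_distrib)
    qed (use True a in \<open>auto simp: a_def\<close>)
    also have "(2 * a) / (a\<^sup>2 * a\<^sup>2) = 2 / a ^ 3" using a by (simp add: power3_eq_cube power2_eq_square)
    finally show ?thesis by simp
  qed
  with lo show ?thesis unfolding a_def by (simp add: abs_le_iff)
qed

lemma log_power_expand:
  assumes z: "0 \<le> z"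
  shows "indicator {..z} x * ln (1 + (z - x)) ^ k =
    (\<Sum>j\<le>k. real (k choose j) * ln (1 + z) ^ (k - j) * (indicator {..z} x * log_jump j z x))"
proof (cases "x \<le> z")
  case True
  have "ln (1 + (z - x)) = ln ((1 + z) * (1 - x / (1 + z)))" using z by (simp add: right_diff_distrib add_diff_eq)
  also have "\<dots> = ln (1 - x / (1 + z)) + ln (1 + z)"
    using True z by (subst ln_mult_pos) (auto simp: field_simps)
  finally show ?thesis using True
    by (simp add: binomial_ring log_jump_def mult_ac)
qed auto

lemma log_power_integrable:
  assumes z: "0 \<le> z"
  shows "integrable jump_law (\<lambda>x. indicator {..z} x * ln (1 + (z - x)) ^ k)"
  unfolding log_power_expand[OF z] by (intro Bochner_Integration.integrable_sum integrable_mult_right log_jump_integrable z)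

lemma step_log_power:
  assumes z: "0 \<le> z"
  shows "step (log_pow k) z =
    (\<Sum>j\<le>k. real (k choose j) * ln (1 + z) ^ (k - j) * (\<integral>x. indicator {..z} x * log_jump j z x \<partial>jump_law))"
  unfolding step_def log_power_expand[OF z]
  by (subst Bochner_Integration.integral_sum)
     (auto intro!: Bochner_Integration.integrable_sum integrable_mult_right log_jump_integrable z)

text \<open>In the binomial expansion the terms of order \<open>0\<close> and \<open>1\<close> give the killing and the
  leading part of the drift; all further terms have one logarithm less.\<close>

theorem step_log_power_expansion:
  assumes "1 \<le> k"
  obtains C where "0 \<le> C"
    "\<And>z. 0 \<le> z \<Longrightarrow> \<bar>step_error k z\<bar>
      \<le> C * (tail z * (1 + ln (1 + z)) ^ (k - 1))"
proof -
  define c where "c = (\<lambda>j::nat. 8 + 44 * fact j * 2 ^ j :: real)"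
  have c: "0 \<le> c j" for j by (simp add: c_def)
  define C0 where "C0 = 94 * real k + (\<Sum>j\<in>{2..k}. real (k choose j) * c j)"
  have C0: "0 \<le> C0" by (auto simp: C0_def c intro!: add_nonneg_nonneg sum_nonneg mult_nonneg_nonneg)
  have main: "\<bar>step_error k z\<bar>
      \<le> C0 * ((1 + ln (1 + z)) ^ (k - 1) / (1 + z)\<^sup>2)" if z: "0 \<le> z" for z
  proof -
    define a l where "a = 1 + z" and "l = ln (1 + z)"
    have a: "1 \<le> a" using z by (simp add: a_def)
    have l: "0 \<le> l" "l \<le> a" using z ln_le_minus_one[of "1 + z"] by (auto simp: l_def a_def)
    define I where "I = (\<lambda>j. \<integral>x. indicator {..z} x * log_jump j z x \<partial>jump_law)"
    have I: "(\<integral>x. indicator {..z} x * log_jump j z x \<partial>jump_law) = I j" for j by (simp add: I_def)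
    define R where "R = (\<Sum>j\<in>{2..k}. real (k choose j) * l ^ (k - j) * I j)"
    have I0: "I 0 = 1 - tail z"
      by (simp add: I_def log_jump_def)
    have "{..k} = insert 0 (insert 1 {2..k})" using assms by auto
    then have "step (log_pow k) z = l ^ k * (1 - tail z) + real k * l ^ (k - 1) * I 1 + R"
      unfolding step_log_power[OF z] R_def l_def[symmetric] I by (simp add: I0)
    moreover have lk: "l ^ k = l ^ (k - 1) * l" using assms by (cases k) auto
    ultimately have e: "l ^ k - step (log_pow k) z - (2 * real k + 1) * (tail z * l ^ k)
      = - (real k * l ^ (k - 1) * (2 * l * (tail z - 1 / (4 * a\<^sup>2)))) - real k * l ^ (k - 1) * (I 1 + l / (2 * a\<^sup>2)) - R"
      unfolding lk by (simp add: algebra_simps)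
    have p: "l ^ (k - 1) \<le> (1 + l) ^ (k - 1)" using l by (intro power_mono) auto
    have b1: "\<bar>real k * l ^ (k - 1) * (2 * l * (tail z - 1 / (4 * a\<^sup>2)))\<bar> \<le> real k * (1 + l) ^ (k - 1) * (4 / a\<^sup>2)"
    proof -
      have "\<bar>real k * l ^ (k - 1) * (2 * l * (tail z - 1 / (4 * a\<^sup>2)))\<bar> = real k * l ^ (k - 1) * (2 * l * \<bar>tail z - 1 / (4 * a\<^sup>2)\<bar>)"
        using l by (simp add: abs_mult)
      also have "\<dots> \<le> real k * (1 + l) ^ (k - 1) * (2 * a * (2 / a ^ 3))"
        using l p a tail_expansion[OF z] unfolding a_def[symmetric]
        by (intro mult_mono mult_nonneg_nonneg) auto
      also have "2 * a * (2 / a ^ 3) = 4 / a\<^sup>2" using a by (simp add: power3_eq_cube power2_eq_square)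
      finally show ?thesis .
    qed
    have b2: "\<bar>real k * l ^ (k - 1) * (I 1 + l / (2 * a\<^sup>2))\<bar> \<le> real k * (1 + l) ^ (k - 1) * (90 / a\<^sup>2)"
    proof -
      have "\<bar>real k * l ^ (k - 1) * (I 1 + l / (2 * a\<^sup>2))\<bar> = real k * l ^ (k - 1) * \<bar>I 1 + l / (2 * a\<^sup>2)\<bar>"
        using l by (simp add: abs_mult)
      also have "\<dots> \<le> real k * (1 + l) ^ (k - 1) * (90 / a\<^sup>2)"
        using l p log_jump_first_moment[OF z] unfolding I_def l_def a_def
        by (intro mult_mono mult_nonneg_nonneg) auto
      finally show ?thesis .
    qed
    have b3: "\<bar>R\<bar> \<le> (\<Sum>j\<in>{2..k}. real (k choose j) * c j) * ((1 + l) ^ (k - 1) / a\<^sup>2)"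
    proof -
      have "\<bar>R\<bar> \<le> (\<Sum>j\<in>{2..k}. \<bar>real (k choose j) * l ^ (k - j) * I j\<bar>)" unfolding R_def by (rule sum_abs)
      also have "\<dots> \<le> (\<Sum>j\<in>{2..k}. real (k choose j) * c j * ((1 + l) ^ (k - 1) / a\<^sup>2))"
      proof (rule sum_mono)
        fix j assume j: "j \<in> {2..k}"
        have "\<bar>real (k choose j) * l ^ (k - j) * I j\<bar> = real (k choose j) * l ^ (k - j) * \<bar>I j\<bar>"
          using l by (simp add: abs_mult)
        also have "\<dots> \<le> real (k choose j) * (1 + l) ^ (k - j) * (c j * (1 + l) / a\<^sup>2)"
          using j l log_jump_higher_moment[OF z, of j] unfolding I_def l_def a_def c_def
          by (intro mult_mono power_mono mult_nonneg_nonneg) auto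
        also have "\<dots> = real (k choose j) * c j * ((1 + l) ^ Suc (k - j) / a\<^sup>2)" by simp
        also have "\<dots> \<le> real (k choose j) * c j * ((1 + l) ^ (k - 1) / a\<^sup>2)"
          using j l c by (intro mult_left_mono divide_right_mono power_increasing) auto
        finally show "\<bar>real (k choose j) * l ^ (k - j) * I j\<bar> \<le> real (k choose j) * c j * ((1 + l) ^ (k - 1) / a\<^sup>2)" .
      qed
      finally show ?thesis unfolding sum_distrib_right .
    qed
    have C0_split: "C0 * ((1 + l) ^ (k - 1) / a\<^sup>2) = real k * (1 + l) ^ (k - 1) * (4 / a\<^sup>2) + real k * (1 + l) ^ (k - 1) * (90 / a\<^sup>2)
       + (\<Sum>j\<in>{2..k}. real (k choose j) * c j) * ((1 + l) ^ (k - 1) / a\<^sup>2)"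
      unfolding C0_def by (simp add: algebra_simps)
    have "\<bar>l ^ k - step (log_pow k) z - (2 * real k + 1) * (tail z * l ^ k)\<bar>
        \<le> C0 * ((1 + l) ^ (k - 1) / a\<^sup>2)"
    proof -
      have tri: "\<bar>- x - y - w\<bar> \<le> u + v + q" if "\<bar>x\<bar> \<le> u" "\<bar>y\<bar> \<le> v" "\<bar>w\<bar> \<le> q" for x y w u v q :: real
        using that by linarith
      show ?thesis unfolding e C0_split by (rule tri[OF b1 b2 b3])
    qed
    then show ?thesis by (simp only: l_def a_def)
  qed
  show ?thesis
  proof (rule that[of "4 * C0"])
    fix z :: real assume z: "0 \<le> z"
    have "C0 * ((1 + ln (1 + z)) ^ (k - 1) / (1 + z)\<^sup>2) = C0 * (1 + ln (1 + z)) ^ (k - 1) * (1 / (1 + z)\<^sup>2)" by simp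
    also have "\<dots> \<le> C0 * (1 + ln (1 + z)) ^ (k - 1) * (4 * tail z)"
      using z C0 by (intro mult_left_mono weight_le_tail) auto
    also have "\<dots> = 4 * C0 * (tail z * (1 + ln (1 + z)) ^ (k - 1))" by simp
    finally show "\<bar>step_error k z\<bar>
      \<le> 4 * C0 * (tail z * (1 + ln (1 + z)) ^ (k - 1))"
      by (rule order_trans[OF main[OF z]])
  qed (use C0 in auto)
qed

lemma step_measurable [measurable]:
  assumes [measurable]: "g \<in> borel_measurable borel"
  shows "step g \<in> borel_measurable borel"
proof -
  have "(\<lambda>z. \<integral>x. (if x \<le> z then 1 else 0) * g (z - x) \<partial>jump_law) \<in> borel_measurable borel"
    by measurable
  then show ?thesis unfolding step_def[abs_def] by (simp add: indicator_def)
qed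

lemma tail_le_1: "tail z \<le> 1"
  using tail_pos[of "- z"] by (simp add: tail_minus)

lemma one_plus_power_le: "0 \<le> l \<Longrightarrow> (1 + l) ^ m \<le> 2 ^ m * (1 + l ^ m)" for l :: real
proof (cases "l \<le> 1")
  case True
  assume "0 \<le> l"
  then have "(1 + l) ^ m \<le> 2 ^ m" using True by (intro power_mono) auto
  also have "\<dots> \<le> 2 ^ m * (1 + l ^ m)" using \<open>0 \<le> l\<close> by simp
  finally show ?thesis .
next
  case False
  then have "(1 + l) ^ m \<le> (2 * l) ^ m" by (intro power_mono) auto
  also have "\<dots> \<le> 2 ^ m * (1 + l ^ m)" by (simp add: power_mult_distrib)
  finally show ?thesis .
qed

lemma power_pred_le: "0 \<le> l \<Longrightarrow> l ^ (k - 1) \<le> 1 + l ^ k" for l :: real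
proof (cases "l \<le> 1")
  case True
  assume "0 \<le> l"
  then have "l ^ (k - 1) \<le> 1" "0 \<le> l ^ k" using True by (auto simp: power_le_one)
  then show ?thesis by linarith
next
  case False
  then have "l ^ (k - 1) \<le> l ^ k" by (intro power_increasing) auto
  then show ?thesis by linarith
qed

lemma step_one: "step (log_pow 0) z = 1 - tail z"
  by (simp add: step_def)

text \<open>This crude bound is used only to see that powers of the logarithm stay integrable along the walk.\<close>

lemma step_log_pow_bounded:
  obtains B where "0 \<le> B" "\<And>z. 0 \<le> z \<Longrightarrow> \<bar>step (log_pow k) z\<bar> \<le> B * (1 + log_pow k z)"
proof (cases "k = 0")
  case True
  show ?thesis
  proof (rule that[of 1])
    fix z :: real assume "0 \<le> z"
    have "\<bar>1 - tail z\<bar> \<le> 2" using tail_pos[of z] tail_le_1[of z] by linarith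
    then show "\<bar>step (log_pow k) z\<bar> \<le> 1 * (1 + log_pow k z)"
      using True step_one[of z] by simp
  qed simp
next
  case False
  then have k: "1 \<le> k" by simp
  from step_log_power_expansion[OF this] obtain C where C: "0 \<le> C"
    "\<And>z. 0 \<le> z \<Longrightarrow> \<bar>step_error k z\<bar>
      \<le> C * (tail z * (1 + ln (1 + z)) ^ (k - 1))" by blast
  \<comment> \<open>\<open>2 k + 1\<close> from the drift and \<open>1\<close> from the function itself; the last summand bounds the error\<close>
  show ?thesis
  proof (rule that[of "(2 * real k + 2) + C * 2 ^ (k - 1) * 2"])
    fix z :: real assume z: "0 \<le> z"
    define l where "l = ln (1 + z)"
    have l: "0 \<le> l" using z by (simp add: l_def)
    have t: "0 \<le> tail z" "tail z \<le> 1" using tail_pos[of z] tail_le_1[of z] by auto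
    have "(1 + l) ^ (k - 1) \<le> 2 ^ (k - 1) * (1 + l ^ (k - 1))" by (rule one_plus_power_le[OF l])
    also have "\<dots> \<le> 2 ^ (k - 1) * (1 + (1 + l ^ k))" by (intro mult_left_mono add_left_mono power_pred_le l) auto
    also have "\<dots> \<le> 2 ^ (k - 1) * (2 * (1 + l ^ k))" using l by (intro mult_left_mono) auto
    also have "\<dots> = 2 ^ (k - 1) * 2 * (1 + l ^ k)" by (simp only: mult.assoc)
    finally have p: "(1 + l) ^ (k - 1) \<le> 2 ^ (k - 1) * 2 * (1 + l ^ k)" .
    have "C * (tail z * (1 + l) ^ (k - 1)) \<le> C * (1 * (2 ^ (k - 1) * 2 * (1 + l ^ k)))"
      using C(1) t l p by (intro mult_left_mono mult_mono) auto
    then have e: "\<bar>l ^ k - step (log_pow k) z - (2 * real k + 1) * (tail z * l ^ k)\<bar> \<le> C * 2 ^ (k - 1) * 2 * (1 + l ^ k)"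
      using C(2)[OF z] unfolding l_def by simp
    have "0 \<le> l ^ k" using l by simp
    have "(2 * real k + 1) * (tail z * l ^ k) \<le> (2 * real k + 1) * (1 * l ^ k)"
      using t l by (intro mult_left_mono mult_right_mono) auto
    moreover have "0 \<le> (2 * real k + 1) * (tail z * l ^ k)" using t l by simp
    ultimately have "\<bar>step (log_pow k) z\<bar> \<le> l ^ k + (2 * real k + 1) * l ^ k + C * 2 ^ (k - 1) * 2 * (1 + l ^ k)"
      using e \<open>0 \<le> l ^ k\<close> by linarith
    also have "\<dots> \<le> ((2 * real k + 2) + C * 2 ^ (k - 1) * 2) * (1 + l ^ k)"
      by (simp add: algebra_simps)
    finally show "\<bar>step (log_pow k) z\<bar> \<le> ((2 * real k + 2) + C * 2 ^ (k - 1) * 2) * (1 + log_pow k z)"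
      unfolding l_def .
  qed (use C in auto)
qed

section \<open>Rewards for leaving by one jump\<close>

text \<open>Asymptotically the tail is homogeneous of degree \<open>-2\<close>.\<close>

lemma tail_scaling:
  assumes z: "0 \<le> z" and b: "0 < b" "b \<le> 1"
  shows "\<bar>tail (z / b) - b\<^sup>2 * tail z\<bar> \<le> 8 / (1 + z) ^ 3"
proof (cases "1 \<le> z")
  case False
  have "tail x \<le> 1" for x using tail_pos[of "- x"] by (simp add: tail_minus)
  then have "tail (z / b) \<le> 1" "b\<^sup>2 * tail z \<le> 1"
    using b by (auto intro!: mult_le_one power_le_one less_imp_le[OF tail_pos])
  moreover have "0 \<le> tail (z / b)" "0 \<le> b\<^sup>2 * tail z" by (auto simp: less_imp_le[OF tail_pos])
  ultimately have "\<bar>tail (z / b) - b\<^sup>2 * tail z\<bar> \<le> 1" by linarith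
  also have "1 \<le> 8 / (1 + z) ^ 3"
    using power_mono[of "1 + z" 2 3] False z by simp
  finally show ?thesis .
next
  case True
  have b2: "b\<^sup>2 \<le> 1" "0 < b\<^sup>2" using b by (auto simp: power_le_one)
  have 1: "tail (z / b) \<le> b\<^sup>2 / (4 * z\<^sup>2)" using tail_upper[of "z / b"] True b by (simp add: power_divide)
  have "b\<^sup>2 / (4 * (1 + z\<^sup>2)) \<le> b\<^sup>2 / (4 * (b\<^sup>2 + z\<^sup>2))"
    using b2 by (intro divide_left_mono mult_left_mono add_mono mult_pos_pos add_pos_nonneg) auto
  also have "\<dots> = 1 / (4 * (1 + (z / b)\<^sup>2))" using b by (simp add: field_simps power2_eq_square)
  also have "\<dots> \<le> tail (z / b)" by (rule tail_lower) (use z b in auto)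
  finally have 2: "b\<^sup>2 / (4 * (1 + z\<^sup>2)) \<le> tail (z / b)" .
  have 3: "b\<^sup>2 * tail z \<le> b\<^sup>2 / (4 * z\<^sup>2)" using mult_left_mono[OF tail_upper[of z], of "b\<^sup>2"] True by simp
  have 4: "b\<^sup>2 / (4 * (1 + z\<^sup>2)) \<le> b\<^sup>2 * tail z" using mult_left_mono[OF tail_lower[OF z], of "b\<^sup>2"] by simp
  have "\<bar>tail (z / b) - b\<^sup>2 * tail z\<bar> \<le> b\<^sup>2 / (4 * z\<^sup>2) - b\<^sup>2 / (4 * (1 + z\<^sup>2))" using 1 2 3 4 by linarith
  also have "\<dots> = b\<^sup>2 / (4 * (z\<^sup>2 * (1 + z\<^sup>2)))"
  proof -
    have *: "c / (4 * w) - c / (4 * (1 + w)) = c / (4 * (w * (1 + w)))" if "0 < w" for c w :: real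
      using that by (simp add: divide_simps) (simp add: algebra_simps)
    show ?thesis by (rule *) (use True in auto)
  qed
  also have "\<dots> \<le> 1 / (4 * ((1 + z) ^ 3 / 8))"
  proof (intro frac_le mult_left_mono)
    have "z\<^sup>2 * (1 + z\<^sup>2) \<ge> z ^ 3"
    proof -
      have "z * 1 \<le> z * z" using True by (intro mult_left_mono) auto
      then have "z \<le> 1 + z\<^sup>2" by (simp add: power2_eq_square)
      then show ?thesis by (simp add: power3_eq_cube power2_eq_square mult.assoc mult_left_mono True z)
    qed
    moreover have "((1 + z) / 2) ^ 3 \<le> z ^ 3" using True by (intro power_mono) auto
    ultimately show "(1 + z) ^ 3 / 8 \<le> z\<^sup>2 * (1 + z\<^sup>2)" by (simp add: power_divide)
  qed (use z b2 in auto)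
  also have "\<dots> \<le> 8 / (1 + z) ^ 3" using z by (simp add: field_simps)
  finally show ?thesis .
qed

lemma tail_lipschitz:
  assumes b: "0 < b" "b \<le> 1" and pq: "0 \<le> p" "p \<le> q"
  shows "tail (p / b) - tail (q / b) \<le> 2 / b * ((q - p) / (1 + p) ^ 3)"
proof (cases "p = q")
  case False
  then have "p / b < q / b" using b pq by (simp add: divide_strict_right_mono)
  from MVT2[OF this DERIV_tail] obtain \<xi> where \<xi>: "p / b < \<xi>" "tail (q / b) - tail (p / b) = (q / b - p / b) * - jump_density \<xi>"
    by blast
  have "p \<le> p / b" using b pq by (simp add: pos_le_divide_eq mult_left_le)
  then have "p \<le> \<xi>" using \<xi> by simp
  then have "2 / (1 + \<bar>\<xi>\<bar>) ^ 3 \<le> 2 / (1 + p) ^ 3"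
    using pq by (intro divide_left_mono power_mono mult_pos_pos zero_less_power) auto
  then have "jump_density \<xi> \<le> 2 / (1 + p) ^ 3" using jump_density_bound[of \<xi>] by linarith
  then have "(q / b - p / b) * jump_density \<xi> \<le> (q / b - p / b) * (2 / (1 + p) ^ 3)"
    using \<open>p / b < q / b\<close> by (intro mult_left_mono) auto
  also have "\<dots> = 2 / b * ((q - p) / (1 + p) ^ 3)" by (simp add: diff_divide_distrib[symmetric])
  finally show ?thesis using \<xi>(2) by simp
qed auto

text \<open>For \<open>c = tail w\<close> this is the probability that the next jump of a walk at distance \<open>z\<close> below the level
  is at least \<open>z / b\<close> and at most \<open>w\<close>.\<close>

definition exit_reward :: "real \<Rightarrow> real \<Rightarrow> real \<Rightarrow> real" where
  "exit_reward b c z = max 0 (tail (z / b) - c)"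

lemma exit_reward_measurable [measurable]: "exit_reward b c \<in> borel_measurable borel"
  unfolding exit_reward_def by measurable

lemma exit_reward_nonneg: "0 \<le> exit_reward b c z"
  by (simp add: exit_reward_def)

lemma exit_reward_le_tail:
  assumes "0 < b" "b \<le> 1" "0 \<le> c" "0 \<le> z"
  shows "exit_reward b c z \<le> tail z"
proof -
  have "z \<le> z / b" using assms by (simp add: pos_le_divide_eq mult_left_le)
  then have "tail (z / b) \<le> tail z" by (rule tail_antimono)
  then show ?thesis using assms tail_pos[of z] by (simp add: exit_reward_def)
qed

text \<open>The reward has slope \<open>O((1 + z)\<^sup>-\<^sup>3)\<close>, which handles jumps up to half the distance; jumps
  close to the level have density \<open>O((1 + z)\<^sup>-\<^sup>3)\<close> and meet an integrable reward. The constant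
  is uniform in \<open>c\<close>, so that \<open>c\<close> may vary with the level.\<close>

theorem exit_reward_almost_harmonic:
  assumes b: "0 < b" "b \<le> 1"
  obtains C where "0 \<le> C"
    "\<And>c z. 0 \<le> c \<Longrightarrow> 0 \<le> z \<Longrightarrow> \<bar>exit_reward b c z - step (exit_reward b c) z\<bar> \<le> C / (1 + z) ^ 3"
proof -
  define m where "m = (\<integral>x. \<bar>x\<bar> \<partial>jump_law)"
  have m: "0 \<le> m" by (simp add: m_def)
  show ?thesis
  proof (rule that[of "16 / b * m + 16 + 1"])
    fix c z :: real assume c: "0 \<le> c" and z: "0 \<le> z"
    let ?r = "exit_reward b c"
    define D where "D = (\<lambda>x. ?r z - indicator {..z} x * ?r (z - x))"
    have [measurable]: "D \<in> borel_measurable borel" unfolding D_def by measurable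
    have r1: "?r d \<le> 1 / (1 + d)\<^sup>2" if "0 \<le> d" for d
      using exit_reward_le_tail[OF b c that] tail_le_weight[OF that] by linarith
    have r2: "?r q \<le> ?r p" if "p \<le> q" for p q
    proof -
      have "tail (q / b) \<le> tail (p / b)" using that b by (intro tail_antimono divide_right_mono) auto
      then show ?thesis by (simp add: exit_reward_def)
    qed
    have r3: "?r p - ?r q \<le> 2 / b * ((q - p) / (1 + p) ^ 3)" if "0 \<le> p" "p \<le> q" for p q
    proof -
      have "tail (q / b) \<le> tail (p / b)" using that b by (intro tail_antimono divide_right_mono) auto
      then have "?r p - ?r q \<le> tail (p / b) - tail (q / b)" by (simp add: exit_reward_def)
      then show ?thesis using tail_lipschitz[OF b that] by linarith
    qed
    define B where "B = (\<lambda>x. 16 / b / (1 + z) ^ 3 * \<bar>x\<bar> + indicator {z/2..z} x * (1 / (1 + z - x)\<^sup>2) + indicator {z<..} x * (1 / (1 + z)\<^sup>2))"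
    have DB: "\<bar>D x\<bar> \<le> B x" for x
    proof -
      consider "x \<le> z / 2" | "z / 2 < x" "x \<le> z" | "z < x" by linarith
      then show ?thesis
      proof cases
        case 1
        have xz: "x \<le> z" using 1 z by linarith
        define p q where "p = min z (z - x)" and "q = max z (z - x)"
        have pq: "0 \<le> p" "p \<le> q" "q - p = \<bar>x\<bar>" "z / 2 \<le> p" using 1 z by (auto simp: p_def q_def)
        have "\<bar>D x\<bar> = \<bar>?r z - ?r (z - x)\<bar>" using xz by (simp add: D_def)
        also have "\<dots> = ?r p - ?r q" using r2[of p q] pq(2) by (auto simp: p_def q_def min_def max_def)
        also have "\<dots> \<le> 2 / b * (\<bar>x\<bar> / (1 + p) ^ 3)" using r3[OF pq(1,2)] pq(3) by simp
        also have "\<dots> \<le> 2 / b * (\<bar>x\<bar> / ((1 + z) / 2) ^ 3)"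
          using pq b z by (intro mult_left_mono divide_left_mono power_mono mult_pos_pos zero_less_power) auto
        also have "\<dots> = 16 / b / (1 + z) ^ 3 * \<bar>x\<bar>" by (simp add: power_divide)
        also have "\<dots> \<le> B x" using z by (simp add: B_def)
        finally show ?thesis .
      next
        case 2
        have xz: "0 \<le> x" "0 \<le> z - x" using 2 z by auto
        have "\<bar>D x\<bar> = ?r (z - x) - ?r z" using 2 r2[of "z - x" z] xz by (simp add: D_def)
        also have "\<dots> \<le> ?r (z - x)" by (simp add: exit_reward_nonneg)
        also have "\<dots> \<le> 1 / (1 + (z - x))\<^sup>2" by (rule r1[OF xz(2)])
        also have "\<dots> \<le> B x" using 2 z b by (simp add: B_def add_diff_eq)
        finally show ?thesis .
      next
        case 3
        have "\<bar>D x\<bar> = ?r z" using 3 by (simp add: D_def exit_reward_nonneg)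
        also have "\<dots> \<le> 1 / (1 + z)\<^sup>2" by (rule r1[OF z])
        also have "\<dots> \<le> B x" using 3 z b by (simp add: B_def)
        finally show ?thesis .
      qed
    qed
    have rb: "norm (indicator {..z} x * ?r (z - x)) \<le> 1" for x
    proof (cases "x \<le> z")
      case True
      then have "?r (z - x) \<le> 1 / (1 + (z - x))\<^sup>2" by (intro r1) auto
      also have "\<dots> \<le> 1" using one_le_power[of "1 + (z - x)" 2] True by simp
      finally show ?thesis by (simp add: indicator_def exit_reward_nonneg)
    qed auto
    have int: "integrable jump_law (\<lambda>x. indicator {..z} x * ?r (z - x))"
      by (rule jump_law.integrable_const_bound[of _ 1]) (use rb in auto)
    then have intD: "integrable jump_law D" unfolding D_def by auto
    have e: "?r z - step ?r z = (\<integral>x. D x \<partial>jump_law)"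
      unfolding D_def step_def using int by (subst Bochner_Integration.integral_diff) (auto simp: jump_law.prob_space[simplified])
    have "(\<integral>\<^sup>+x. indicator {z/2..z} x * ennreal (1 / (1 + z - x)\<^sup>2) \<partial>jump_law)
       = (\<integral>\<^sup>+x. ennreal (jump_density x) * (indicator {z/2..z} x * ennreal (1 / (1 + z - x)\<^sup>2)) \<partial>lborel)"
      by (rule nn_integral_jump_law) auto
    also have "\<dots> \<le> (\<integral>\<^sup>+x. ennreal (16 / (1 + z) ^ 3) * (ennreal (1 / (1 + z - x)\<^sup>2) * indicator {z/2..z} x) \<partial>lborel)"
    proof (rule nn_integral_mono)
      fix x
      show "ennreal (jump_density x) * (indicator {z/2..z} x * ennreal (1 / (1 + z - x)\<^sup>2))
        \<le> ennreal (16 / (1 + z) ^ 3) * (ennreal (1 / (1 + z - x)\<^sup>2) * indicator {z/2..z} x)"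
      proof (cases "x \<in> {z/2..z}")
        case True
        then have x0: "0 \<le> x" using z by auto
        have "((1 + z) / 2) ^ 3 \<le> (1 + x) ^ 3" using True z by (intro power_mono) auto
        then have "2 / (1 + x) ^ 3 \<le> 2 / ((1 + z) / 2) ^ 3" using x0 z
          by (intro divide_left_mono) auto
        then have "jump_density x \<le> 16 / (1 + z) ^ 3" using jump_density_bound[of x] x0
          by (simp add: power_divide)
        then show ?thesis using True by (auto intro!: mult_right_mono ennreal_leI)
      qed auto
    qed
    also have "\<dots> = ennreal (16 / (1 + z) ^ 3) * (\<integral>\<^sup>+x. (ennreal (1 / (1 + z - x)\<^sup>2) * indicator {z/2..z} x) \<partial>lborel)"
      by (rule nn_integral_cmult) auto
    also have "(\<integral>\<^sup>+x. (ennreal (1 / (1 + z - x)\<^sup>2) * indicator {z/2..z} x) \<partial>lborel) = ennreal (1 / (1 + z - z) - 1 / (1 + z - z / 2))"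
    proof (rule nn_integral_FTC_Icc)
      fix x assume "x \<in> {z/2..z}"
      then have "1 + z - x \<noteq> 0" by auto
      then show "((\<lambda>x. 1 / (1 + z - x)) has_real_derivative 1 / (1 + z - x)\<^sup>2) (at x)"
        by (auto intro!: derivative_eq_intros simp: power2_eq_square)
    qed (use z in auto)
    also have "ennreal (16 / (1 + z) ^ 3) * ennreal (1 / (1 + z - z) - 1 / (1 + z - z / 2)) \<le> ennreal (16 / (1 + z) ^ 3) * ennreal 1"
      using z by (intro mult_left_mono ennreal_leI) auto
    finally have i2: "(\<integral>\<^sup>+x. indicator {z/2..z} x * ennreal (1 / (1 + z - x)\<^sup>2) \<partial>jump_law) \<le> ennreal (16 / (1 + z) ^ 3)"
      by simp
    have i1: "(\<integral>\<^sup>+x. ennreal (16 / b / (1 + z) ^ 3 * \<bar>x\<bar>) \<partial>jump_law) = ennreal (16 / b * m / (1 + z) ^ 3)"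
      using b z integrable_abs_jump_law by (subst nn_integral_eq_integral) (auto simp: m_def)
    have i3: "(\<integral>\<^sup>+x. indicator {z<..} x * ennreal (1 / (1 + z)\<^sup>2) \<partial>jump_law) \<le> ennreal (1 / (1 + z) ^ 3)"
    proof -
      have "(\<integral>\<^sup>+x. indicator {z<..} x * ennreal (1 / (1 + z)\<^sup>2) \<partial>jump_law) = ennreal (tail z * (1 / (1 + z)\<^sup>2))"
        by (simp add: nn_integral_multc emeasure_jump_law_greater ennreal_mult'[symmetric] less_imp_le[OF tail_pos])
      also have "tail z * (1 / (1 + z)\<^sup>2) \<le> 1 / (1 + z)\<^sup>2 * (1 / (1 + z)\<^sup>2)"
        by (intro mult_right_mono tail_le_weight z) auto
      also have "\<dots> = 1 / (1 + z) ^ 4" by (simp add: power2_eq_square eval_nat_numeral)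
      also have "\<dots> \<le> 1 / (1 + z) ^ 3"
        using z by (intro divide_left_mono power_increasing mult_pos_pos zero_less_power) auto
      finally show ?thesis by (simp add: ennreal_leI)
    qed
    have "ennreal (norm (\<integral>x. D x \<partial>jump_law)) \<le> (\<integral>\<^sup>+x. ennreal (norm (D x)) \<partial>jump_law)"
      by (rule integral_norm_bound_ennreal[OF intD])
    also have "\<dots> \<le> (\<integral>\<^sup>+x. (ennreal (16 / b / (1 + z) ^ 3 * \<bar>x\<bar>) + indicator {z/2..z} x * ennreal (1 / (1 + z - x)\<^sup>2)) + indicator {z<..} x * ennreal (1 / (1 + z)\<^sup>2) \<partial>jump_law)"
    proof (rule nn_integral_mono)
      fix x
      have "ennreal (norm (D x)) \<le> ennreal (B x)" using DB[of x] by (simp add: ennreal_leI)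
      also have "\<dots> = (ennreal (16 / b / (1 + z) ^ 3 * \<bar>x\<bar>) + indicator {z/2..z} x * ennreal (1 / (1 + z - x)\<^sup>2)) + indicator {z<..} x * ennreal (1 / (1 + z)\<^sup>2)"
        using b z unfolding B_def by (auto simp: indicator_def ennreal_plus[symmetric] simp del: ennreal_plus)
      finally show "ennreal (norm (D x)) \<le> (ennreal (16 / b / (1 + z) ^ 3 * \<bar>x\<bar>) + indicator {z/2..z} x * ennreal (1 / (1 + z - x)\<^sup>2)) + indicator {z<..} x * ennreal (1 / (1 + z)\<^sup>2)" .
    qed
    also have "\<dots> = ((\<integral>\<^sup>+x. ennreal (16 / b / (1 + z) ^ 3 * \<bar>x\<bar>) \<partial>jump_law) + (\<integral>\<^sup>+x. indicator {z/2..z} x * ennreal (1 / (1 + z - x)\<^sup>2) \<partial>jump_law))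
        + (\<integral>\<^sup>+x. indicator {z<..} x * ennreal (1 / (1 + z)\<^sup>2) \<partial>jump_law)"
      by (subst nn_integral_add, simp, simp, subst nn_integral_add, simp, simp, simp)
    also have "\<dots> \<le> (ennreal (16 / b * m / (1 + z) ^ 3) + ennreal (16 / (1 + z) ^ 3)) + ennreal (1 / (1 + z) ^ 3)"
      unfolding i1 by (intro add_mono i2 i3 order_refl)
    also have "\<dots> = ennreal ((16 / b * m + 16 + 1) / (1 + z) ^ 3)"
      using b z m by (simp add: ennreal_plus[symmetric] add_divide_distrib del: ennreal_plus)
    finally show "\<bar>?r z - step ?r z\<bar> \<le> (16 / b * m + 16 + 1) / (1 + z) ^ 3"
      unfolding e by (subst (asm) ennreal_le_iff) (use b z m in auto)
  qed (use m b in auto)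
qed

section \<open>The square-root law and alternating sums\<close>

lemma has_integral_even_power:
  "((\<lambda>x::real. (x\<^sup>2) ^ k) has_integral 1 / (2 * real k + 1)) {0..1}"
proof -
  have "((\<lambda>x::real. x ^ (2 * k)) has_integral (1 ^ Suc (2 * k) / (2 * real k + 1) - 0 ^ Suc (2 * k) / (2 * real k + 1))) {0..1}"
  proof (rule fundamental_theorem_of_calculus)
    fix x :: real
    have "((\<lambda>x. x ^ Suc (2 * k)) has_real_derivative real (Suc (2 * k)) * x ^ (2 * k)) (at x within {0..1})"
      using DERIV_pow[of "Suc (2 * k)" x "{0..1}"] by simp
    from DERIV_cdivide[OF this, of "2 * real k + 1"]
    have "((\<lambda>x. x ^ Suc (2 * k) / (2 * real k + 1)) has_real_derivative x ^ (2 * k)) (at x within {0..1})"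
    proof (rule DERIV_cong)
      have "2 * real k + 1 \<noteq> 0" by linarith
      then show "real (Suc (2 * k)) * x ^ (2 * k) / (2 * real k + 1) = x ^ (2 * k)"
        by (simp add: add.commute)
    qed
    then show "((\<lambda>x. x ^ Suc (2 * k) / (2 * real k + 1)) has_vector_derivative x ^ (2 * k)) (at x within {0..1})"
      by (simp add: has_real_derivative_iff_has_vector_derivative[symmetric])
  qed simp
  then show ?thesis by (simp add: power_mult)
qed

context prob_space
begin

text \<open>The limit law lives on \<open>[0, 1]\<close>: as high moments tend to \<open>0\<close> with the order, the part of the
  \<open>k\<close>-th moment beyond \<open>1\<close> is bounded by the \<open>m\<close>-th moment, whose limit \<open>1 / (2 m + 1)\<close> can be made
  arbitrarily small.\<close>

lemma truncated_moments_tendsto: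
  fixes V :: "'i \<Rightarrow> 'a \<Rightarrow> real"
  assumes V [measurable]: "\<And>i. V i \<in> borel_measurable M"
    and nonneg: "\<forall>\<^sub>F i in F. \<forall>\<omega>\<in>space M. 0 \<le> V i \<omega>"
    and int: "\<And>k. \<forall>\<^sub>F i in F. integrable M (\<lambda>\<omega>. V i \<omega> ^ k)"
    and mom: "\<And>k. ((\<lambda>i. expectation (\<lambda>\<omega>. V i \<omega> ^ k)) \<longlongrightarrow> 1 / (2 * real k + 1)) F"
  shows "((\<lambda>i. expectation (\<lambda>\<omega>. min 1 (V i \<omega>) ^ k)) \<longlongrightarrow> 1 / (2 * real k + 1)) F"
proof (rule tendstoI)
  fix e :: real assume e: "0 < e"
  obtain m0 where m0: "1 / e < real m0" using reals_Archimedean2 by blast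
  define m where "m = max k m0"
  have m: "k \<le> m" "1 / (2 * real m + 1) < e"
  proof -
    have "1 / e < 2 * real m + 1" using m0 by (simp add: m_def)
    then show "1 / (2 * real m + 1) < e" using e by (simp add: field_simps)
  qed (simp add: m_def)
  define d where "d = (e - 1 / (2 * real m + 1)) / 2"
  have d: "0 < d" using m by (simp add: d_def)
  have "\<forall>\<^sub>F i in F. dist (expectation (\<lambda>\<omega>. V i \<omega> ^ k)) (1 / (2 * real k + 1)) < d" by (rule tendstoD[OF mom d])
  moreover have "\<forall>\<^sub>F i in F. dist (expectation (\<lambda>\<omega>. V i \<omega> ^ m)) (1 / (2 * real m + 1)) < d" by (rule tendstoD[OF mom d])
  ultimately show "\<forall>\<^sub>F i in F. dist (expectation (\<lambda>\<omega>. min 1 (V i \<omega>) ^ k)) (1 / (2 * real k + 1)) < e"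
    using nonneg int[of k] int[of m]
  proof eventually_elim
    case (elim i)
    have iw: "integrable M (\<lambda>\<omega>. min 1 (V i \<omega>) ^ k)"
      by (rule integrable_const_bound[of _ 1]) (use elim(3) in \<open>auto simp: power_le_one abs_le_iff intro!: AE_I2 power_le_one order_trans[OF _ zero_le_power]\<close>)
    have pw: "\<bar>V i \<omega> ^ k - min 1 (V i \<omega>) ^ k\<bar> \<le> V i \<omega> ^ m" if "\<omega> \<in> space M" for \<omega>
    proof (cases "V i \<omega> \<le> 1")
      case True then show ?thesis using elim(3) that by (auto simp: min_def)
    next
      case False
      then have "1 \<le> V i \<omega> ^ k" "V i \<omega> ^ k \<le> V i \<omega> ^ m" using m by (auto intro: power_increasing)
      moreover have "min 1 (V i \<omega>) ^ k = 1" using False by (simp add: min_def)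
      ultimately show ?thesis by linarith
    qed
    have "\<bar>expectation (\<lambda>\<omega>. V i \<omega> ^ k) - expectation (\<lambda>\<omega>. min 1 (V i \<omega>) ^ k)\<bar>
        = \<bar>expectation (\<lambda>\<omega>. V i \<omega> ^ k - min 1 (V i \<omega>) ^ k)\<bar>"
      using elim iw by (subst Bochner_Integration.integral_diff) auto
    also have "\<dots> \<le> expectation (\<lambda>\<omega>. V i \<omega> ^ m)"
      using elim iw pw by (intro order_trans[OF integral_abs_bound] integral_mono) auto
    finally have "\<bar>expectation (\<lambda>\<omega>. V i \<omega> ^ k) - expectation (\<lambda>\<omega>. min 1 (V i \<omega>) ^ k)\<bar> \<le> expectation (\<lambda>\<omega>. V i \<omega> ^ m)" .
    then show ?case using elim(1,2) unfolding dist_real_def d_def by argo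
  qed
qed

text \<open>A continuous function between the indicators of \<open>x \<le> a\<close> and \<open>x \<le> a + \<delta>\<close> is approximated by a polynomial
  on \<open>[0, 1]\<close>. The limit of the expectation of a polynomial \<open>p\<close> is the integral of \<open>p (x\<^sup>2)\<close> over the unit
  interval, because this holds for powers.\<close>

lemma square_root_law_bounds:
  fixes V :: "'i \<Rightarrow> 'a \<Rightarrow> real"
  assumes V [measurable]: "\<And>i. V i \<in> borel_measurable M"
    and nonneg: "\<forall>\<^sub>F i in F. \<forall>\<omega>\<in>space M. 0 \<le> V i \<omega>"
    and int: "\<And>k. \<forall>\<^sub>F i in F. integrable M (\<lambda>\<omega>. V i \<omega> ^ k)"
    and mom: "\<And>k. ((\<lambda>i. expectation (\<lambda>\<omega>. V i \<omega> ^ k)) \<longlongrightarrow> 1 / (2 * real k + 1)) F"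
    and a: "0 \<le> a" "0 < \<delta>" "a + \<delta> < 1" and \<eta>: "0 < \<eta>"
  shows "\<forall>\<^sub>F i in F. prob {\<omega>\<in>space M. V i \<omega> \<le> a} \<le> sqrt (a + \<delta>) + 3 * \<eta>
      \<and> sqrt a - 3 * \<eta> \<le> prob {\<omega>\<in>space M. V i \<omega> \<le> a + \<delta>}"
proof -
  \<comment> \<open>continuous, \<open>1\<close> up to \<open>a\<close> and \<open>0\<close> from \<open>a + \<delta>\<close> on\<close>
  define g where "g = (\<lambda>x. max 0 (min 1 ((a + \<delta> - x) / \<delta>)))"
  have g_cont: "continuous_on S g" for S unfolding g_def using a by (intro continuous_intros) auto
  have g1: "g x = 1" if "x \<le> a" for x using that a by (auto simp: g_def field_simps)
  have g0: "g x = 0" if "a + \<delta> \<le> x" for x using that a by (auto simp: g_def divide_nonpos_pos)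
  have g01: "0 \<le> g x" "g x \<le> 1" for x by (auto simp: g_def)
  obtain p where p: "real_polynomial_function p" "\<And>x. x \<in> {0..1::real} \<Longrightarrow> \<bar>g x - p x\<bar> < \<eta>"
    using Stone_Weierstrass_real_polynomial_function[OF compact_Icc g_cont \<eta>] by blast
  obtain c n where pc: "p = (\<lambda>x. \<Sum>i\<le>n. c i * x ^ i)"
    using p(1) unfolding real_polynomial_function_iff_sum by blast
  define W where "W = (\<lambda>i \<omega>. min 1 (V i \<omega>))"
  have [measurable]: "W i \<in> borel_measurable M" for i unfolding W_def by measurable
  define L where "L = (\<Sum>i\<le>n. c i * (1 / (2 * real i + 1)))"
  have L: "((\<lambda>x. p (x\<^sup>2)) has_integral L) {0..1}"
    unfolding pc L_def by (intro has_integral_sum has_integral_mult_right has_integral_even_power) auto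
  have sqa: "sqrt a \<le> 1" "sqrt (a + \<delta>) \<le> 1" using a by auto
  have h1: "((\<lambda>x::real. if x \<in> {0..r} then 1 else 0) has_integral r) {0..1}" if "0 \<le> r" "r \<le> 1" for r :: real
    using has_integral_const_real[of "1::real" 0 r] that
    by (subst has_integral_restrict) auto
  have Lu: "L \<le> sqrt (a + \<delta>) + \<eta>"
  proof (rule has_integral_le[OF L])
    show "((\<lambda>x::real. (if x \<in> {0..sqrt (a + \<delta>)} then 1 else 0) + \<eta>) has_integral (sqrt (a + \<delta>) + \<eta>)) {0..1}"
      using has_integral_add[OF h1 has_integral_const_real[of \<eta> 0 1]] sqa a by simp
    fix x :: real assume x: "x \<in> {0..1}"
    then have x2: "x\<^sup>2 \<in> {0..1}" by (auto simp: power_le_one)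
    have "g (x\<^sup>2) \<le> (if x \<in> {0..sqrt (a + \<delta>)} then 1 else 0)"
    proof (cases "x \<le> sqrt (a + \<delta>)")
      case False
      then have "a + \<delta> \<le> x\<^sup>2" using a x by (intro order_trans[OF _ power_mono[of "sqrt (a + \<delta>)" x 2]]) auto
      then show ?thesis using g0 False by simp
    qed (use g01 x in auto)
    then show "p (x\<^sup>2) \<le> (if x \<in> {0..sqrt (a + \<delta>)} then 1 else 0) + \<eta>" using p(2)[OF x2] by linarith
  qed
  have Ll: "sqrt a - \<eta> \<le> L"
  proof (rule has_integral_le[OF _ L])
    show "((\<lambda>x::real. (if x \<in> {0..sqrt a} then 1 else 0) - \<eta>) has_integral (sqrt a - \<eta>)) {0..1}"
      using has_integral_diff[OF h1 has_integral_const_real[of \<eta> 0 1]] sqa a by simp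
    fix x :: real assume x: "x \<in> {0..1}"
    then have x2: "x\<^sup>2 \<in> {0..1}" by (auto simp: power_le_one)
    have "(if x \<in> {0..sqrt a} then 1 else 0) \<le> g (x\<^sup>2)"
    proof (cases "x \<le> sqrt a")
      case True
      then have "x\<^sup>2 \<le> a" using power_mono[OF True, of 2] a x by simp
      then show ?thesis using g1 by simp
    qed (use g01 in auto)
    then show "(if x \<in> {0..sqrt a} then 1 else 0) - \<eta> \<le> p (x\<^sup>2)" using p(2)[OF x2] by linarith
  qed
  have "((\<lambda>i. \<Sum>j\<le>n. c j * expectation (\<lambda>\<omega>. W i \<omega> ^ j)) \<longlongrightarrow> L) F"
    unfolding L_def W_def by (intro tendsto_sum tendsto_mult tendsto_const truncated_moments_tendsto V nonneg int mom)
  from tendstoD[OF this \<eta>] show ?thesis using nonneg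
  proof eventually_elim
    case (elim i)
    have W01: "0 \<le> W i \<omega>" "W i \<omega> \<le> 1" if "\<omega> \<in> space M" for \<omega> using elim(2) that by (auto simp: W_def)
    have iw: "integrable M (\<lambda>\<omega>. W i \<omega> ^ j)" for j
      by (rule integrable_const_bound[of _ 1]) (use W01 in \<open>auto intro!: AE_I2 power_le_one\<close>)
    have ip: "integrable M (\<lambda>\<omega>. p (W i \<omega>))" unfolding pc by (intro Bochner_Integration.integrable_sum integrable_mult_right iw)
    have Ep: "expectation (\<lambda>\<omega>. p (W i \<omega>)) = (\<Sum>j\<le>n. c j * expectation (\<lambda>\<omega>. W i \<omega> ^ j))"
      unfolding pc by (subst Bochner_Integration.integral_sum) (auto intro!: integrable_mult_right iw)
    have ii: "integrable M (indicator {\<omega>\<in>space M. V i \<omega> \<le> b} :: 'a \<Rightarrow> real)" for b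
      by (rule integrable_real_indicator) (auto simp: emeasure_eq_measure)
    have "prob {\<omega>\<in>space M. V i \<omega> \<le> a} = expectation (indicator {\<omega>\<in>space M. V i \<omega> \<le> a})" by simp
    also have "\<dots> \<le> expectation (\<lambda>\<omega>. p (W i \<omega>) + \<eta>)"
    proof (rule integral_mono)
      fix \<omega> assume \<omega>: "\<omega> \<in> space M"
      have "indicator {\<omega>\<in>space M. V i \<omega> \<le> a} \<omega> \<le> g (W i \<omega>)"
        using g01[of "W i \<omega>"] g1[of "W i \<omega>"] a by (auto simp: indicator_def W_def min_def)
      then show "indicator {\<omega>\<in>space M. V i \<omega> \<le> a} \<omega> \<le> p (W i \<omega>) + \<eta>"
        using p(2)[of "W i \<omega>"] W01[OF \<omega>] by auto
    qed (use ip ii in auto)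
    also have "\<dots> = expectation (\<lambda>\<omega>. p (W i \<omega>)) + \<eta>" using ip by (simp add: prob_space)
    finally have u: "prob {\<omega>\<in>space M. V i \<omega> \<le> a} \<le> expectation (\<lambda>\<omega>. p (W i \<omega>)) + \<eta>" .
    have "expectation (\<lambda>\<omega>. p (W i \<omega>)) - \<eta> = expectation (\<lambda>\<omega>. p (W i \<omega>) - \<eta>)" using ip by (simp add: prob_space)
    also have "\<dots> \<le> expectation (indicator {\<omega>\<in>space M. V i \<omega> \<le> a + \<delta>})"
    proof (rule integral_mono)
      fix \<omega> assume \<omega>: "\<omega> \<in> space M"
      have "g (W i \<omega>) \<le> indicator {\<omega>\<in>space M. V i \<omega> \<le> a + \<delta>} \<omega>"
        using g01[of "W i \<omega>"] g0[of "W i \<omega>"] a \<omega> by (auto simp: indicator_def W_def min_def split: if_splits)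
      then show "p (W i \<omega>) - \<eta> \<le> indicator {\<omega>\<in>space M. V i \<omega> \<le> a + \<delta>} \<omega>"
        using p(2)[of "W i \<omega>"] W01[OF \<omega>] by auto
    qed (use ip ii in auto)
    also have "\<dots> = prob {\<omega>\<in>space M. V i \<omega> \<le> a + \<delta>}" by simp
    finally have l: "expectation (\<lambda>\<omega>. p (W i \<omega>)) - \<eta> \<le> prob {\<omega>\<in>space M. V i \<omega> \<le> a + \<delta>}" .
    have "\<bar>expectation (\<lambda>\<omega>. p (W i \<omega>)) - L\<bar> < \<eta>" using elim(1) unfolding Ep dist_real_def .
    then show ?case using u l Lu Ll by linarith
  qed
qed

text \<open>A random variable with values in \<open>[0, 1]\<close> and these moments has the law of the square of a uniform
  variable, hence the distribution function \<open>sqrt\<close>.\<close>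

theorem square_root_law_from_moments:
  fixes V :: "'i \<Rightarrow> 'a \<Rightarrow> real"
  assumes V [measurable]: "\<And>i. V i \<in> borel_measurable M"
    and nonneg: "\<forall>\<^sub>F i in F. \<forall>\<omega>\<in>space M. 0 \<le> V i \<omega>"
    and int: "\<And>k. \<forall>\<^sub>F i in F. integrable M (\<lambda>\<omega>. V i \<omega> ^ k)"
    and mom: "\<And>k. ((\<lambda>i. expectation (\<lambda>\<omega>. V i \<omega> ^ k)) \<longlongrightarrow> 1 / (2 * real k + 1)) F"
    and a: "0 \<le> a"
  shows "((\<lambda>i. prob {\<omega>\<in>space M. V i \<omega> \<le> a}) \<longlongrightarrow> sqrt (min 1 a)) F"
proof (rule order_tendstoI)
  note bounds = square_root_law_bounds[OF V nonneg int mom]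
  fix e assume e: "e < sqrt (min 1 a)"
  show "\<forall>\<^sub>F i in F. e < prob {\<omega>\<in>space M. V i \<omega> \<le> a}"
  proof (cases "e < 0")
    case True then show ?thesis by (intro always_eventually allI) (auto intro: less_le_trans)
  next
    case False
    then have "e\<^sup>2 < min 1 a" using e a by (metis linorder_not_less real_sqrt_less_iff real_sqrt_unique)
    then obtain a0 where a0: "e\<^sup>2 < a0" "a0 < min 1 a" using dense by blast
    then have "0 \<le> a0" using zero_le_power2[of e] by linarith
    have "e < sqrt a0" using a0 by (intro real_less_rsqrt)
    define \<delta> where "\<delta> = (min 1 a - a0) / 2"
    define \<eta> where "\<eta> = (sqrt a0 - e) / 6"
    have d: "0 < \<delta>" "a0 + \<delta> < min 1 a" "0 < \<eta>" using a0 \<open>e < sqrt a0\<close> by (auto simp: \<delta>_def \<eta>_def field_simps)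
    have "\<forall>\<^sub>F i in F. sqrt a0 - 3 * \<eta> \<le> prob {\<omega>\<in>space M. V i \<omega> \<le> a0 + \<delta>}"
      using bounds[of a0 \<delta> \<eta>] d \<open>0 \<le> a0\<close> by (auto elim: eventually_mono)
    then show ?thesis
    proof eventually_elim
      case (elim i)
      have "prob {\<omega>\<in>space M. V i \<omega> \<le> a0 + \<delta>} \<le> prob {\<omega>\<in>space M. V i \<omega> \<le> a}"
        using d by (intro finite_measure_mono) auto
      moreover have "e < sqrt a0 - 3 * \<eta>" using \<open>e < sqrt a0\<close> by (simp add: \<eta>_def field_simps)
      ultimately show ?case using elim by linarith
    qed
  qed
next
  note bounds = square_root_law_bounds[OF V nonneg int mom]
  fix e assume e: "sqrt (min 1 a) < e"
  show "\<forall>\<^sub>F i in F. prob {\<omega>\<in>space M. V i \<omega> \<le> a} < e"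
  proof (cases "1 \<le> a")
    case True
    then have "1 < e" using e by simp
    then show ?thesis by (intro always_eventually allI le_less_trans[OF prob_le_1])
  next
    case False
    then have e': "sqrt a < e" using e by simp
    then have "0 < e" using real_sqrt_ge_zero[OF a] by linarith
    have "a < e\<^sup>2" using power_strict_mono[OF e' real_sqrt_ge_zero[OF a], of 2] a by simp
    define b where "b = min 1 (e\<^sup>2)"
    have b: "a < b" "b \<le> 1" "sqrt b \<le> e" using False \<open>a < e\<^sup>2\<close> \<open>0 < e\<close> by (auto simp: b_def intro!: real_le_lsqrt)
    define \<delta> where "\<delta> = (b - a) / 2"
    have d: "0 < \<delta>" "a + \<delta> < b" using b by (auto simp: \<delta>_def field_simps)
    then have "sqrt (a + \<delta>) < sqrt b" by simp
    then have s: "sqrt (a + \<delta>) < e" using b by linarith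
    define \<eta> where "\<eta> = (e - sqrt (a + \<delta>)) / 6"
    have "0 < \<eta>" using s by (simp add: \<eta>_def)
    then have "\<forall>\<^sub>F i in F. prob {\<omega>\<in>space M. V i \<omega> \<le> a} \<le> sqrt (a + \<delta>) + 3 * \<eta>"
      using bounds[of a \<delta> \<eta>] d a b by (auto elim: eventually_mono)
    moreover have "sqrt (a + \<delta>) + 3 * \<eta> < e" using s by (simp add: \<eta>_def field_simps)
    ultimately show ?thesis by (auto elim: eventually_mono)
  qed
qed

end

text \<open>Pairing consecutive terms: twice the alternating sum equals the first term plus the alternating sum of
  the differences.\<close>

lemma alternating_sum_bound:
  fixes x e :: "nat \<Rightarrow> real"
  assumes x: "summable x" and nonneg: "\<And>n. 0 \<le> x n"
    and e: "summable e" and xe: "\<And>n. \<bar>x n - x (Suc n)\<bar> \<le> e n"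
  shows "\<bar>\<Sum>n. (-1) ^ n * x n\<bar> \<le> (x 0 + suminf e) / 2"
proof -
  have sa: "summable (\<lambda>n. (-1) ^ n * x n)"
    by (rule summable_comparison_test'[OF x, of 0]) (simp add: abs_mult nonneg)
  have id: "2 * (\<Sum>n<m. (-1) ^ n * x n) = x 0 - (-1) ^ m * x m + (\<Sum>n<m. (-1) ^ n * (x n - x (Suc n)))" for m
    by (induction m) (simp_all add: algebra_simps)
  have bound: "2 * \<bar>\<Sum>n<m. (-1) ^ n * x n\<bar> \<le> x 0 + x m + (\<Sum>n<m. e n)" for m
  proof -
    have "2 * \<bar>\<Sum>n<m. (-1) ^ n * x n\<bar> = \<bar>x 0 - (-1) ^ m * x m + (\<Sum>n<m. (-1) ^ n * (x n - x (Suc n)))\<bar>"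
      unfolding id[symmetric] by simp
    also have "\<dots> \<le> \<bar>x 0\<bar> + \<bar>(-1) ^ m * x m\<bar> + \<bar>\<Sum>n<m. (-1) ^ n * (x n - x (Suc n))\<bar>" by linarith
    also have "\<bar>\<Sum>n<m. (-1) ^ n * (x n - x (Suc n))\<bar> \<le> (\<Sum>n<m. e n)"
      by (rule order_trans[OF sum_abs sum_mono]) (simp add: abs_mult xe)
    finally show ?thesis by (simp add: abs_mult nonneg)
  qed
  have "(\<lambda>m. 2 * \<bar>\<Sum>n<m. (-1) ^ n * x n\<bar>) \<longlonglongrightarrow> 2 * \<bar>\<Sum>n. (-1) ^ n * x n\<bar>"
    by (intro tendsto_intros summable_LIMSEQ sa)
  moreover have "(\<lambda>m. x 0 + x m + (\<Sum>n<m. e n)) \<longlonglongrightarrow> x 0 + 0 + suminf e"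
    by (intro tendsto_intros summable_LIMSEQ e summable_LIMSEQ_zero x)
  ultimately have "2 * \<bar>\<Sum>n. (-1) ^ n * x n\<bar> \<le> x 0 + 0 + suminf e"
    by (rule LIMSEQ_le) (use bound in blast)
  then show ?thesis by simp
qed

section \<open>Geometry of the exiting ray\<close>

lemma crossing_index_eq:
  assumes "\<And>k. k \<le> n \<Longrightarrow> walk \<theta> k \<le> s" "s < walk \<theta> (Suc n)"
  shows "crossing_index \<theta> s = Suc n"
  unfolding crossing_index_def
proof (rule cInf_eq_minimum)
  show "Suc n \<in> {n. 0 < n \<and> s < walk \<theta> n}" using assms(2) by simp
  fix m assume "m \<in> {n. 0 < n \<and> s < walk \<theta> n}"
  then show "Suc n \<le> m" using assms(1)[of m] by (cases "m \<le> n") auto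
qed

text \<open>A walk that never exceeds the level is a null event, but it still has to be measurable. There the index
  is the infimum of the empty set of naturals, of which no value is known; the exit height and the exit
  angle are therefore described for an arbitrary index.\<close>

definition never_index :: nat where
  "never_index = Inf {}"

text \<open>The two truth values say whether the two endpoints of the segment lie on the edge. For a fixed
  index nothing else about the segment affects its intersections with the edge, since neither endpoint
  lies beyond the edge.\<close>

definition never_height :: "bool \<Rightarrow> bool \<Rightarrow> real" where
  "never_height p q = (THE h. \<exists>u. 0 \<le> u \<and> u \<le> 1 \<and> (u = 1 \<or> p) \<and> (u = 0 \<or> q) \<and>
     h = (1 - u) * ((1 - (-1) ^ (never_index - 1)) / 2) + u * ((1 - (-1) ^ never_index) / 2))"

definition never_angle :: "real \<Rightarrow> real" where
  "never_angle x = (if never_index = 0 then Arg 0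
     else Arg (Complex x ((1 - (-1) ^ never_index) / 2 - (1 - (-1) ^ (never_index - 1)) / 2)))"

lemma never_angle_measurable [measurable]: "never_angle \<in> borel_measurable borel"
proof (cases "never_index = 0")
  case True
  then show ?thesis unfolding never_angle_def[abs_def] by simp
next
  case False
  define d :: real where "d = (1 - (-1) ^ never_index) / 2 - (1 - (-1) ^ (never_index - 1)) / 2"
  obtain m where m: "never_index = Suc m" using False not0_implies_Suc by blast
  have "d \<noteq> 0" unfolding d_def m by (cases "even m") auto
  then have "continuous_on UNIV (\<lambda>x. Arg (Complex x d))"
    by (intro continuous_intros) (auto simp: complex_nonpos_Reals_iff)
  then have "(\<lambda>x. Arg (Complex x d)) \<in> borel_measurable borel" by (rule borel_measurable_continuous_onI)
  then show ?thesis using False unfolding never_angle_def[abs_def] d_def by simp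
qed

lemma ray_never_exits:
  assumes le: "\<And>k. walk \<theta> k \<le> s"
  shows "exit_height \<theta> s = never_height (walk \<theta> (never_index - 1) = s) (walk \<theta> never_index = s)"
    and "exit_angle \<theta> s = never_angle (walk \<theta> never_index - walk \<theta> (never_index - 1))"
proof -
  have "{n. 0 < n \<and> s < walk \<theta> n} = {}" using le by (auto simp: not_less)
  then have ci: "crossing_index \<theta> s = never_index" unfolding crossing_index_def never_index_def by (simp only:)
  have "Complex 0 h \<in> closed_segment (ray_vertex \<theta> s (never_index - 1)) (ray_vertex \<theta> s never_index) \<longleftrightarrow>
      (\<exists>u. 0 \<le> u \<and> u \<le> 1 \<and> (u = 1 \<or> walk \<theta> (never_index - 1) = s) \<and> (u = 0 \<or> walk \<theta> never_index = s) \<and>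
       h = (1 - u) * ((1 - (-1) ^ (never_index - 1)) / 2) + u * ((1 - (-1) ^ never_index) / 2))" for h
  proof -
    have "0 = (1 - u) * (- s + walk \<theta> (never_index - 1)) + u * (- s + walk \<theta> never_index) \<longleftrightarrow>
        (u = 1 \<or> walk \<theta> (never_index - 1) = s) \<and> (u = 0 \<or> walk \<theta> never_index = s)"
      if u: "0 \<le> u" "u \<le> 1" for u
    proof -
      have "(1 - u) * (- s + walk \<theta> (never_index - 1)) \<le> 0" "u * (- s + walk \<theta> never_index) \<le> 0"
        using u le by (auto intro!: mult_nonneg_nonpos)
      then have "0 = (1 - u) * (- s + walk \<theta> (never_index - 1)) + u * (- s + walk \<theta> never_index) \<longleftrightarrow>
          (1 - u) * (- s + walk \<theta> (never_index - 1)) = 0 \<and> u * (- s + walk \<theta> never_index) = 0"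
        by linarith
      then show ?thesis by auto
    qed
    then show ?thesis
      unfolding in_segment complex_eq_iff ray_vertex_def by (auto simp del: power_Suc)
  qed
  then show "exit_height \<theta> s = never_height (walk \<theta> (never_index - 1) = s) (walk \<theta> never_index = s)"
    unfolding exit_height_def never_height_def ci Let_def by simp
  show "exit_angle \<theta> s = never_angle (walk \<theta> never_index - walk \<theta> (never_index - 1))"
  proof (cases "never_index = 0")
    case True
    then show ?thesis unfolding exit_angle_def never_angle_def ci Let_def by simp
  next
    case False
    have "ray_vertex \<theta> s never_index - ray_vertex \<theta> s (never_index - 1) = Complex (walk \<theta> never_index - walk \<theta> (never_index - 1))
       ((1 - (-1) ^ never_index) / 2 - (1 - (-1) ^ (never_index - 1)) / 2)"
      by (simp add: ray_vertex_def complex_eq_iff)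
    then show ?thesis using False unfolding exit_angle_def never_angle_def ci Let_def by simp
  qed
qed

text \<open>The last segment starts at distance \<open>z\<close> to the left of the edge and has horizontal length \<open>x\<close>, so it meets
  the edge after the fraction \<open>z / x\<close> of its vertical unit.\<close>

lemma ray_exit:
  assumes le: "\<And>k. k \<le> n \<Longrightarrow> walk \<theta> k \<le> s" and gt: "s < walk \<theta> (Suc n)"
  defines "z \<equiv> s - walk \<theta> n" and "x \<equiv> tan (\<theta> (Suc n))"
  shows "exit_height \<theta> s = (if even n then z / x else 1 - z / x)"
    and "exit_angle \<theta> s = (if even n then arctan (1 / x) else - arctan (1 / x))"
proof -
  have ci: "crossing_index \<theta> s = Suc n" by (rule crossing_index_eq[OF le gt])
  have w: "walk \<theta> (Suc n) = walk \<theta> n + x" by (simp add: walk_def x_def)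
  have zx: "0 \<le> z" "z < x" using le[of n] gt by (auto simp: z_def w)
  then have x: "0 < x" by linarith
  define y0 y1 :: real where "y0 = (1 - (-1) ^ n) / 2" and "y1 = (1 - (-1) ^ Suc n) / 2"
  have v0: "ray_vertex \<theta> s n = Complex (- z) y0" and v1: "ray_vertex \<theta> s (Suc n) = Complex (x - z) y1"
    by (simp_all add: ray_vertex_def y0_def y1_def z_def w)
  have y: "y0 + z / x * (y1 - y0) = (if even n then z / x else 1 - z / x)" "y1 - y0 = (if even n then 1 else - 1)"
    by (auto simp: y0_def y1_def)
  have seg: "Complex 0 h \<in> closed_segment (Complex (- z) y0) (Complex (x - z) y1) \<longleftrightarrow> h = y0 + z / x * (y1 - y0)" for h
  proof
    assume "Complex 0 h \<in> closed_segment (Complex (- z) y0) (Complex (x - z) y1)"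
    then obtain u where u: "Complex 0 h = (1 - u) *\<^sub>R Complex (- z) y0 + u *\<^sub>R Complex (x - z) y1"
      by (auto simp: in_segment)
    then have "0 = (1 - u) * - z + u * (x - z)" "h = (1 - u) * y0 + u * y1"
      by (simp_all add: complex_eq_iff)
    then have "u * x = z" "h = y0 + u * (y1 - y0)" by (simp_all add: algebra_simps)
    moreover from this have "u = z / x" using x by (simp add: eq_divide_eq)
    ultimately show "h = y0 + z / x * (y1 - y0)" by simp
  next
    assume h: "h = y0 + z / x * (y1 - y0)"
    define r where "r = z / x"
    have r: "z = r * x" using x by (simp add: r_def)
    have "Complex 0 h = (1 - r) *\<^sub>R Complex (- (r * x)) y0 + r *\<^sub>R Complex (x - r * x) y1"
      by (simp add: complex_eq_iff h r_def[symmetric] algebra_simps)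
    then have "Complex 0 h = (1 - z / x) *\<^sub>R Complex (- z) y0 + (z / x) *\<^sub>R Complex (x - z) y1"
      using x by (simp add: r_def)
    then show "Complex 0 h \<in> closed_segment (Complex (- z) y0) (Complex (x - z) y1)"
      unfolding in_segment using zx x by (intro exI[of _ "z / x"]) simp
  qed
  have "exit_height \<theta> s = y0 + z / x * (y1 - y0)"
    unfolding exit_height_def ci Let_def by (simp add: v0 v1 seg)
  then show "exit_height \<theta> s = (if even n then z / x else 1 - z / x)" unfolding y(1) .
  have "ray_vertex \<theta> s (Suc n) - ray_vertex \<theta> s n = Complex x (y1 - y0)"
    by (simp add: v0 v1 complex_eq_iff)
  then have "exit_angle \<theta> s = Arg (Complex x (y1 - y0))"
    unfolding exit_angle_def ci Let_def by simp
  also have "\<dots> = arctan ((y1 - y0) / x)" using x by (subst arg_conv_arctan) auto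
  finally show "exit_angle \<theta> s = (if even n then arctan (1 / x) else - arctan (1 / x))"
    unfolding y(2) using arctan_minus[of "1 / x"] by (cases "even n") auto
qed

lemma ray_exit_angle_events:
  fixes x s t :: real
  assumes x: "0 < x" and s: "1 < s" and t: "0 \<le> t" and \<Lambda>: "\<Lambda> = (if e then arctan (1 / x) else - arctan (1 / x))"
  shows "sqrt (max 0 (ln (cot \<bar>\<Lambda>\<bar>) / ln s)) \<le> t \<longleftrightarrow> x \<le> s powr t\<^sup>2"
    and "1 * \<Lambda> \<le> 0 \<longleftrightarrow> \<not> e" and "- 1 * \<Lambda> \<le> 0 \<longleftrightarrow> e"
proof -
  have pos: "0 < arctan (1 / x)" using x by simp
  have abs: "\<bar>\<Lambda>\<bar> = arctan (1 / x)" using pos \<Lambda> by auto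
  have c: "cot (arctan (1 / x)) = x"
  proof -
    have "tan (arctan (1 / x)) = 1 / x" by (rule tan_arctan)
    moreover have "cot (arctan (1 / x)) = inverse (tan (arctan (1 / x)))" by (simp add: cot_def tan_def)
    ultimately show ?thesis by simp
  qed
  have l: "0 < ln s" using s by simp
  have "sqrt (max 0 (ln x / ln s)) \<le> t \<longleftrightarrow> max 0 (ln x / ln s) \<le> t\<^sup>2"
    using t by (metis real_sqrt_le_iff real_sqrt_abs abs_of_nonneg)
  also have "\<dots> \<longleftrightarrow> ln x \<le> t\<^sup>2 * ln s" using l by (simp add: pos_divide_le_eq)
  also have "\<dots> \<longleftrightarrow> ln x \<le> ln (s powr t\<^sup>2)" using s by (simp add: ln_powr)
  also have "\<dots> \<longleftrightarrow> x \<le> s powr t\<^sup>2" using x s by (subst ln_le_cancel_iff) auto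
  finally show "sqrt (max 0 (ln (cot \<bar>\<Lambda>\<bar>) / ln s)) \<le> t \<longleftrightarrow> x \<le> s powr t\<^sup>2" unfolding abs c .
  show "1 * \<Lambda> \<le> 0 \<longleftrightarrow> \<not> e" "- 1 * \<Lambda> \<le> 0 \<longleftrightarrow> e" using pos \<Lambda> by auto
qed

section \<open>The walk until its first passage\<close>

abbreviation jump_pred :: "(real \<Rightarrow> real \<Rightarrow> bool) \<Rightarrow> bool" where
  "jump_pred \<phi> \<equiv> Measurable.pred (borel \<Otimes>\<^sub>M borel) (case_prod \<phi>)"

text \<open>A random walk with independent jumps \<open>X 1\<close>, \<open>X 2\<close>, and so on, with the law of the tangent of the angle.\<close>

locale jump_walk = prob_space M for M :: "'a measure" +
  fixes X :: "nat \<Rightarrow> 'a \<Rightarrow> real"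
  assumes indep: "indep_vars (\<lambda>_. borel) X {1..}"
    and law: "\<And>n. 1 \<le> n \<Longrightarrow> distr M borel (X n) = jump_law"
begin

definition S :: "nat \<Rightarrow> 'a \<Rightarrow> real" where
  "S n \<omega> = (\<Sum>k = 1..n. X k \<omega>)"

definition alive :: "real \<Rightarrow> nat \<Rightarrow> 'a set" where
  "alive s n = {\<omega>\<in>space M. \<forall>k\<le>n. S k \<omega> \<le> s}"

text \<open>The law of the distance to the level at time \<open>n\<close>, on the event that the level has not been exceeded;
  a measure of total mass at most \<open>1\<close>.\<close>

definition killed_law :: "real \<Rightarrow> nat \<Rightarrow> real measure" where
  "killed_law s n = distr (density M (indicator (alive s n))) borel (\<lambda>\<omega>. s - S n \<omega>)"

lemma X_measurable [measurable]: "1 \<le> n \<Longrightarrow> X n \<in> borel_measurable M"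
  using indep unfolding indep_vars_def by auto

lemma S_measurable [measurable]: "S n \<in> borel_measurable M"
proof -
  have "(\<lambda>\<omega>. \<Sum>k = 1..n. X k \<omega>) \<in> borel_measurable M"
    by (intro borel_measurable_sum X_measurable) auto
  then show ?thesis unfolding S_def[abs_def] .
qed

lemma S_0 [simp]: "S 0 \<omega> = 0" by (simp add: S_def)
lemma S_Suc [simp]: "S (Suc n) \<omega> = S n \<omega> + X (Suc n) \<omega>" by (simp add: S_def)

lemma alive_measurable [measurable]: "alive s n \<in> sets M"
  unfolding alive_def by measurable

lemma sets_killed_law [simp, measurable_cong]: "sets (killed_law s n) = sets borel"
  by (simp add: killed_law_def)

lemma space_killed_law [simp]: "space (killed_law s n) = UNIV"
  by (simp add: killed_law_def)

lemma nn_integral_killed_law: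
  assumes [measurable]: "g \<in> borel_measurable borel"
  shows "(\<integral>\<^sup>+z. g z \<partial>killed_law s n) = (\<integral>\<^sup>+\<omega>. indicator (alive s n) \<omega> * g (s - S n \<omega>) \<partial>M)"
proof -
  have "(\<integral>\<^sup>+z. g z \<partial>killed_law s n) = (\<integral>\<^sup>+\<omega>. g (s - S n \<omega>) \<partial>density M (indicator (alive s n)))"
    unfolding killed_law_def by (rule nn_integral_distr) auto
  also have "\<dots> = (\<integral>\<^sup>+\<omega>. indicator (alive s n) \<omega> * g (s - S n \<omega>) \<partial>M)"
    by (rule nn_integral_density) auto
  finally show ?thesis .
qed

lemma emeasure_killed_law_le: "emeasure (killed_law s n) UNIV \<le> 1"
proof -
  have "emeasure (killed_law s n) UNIV = (\<integral>\<^sup>+z. 1 \<partial>killed_law s n)" by simp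
  also have "\<dots> = (\<integral>\<^sup>+\<omega>. indicator (alive s n) \<omega> \<partial>M)" by (subst nn_integral_killed_law) auto
  also have "\<dots> = emeasure M (alive s n)" by simp
  also have "\<dots> \<le> 1" by (rule emeasure_le_1)
  finally show ?thesis .
qed

lemma finite_measure_killed_law: "finite_measure (killed_law s n)"
  by (rule finite_measureI) (use emeasure_killed_law_le[of s n] in \<open>auto simp: top_unique\<close>)

lemma AE_killed_law_nonneg: "AE z in killed_law s n. 0 \<le> z"
proof -
  have "(\<integral>\<^sup>+z. indicator {..<0} z \<partial>killed_law s n) = (\<integral>\<^sup>+\<omega>. indicator (alive s n) \<omega> * indicator {..<0} (s - S n \<omega>) \<partial>M)"
    by (rule nn_integral_killed_law) auto
  also have "\<dots> = (\<integral>\<^sup>+\<omega>. 0 \<partial>M)"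
    by (intro nn_integral_cong) (auto simp: alive_def indicator_def)
  finally have "emeasure (killed_law s n) {..<0} = 0" by simp
  then show ?thesis by (intro AE_I[of _ _ "{..<0}"]) auto
qed

lemma position_indep_next_jump:
  "indep_var borel (\<lambda>\<omega>. if \<forall>k\<le>n. S k \<omega> \<le> s then s - S n \<omega> else - 1) borel (X (Suc n))"
proof -
  let ?P = "\<lambda>A. PiM A (\<lambda>_::nat. borel :: real measure)"
  \<comment> \<open>the value \<open>- 1\<close> marks a walk that has passed the level, since surviving walks have a distance of at
    least \<open>0\<close>; this encodes the distance and the survival in one real number\<close>
  let ?f = "\<lambda>v. if \<forall>k\<le>n. (\<Sum>i = 1..k. v i) \<le> s then s - (\<Sum>i = 1..n. v i) else - 1"
  have "indep_var (?P {1..n}) (\<lambda>\<omega>. restrict (\<lambda>i. X i \<omega>) {1..n}) (?P {Suc n}) (\<lambda>\<omega>. restrict (\<lambda>i. X i \<omega>) {Suc n})"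
    by (rule indep_var_restrict[OF indep]) auto
  then have "indep_var borel (?f \<circ> (\<lambda>\<omega>. restrict (\<lambda>i. X i \<omega>) {1..n}))
      borel ((\<lambda>v. v (Suc n)) \<circ> (\<lambda>\<omega>. restrict (\<lambda>i. X i \<omega>) {Suc n}))"
  proof (rule indep_var_compose)
    have m [measurable]: "(\<lambda>v. \<Sum>i = 1..k. v i) \<in> borel_measurable (?P {1..n})" if "k \<le> n" for k
      using that by (intro borel_measurable_sum measurable_component_singleton) auto
    have "{v \<in> space (?P {1..n}). \<forall>k\<le>n. (\<Sum>i = 1..k. v i) \<le> s} = (\<Inter>k\<in>{..n}. {v \<in> space (?P {1..n}). (\<Sum>i = 1..k. v i) \<le> s})"
      by auto
    also have "\<dots> \<in> sets (?P {1..n})"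
      using m by (intro sets.finite_INT) (auto intro!: borel_measurable_le)
    finally show "?f \<in> ?P {1..n} \<rightarrow>\<^sub>M borel"
      using m[of n] by (intro measurable_If) auto
  qed (intro measurable_component_singleton, simp)
  moreover have "?f \<circ> (\<lambda>\<omega>. restrict (\<lambda>i. X i \<omega>) {1..n}) = (\<lambda>\<omega>. if \<forall>k\<le>n. S k \<omega> \<le> s then s - S n \<omega> else - 1)"
  proof -
    have "(\<Sum>i = 1..k. restrict (\<lambda>i. X i \<omega>) {1..n} i) = S k \<omega>" if "k \<le> n" for k \<omega>
      unfolding S_def using that by (intro sum.cong) auto
    then show ?thesis by (intro ext) (auto simp del: restrict_apply)
  qed
  moreover have "(\<lambda>v. v (Suc n)) \<circ> (\<lambda>\<omega>. restrict (\<lambda>i. X i \<omega>) {Suc n}) = X (Suc n)" by (auto simp: fun_eq_iff)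
  ultimately show ?thesis by simp
qed

text \<open>The Markov property at time \<open>n\<close>, in the form used for everything below: the next jump is independent of
  the present distance and of having stayed below the level.\<close>

lemma nn_integral_next_jump:
  assumes \<phi> [measurable]: "case_prod \<phi> \<in> borel_measurable (borel \<Otimes>\<^sub>M borel)"
  shows "(\<integral>\<^sup>+\<omega>. indicator (alive s n) \<omega> * \<phi> (s - S n \<omega>) (X (Suc n) \<omega>) \<partial>M)
       = (\<integral>\<^sup>+z. (\<integral>\<^sup>+x. \<phi> z x \<partial>jump_law) \<partial>killed_law s n)"
proof -
  define Y where "Y = (\<lambda>\<omega>. if \<forall>k\<le>n. S k \<omega> \<le> s then s - S n \<omega> else - 1)"
  have iv: "indep_var borel Y borel (X (Suc n))" unfolding Y_def by (rule position_indep_next_jump)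
  note d = iv[unfolded indep_var_distribution_eq]
  have [measurable]: "Y \<in> borel_measurable M" "X (Suc n) \<in> borel_measurable M" using d by auto
  have joint: "distr M borel Y \<Otimes>\<^sub>M jump_law = distr M (borel \<Otimes>\<^sub>M borel) (\<lambda>\<omega>. (Y \<omega>, X (Suc n) \<omega>))"
    using d law[of "Suc n"] by simp
  have eq: "indicator (alive s n) \<omega> * c (s - S n \<omega>) = indicator {0..} (Y \<omega>) * (c (Y \<omega>) :: ennreal)" if "\<omega> \<in> space M" for \<omega> c
    using that by (auto simp: Y_def alive_def indicator_def)
  have "(\<integral>\<^sup>+\<omega>. indicator (alive s n) \<omega> * \<phi> (s - S n \<omega>) (X (Suc n) \<omega>) \<partial>M)
      = (\<integral>\<^sup>+\<omega>. indicator {0..} (Y \<omega>) * \<phi> (Y \<omega>) (X (Suc n) \<omega>) \<partial>M)"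
    by (intro nn_integral_cong eq)
  also have "\<dots> = (\<integral>\<^sup>+p. (case p of (z, x) \<Rightarrow> indicator {0..} z * \<phi> z x) \<partial>(distr M borel Y \<Otimes>\<^sub>M jump_law))"
    unfolding joint by (subst nn_integral_distr) auto
  also have "\<dots> = (\<integral>\<^sup>+z. (\<integral>\<^sup>+x. indicator {0..} z * \<phi> z x \<partial>jump_law) \<partial>distr M borel Y)"
    by (subst jump_law.nn_integral_fst[symmetric]) auto
  also have "\<dots> = (\<integral>\<^sup>+z. indicator {0..} z * (\<integral>\<^sup>+x. \<phi> z x \<partial>jump_law) \<partial>distr M borel Y)"
    by (intro nn_integral_cong nn_integral_cmult) measurable
  also have "\<dots> = (\<integral>\<^sup>+\<omega>. indicator {0..} (Y \<omega>) * (\<integral>\<^sup>+x. \<phi> (Y \<omega>) x \<partial>jump_law) \<partial>M)"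
    by (subst nn_integral_distr) auto
  also have "\<dots> = (\<integral>\<^sup>+\<omega>. indicator (alive s n) \<omega> * (\<integral>\<^sup>+x. \<phi> (s - S n \<omega>) x \<partial>jump_law) \<partial>M)"
    by (intro nn_integral_cong eq[symmetric])
  also have "\<dots> = (\<integral>\<^sup>+z. (\<integral>\<^sup>+x. \<phi> z x \<partial>jump_law) \<partial>killed_law s n)"
    by (subst nn_integral_killed_law) auto
  finally show ?thesis .
qed

lemma nn_integral_killed_law_Suc:
  assumes [measurable]: "g \<in> borel_measurable borel"
  shows "(\<integral>\<^sup>+z. g z \<partial>killed_law s (Suc n)) = (\<integral>\<^sup>+z. (\<integral>\<^sup>+x. indicator {..z} x * g (z - x) \<partial>jump_law) \<partial>killed_law s n)"
proof -
  have "(\<integral>\<^sup>+z. g z \<partial>killed_law s (Suc n)) = (\<integral>\<^sup>+\<omega>. indicator (alive s n) \<omega> * (\<lambda>z x. indicator {..z} x * g (z - x)) (s - S n \<omega>) (X (Suc n) \<omega>) \<partial>M)"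
    by (subst nn_integral_killed_law)
       (auto intro!: nn_integral_cong simp: alive_def indicator_def le_Suc_eq algebra_simps)
  also have "\<dots> = (\<integral>\<^sup>+z. (\<integral>\<^sup>+x. indicator {..z} x * g (z - x) \<partial>jump_law) \<partial>killed_law s n)"
  proof (rule nn_integral_next_jump)
    have "(\<lambda>p. (if snd p \<le> fst p then 1 else 0) * g (fst p - snd p)) \<in> borel_measurable (borel \<Otimes>\<^sub>M borel)" by measurable
    then show "(\<lambda>(z, x). indicator {..z} x * g (z - x)) \<in> borel_measurable (borel \<Otimes>\<^sub>M borel)"
      by (simp add: case_prod_beta' indicator_def)
  qed
  finally show ?thesis .
qed

definition first_passage :: "real \<Rightarrow> nat \<Rightarrow> 'a set" where
  "first_passage s n = alive s n - alive s (Suc n)"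

lemma first_passage_measurable [measurable]: "first_passage s n \<in> sets M"
  unfolding first_passage_def by measurable

lemma first_passage_iff:
  "\<omega> \<in> first_passage s n \<longleftrightarrow> \<omega> \<in> alive s n \<and> s < S (Suc n) \<omega>"
  by (auto simp: first_passage_def alive_def le_Suc_eq)

lemma disjoint_first_passage: "disjoint_family (first_passage s)"
proof -
  have "first_passage s m \<inter> first_passage s n = {}" if "m < n" for m n
    using that by (auto simp: first_passage_iff alive_def not_le[symmetric] simp del: S_Suc)
  then show ?thesis unfolding disjoint_family_on_def by (metis Int_commute linorder_neqE_nat)
qed

text \<open>An event of the first passage at time \<open>n + 1\<close> that depends on the distance \<open>z\<close> before the
  jump and on the jump \<open>x\<close>.\<close>

lemma emeasure_first_passage:
  assumes \<phi> [measurable]: "jump_pred \<phi>"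
  shows "emeasure M {\<omega>\<in>first_passage s n. \<phi> (s - S n \<omega>) (X (Suc n) \<omega>)}
       = (\<integral>\<^sup>+z. emeasure jump_law {x. z < x \<and> \<phi> z x} \<partial>killed_law s n)"
proof -
  have [measurable]: "(\<lambda>\<omega>. \<phi> (s - S n \<omega>) (X (Suc n) \<omega>)) \<in> measurable M (count_space UNIV)"
    using measurable_compose[OF _ \<phi>, of "\<lambda>\<omega>. (s - S n \<omega>, X (Suc n) \<omega>)" M] by simp
  have [measurable]: "Measurable.pred jump_law (\<phi> z)" for z
    using measurable_compose[OF _ \<phi>, of "\<lambda>x. (z, x)" jump_law] by simp
  have m: "{\<omega>\<in>first_passage s n. \<phi> (s - S n \<omega>) (X (Suc n) \<omega>)} \<in> sets M"
  proof -
    have "{\<omega>\<in>first_passage s n. \<phi> (s - S n \<omega>) (X (Suc n) \<omega>)} = first_passage s n \<inter> {\<omega>\<in>space M. \<phi> (s - S n \<omega>) (X (Suc n) \<omega>)}"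
      using sets.sets_into_space[OF first_passage_measurable] by auto
    then show ?thesis by simp
  qed
  have "emeasure M {\<omega>\<in>first_passage s n. \<phi> (s - S n \<omega>) (X (Suc n) \<omega>)}
      = (\<integral>\<^sup>+\<omega>. indicator {\<omega>\<in>first_passage s n. \<phi> (s - S n \<omega>) (X (Suc n) \<omega>)} \<omega> \<partial>M)"
    using m by simp
  also have "\<dots> = (\<integral>\<^sup>+\<omega>. indicator (alive s n) \<omega> * (\<lambda>z x. if z < x \<and> \<phi> z x then 1 else 0) (s - S n \<omega>) (X (Suc n) \<omega>) \<partial>M)"
    by (intro nn_integral_cong) (auto simp: first_passage_iff indicator_def algebra_simps)
  also have "\<dots> = (\<integral>\<^sup>+z. (\<integral>\<^sup>+x. (if z < x \<and> \<phi> z x then 1 else 0) \<partial>jump_law) \<partial>killed_law s n)"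
  proof (rule nn_integral_next_jump)
    have "(\<lambda>p. if fst p < snd p \<and> case_prod \<phi> p then 1 else 0 :: ennreal) \<in> borel_measurable (borel \<Otimes>\<^sub>M borel)" by measurable
    then show "(\<lambda>(z, x). if z < x \<and> \<phi> z x then 1 else 0 :: ennreal) \<in> borel_measurable (borel \<Otimes>\<^sub>M borel)"
      by (simp add: case_prod_beta')
  qed
  also have "\<dots> = (\<integral>\<^sup>+z. emeasure jump_law {x. z < x \<and> \<phi> z x} \<partial>killed_law s n)"
  proof (intro nn_integral_cong)
    fix z
    have ms: "{x. z < x \<and> \<phi> z x} \<in> sets jump_law"
    proof -
      have "{x \<in> space jump_law. z < x \<and> \<phi> z x} \<in> sets jump_law" by measurable
      then show ?thesis by simp
    qed
    have "(\<integral>\<^sup>+x. (if z < x \<and> \<phi> z x then 1 else 0) \<partial>jump_law) = (\<integral>\<^sup>+x. indicator {x. z < x \<and> \<phi> z x} x \<partial>jump_law)"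
      by (intro nn_integral_cong) (auto simp: indicator_def)
    also have "\<dots> = emeasure jump_law {x. z < x \<and> \<phi> z x}" using ms by (rule nn_integral_indicator)
    finally show "(\<integral>\<^sup>+x. (if z < x \<and> \<phi> z x then 1 else 0) \<partial>jump_law) = emeasure jump_law {x. z < x \<and> \<phi> z x}" .
  qed
  finally show ?thesis .
qed

section \<open>Logarithmic moments of the undershoot\<close>

lemma killed_law_0: "0 \<le> s \<Longrightarrow> killed_law s 0 = return borel s"
proof (rule measure_eqI)
  fix A assume s: "0 \<le> s" and "A \<in> sets (killed_law s 0)"
  then have [measurable]: "A \<in> sets borel" by simp
  have "emeasure (killed_law s 0) A = (\<integral>\<^sup>+z. indicator A z \<partial>killed_law s 0)" by simp
  also have "\<dots> = (\<integral>\<^sup>+\<omega>. indicator (alive s 0) \<omega> * indicator A (s - S 0 \<omega>) \<partial>M)" by (rule nn_integral_killed_law) auto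
  also have "\<dots> = (\<integral>\<^sup>+\<omega>. indicator A s \<partial>M)"
    by (intro nn_integral_cong) (use s in \<open>auto simp: alive_def\<close>)
  also have "\<dots> = indicator A s" by (simp add: emeasure_space_1)
  finally show "emeasure (killed_law s 0) A = emeasure (return borel s) A" by simp
qed simp

text \<open>Surviving one more step means to apply the one-step operator to the function that is averaged.\<close>

lemma killed_law_Suc_integral:
  assumes [measurable]: "g \<in> borel_measurable borel"
    and nonneg: "\<And>z. 0 \<le> z \<Longrightarrow> 0 \<le> g z"
    and int: "\<And>z. 0 \<le> z \<Longrightarrow> integrable jump_law (\<lambda>x. indicator {..z} x * g (z - x))"
    and ints: "integrable (killed_law s n) (step g)"
  shows "integrable (killed_law s (Suc n)) g"
    and "(\<integral>z. g z \<partial>killed_law s (Suc n)) = (\<integral>z. step g z \<partial>killed_law s n)"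
proof -
  have step_nonneg: "0 \<le> step g z" for z
    unfolding step_def by (rule Bochner_Integration.integral_nonneg) (auto simp: indicator_def nonneg)
  have "(\<integral>\<^sup>+z. ennreal (g z) \<partial>killed_law s (Suc n)) = (\<integral>\<^sup>+z. (\<integral>\<^sup>+x. indicator {..z} x * ennreal (g (z - x)) \<partial>jump_law) \<partial>killed_law s n)"
    by (rule nn_integral_killed_law_Suc) auto
  also have "\<dots> = (\<integral>\<^sup>+z. ennreal (step g z) \<partial>killed_law s n)"
  proof (rule nn_integral_cong_AE, use AE_killed_law_nonneg in eventually_elim)
    fix z :: real assume z: "0 \<le> z"
    have "(\<integral>\<^sup>+x. indicator {..z} x * ennreal (g (z - x)) \<partial>jump_law) = (\<integral>\<^sup>+x. ennreal (indicator {..z} x * g (z - x)) \<partial>jump_law)"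
      by (intro nn_integral_cong) (auto simp: indicator_def)
    also have "\<dots> = ennreal (step g z)" unfolding step_def
      by (rule nn_integral_eq_integral[OF int[OF z]]) (auto simp: indicator_def nonneg)
    finally show "(\<integral>\<^sup>+x. indicator {..z} x * ennreal (g (z - x)) \<partial>jump_law) = ennreal (step g z)" .
  qed
  also have "\<dots> = ennreal (\<integral>z. step g z \<partial>killed_law s n)"
    by (rule nn_integral_eq_integral[OF ints]) (simp add: step_nonneg)
  finally have e: "(\<integral>\<^sup>+z. ennreal (g z) \<partial>killed_law s (Suc n)) = ennreal (\<integral>z. step g z \<partial>killed_law s n)" .
  have ae: "AE z in killed_law s (Suc n). 0 \<le> g z"
    using AE_killed_law_nonneg by eventually_elim (rule nonneg)
  show "integrable (killed_law s (Suc n)) g"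
    by (rule integrableI_nonneg) (use ae e in auto)
  show "(\<integral>z. g z \<partial>killed_law s (Suc n)) = (\<integral>z. step g z \<partial>killed_law s n)"
    using e by (subst integral_eq_nn_integral) (use ae in \<open>auto simp: step_nonneg Bochner_Integration.integral_nonneg\<close>)
qed

lemma killed_law_integrable_const [simp]: "integrable (killed_law s n) (\<lambda>_. c :: real)"
  using finite_measure.integrable_const[OF finite_measure_killed_law] .

lemma killed_law_integrable_bound:
  fixes f g :: "real \<Rightarrow> real"
  assumes "integrable (killed_law s n) g" and [measurable]: "f \<in> borel_measurable borel"
    and "\<And>z. 0 \<le> z \<Longrightarrow> \<bar>f z\<bar> \<le> g z"
  shows "integrable (killed_law s n) f"
proof (rule Bochner_Integration.integrable_bound[OF assms(1)])
  show "AE z in killed_law s n. norm (f z) \<le> norm (g z)"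
    using AE_killed_law_nonneg by eventually_elim (use assms(3) in force)
qed simp

lemma killed_law_integral_mono:
  fixes f g :: "real \<Rightarrow> real"
  assumes "integrable (killed_law s n) f" "integrable (killed_law s n) g" "\<And>z. 0 \<le> z \<Longrightarrow> f z \<le> g z"
  shows "(\<integral>z. f z \<partial>killed_law s n) \<le> (\<integral>z. g z \<partial>killed_law s n)"
proof (rule integral_mono_AE[OF assms(1,2)])
  show "AE z in killed_law s n. f z \<le> g z"
    using AE_killed_law_nonneg by eventually_elim (use assms(3) in force)
qed

lemma killed_law_integral_nonneg:
  fixes f :: "real \<Rightarrow> real"
  assumes "\<And>z. 0 \<le> z \<Longrightarrow> 0 \<le> f z"
  shows "0 \<le> (\<integral>z. f z \<partial>killed_law s n)"
proof (rule integral_nonneg_AE)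
  show "AE z in killed_law s n. 0 \<le> f z"
    using AE_killed_law_nonneg by eventually_elim (use assms in force)
qed

lemma killed_law_log_pow_integrable:
  assumes s: "0 \<le> s"
  shows "integrable (killed_law s n) (log_pow k)"
proof (induction n)
  case 0
  show ?case unfolding killed_law_0[OF s] by (rule integrableI_bounded) (auto simp: nn_integral_return)
next
  case (Suc n)
  obtain B where B: "0 \<le> B" "\<And>z. 0 \<le> z \<Longrightarrow> \<bar>step (log_pow k) z\<bar> \<le> B * (1 + log_pow k z)"
    using step_log_pow_bounded by blast
  show ?case
  proof (rule killed_law_Suc_integral(1))
    show "integrable (killed_law s n) (step (log_pow k))"
      by (rule killed_law_integrable_bound[of _ _ "\<lambda>z. B * (1 + log_pow k z)"]) (use Suc B in auto)
  qed (auto intro: log_power_integrable)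
qed

lemma killed_law_log_pow_Suc:
  assumes s: "0 \<le> s"
  shows "integrable (killed_law s n) (step (log_pow k))"
    and "(\<integral>z. log_pow k z \<partial>killed_law s (Suc n)) = (\<integral>z. step (log_pow k) z \<partial>killed_law s n)"
proof -
  obtain B where B: "0 \<le> B" "\<And>z. 0 \<le> z \<Longrightarrow> \<bar>step (log_pow k) z\<bar> \<le> B * (1 + log_pow k z)"
    using step_log_pow_bounded by blast
  show i: "integrable (killed_law s n) (step (log_pow k))"
    by (rule killed_law_integrable_bound[of _ _ "\<lambda>z. B * (1 + log_pow k z)"])
       (use killed_law_log_pow_integrable[OF s] B in auto)
  show "(\<integral>z. log_pow k z \<partial>killed_law s (Suc n)) = (\<integral>z. step (log_pow k) z \<partial>killed_law s n)"
    by (rule killed_law_Suc_integral(2)[OF _ _ _ i]) (auto intro: log_power_integrable)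
qed

lemma killed_law_tail_log_pow_integrable:
  assumes s: "0 \<le> s"
  shows "integrable (killed_law s n) (\<lambda>z. tail z * log_pow k z)"
proof (rule killed_law_integrable_bound[OF killed_law_log_pow_integrable[OF s, of n k]])
  fix z :: real assume "0 \<le> z"
  then show "\<bar>tail z * log_pow k z\<bar> \<le> log_pow k z"
    using tail_pos[of z] tail_le_1[of z] by (simp add: abs_mult mult_left_le_one_le)
qed measurable

text \<open>As \<open>tail z\<close> is the probability of passing the level from the distance \<open>z\<close>, this is the logarithmic
  moment of the undershoot restricted to first passages within the first \<open>m\<close> jumps.\<close>

definition exit_moment :: "nat \<Rightarrow> real \<Rightarrow> nat \<Rightarrow> real" where
  "exit_moment k s m = (\<Sum>n<m. \<integral>z. tail z * log_pow k z \<partial>killed_law s n)"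

lemma exit_moment_term_nonneg: "0 \<le> (\<integral>z. tail z * log_pow k z \<partial>killed_law s n)"
  by (rule killed_law_integral_nonneg) (auto simp: less_imp_le[OF tail_pos])

lemma exit_moment_nonneg: "0 \<le> exit_moment k s m"
  unfolding exit_moment_def by (intro sum_nonneg exit_moment_term_nonneg)

lemma exit_moment_0:
  assumes s: "0 \<le> s"
  shows "exit_moment 0 s m = 1 - (\<integral>z. log_pow 0 z \<partial>killed_law s m)"
proof (induction m)
  case 0
  show ?case unfolding exit_moment_def killed_law_0[OF s] by (simp add: integral_return measure_return)
next
  case (Suc m)
  have i: "integrable (killed_law s m) tail" using killed_law_tail_log_pow_integrable[OF s, of m 0] by simp
  have "(\<integral>z. log_pow 0 z \<partial>killed_law s (Suc m)) = (\<integral>z. 1 - tail z \<partial>killed_law s m)"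
    unfolding killed_law_log_pow_Suc(2)[OF s] step_one ..
  also have "\<dots> = (\<integral>z. 1 \<partial>killed_law s m) - (\<integral>z. tail z \<partial>killed_law s m)"
    by (rule Bochner_Integration.integral_diff[OF _ i]) simp
  finally show ?case using Suc by (simp add: exit_moment_def)
qed

lemma exit_moment_0_le_1: "0 \<le> s \<Longrightarrow> exit_moment 0 s m \<le> 1"
  using killed_law_integral_nonneg[of "log_pow 0" s m] exit_moment_0[of s m] by simp

text \<open>The one-step expansion summed over the first \<open>m\<close> steps: the differences telescope.\<close>

lemma exit_moment_identity:
  assumes k: "1 \<le> k"
  obtains C where "0 \<le> C"
    "\<And>s m. 0 \<le> s \<Longrightarrow> \<bar>(2 * real k + 1) * exit_moment k s m - (log_pow k s - (\<integral>z. log_pow k z \<partial>killed_law s m))\<bar>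
      \<le> C * (exit_moment 0 s m + exit_moment (k - 1) s m)"
proof -
  from step_log_power_expansion[OF k] obtain C where C: "0 \<le> C"
    "\<And>z. 0 \<le> z \<Longrightarrow> \<bar>step_error k z\<bar>
      \<le> C * (tail z * (1 + ln (1 + z)) ^ (k - 1))" by blast
  define C' where "C' = C * 2 ^ (k - 1)"
  show ?thesis
  proof (rule that[of C'])
    fix s :: real and m :: nat assume s: "0 \<le> s"
    let ?I = "\<lambda>j n. \<integral>z. tail z * log_pow j z \<partial>killed_law s n"
    let ?H = "\<lambda>n. \<integral>z. log_pow k z \<partial>killed_law s n"
    have one: "\<bar>(2 * real k + 1) * ?I k n - (?H n - ?H (Suc n))\<bar> \<le> C' * (?I 0 n + ?I (k - 1) n)" for n
    proof -
      note ih = killed_law_log_pow_integrable[OF s, of n k]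
        and st = killed_law_log_pow_Suc[OF s, of n k]
        and it = killed_law_tail_log_pow_integrable[OF s, of n]
      have "?H n - ?H (Suc n) - (2 * real k + 1) * ?I k n
          = (\<integral>z. step_error k z \<partial>killed_law s n)"
        using ih st(1) it[of k] unfolding st(2) by simp
      then have "\<bar>(2 * real k + 1) * ?I k n - (?H n - ?H (Suc n))\<bar>
          = \<bar>\<integral>z. step_error k z \<partial>killed_law s n\<bar>"
        by linarith
      also have "\<dots> \<le> (\<integral>z. \<bar>step_error k z\<bar> \<partial>killed_law s n)"
        by (rule integral_abs_bound)
      also have "\<dots> \<le> (\<integral>z. C' * (tail z * log_pow 0 z + tail z * log_pow (k - 1) z) \<partial>killed_law s n)"
      proof (rule killed_law_integral_mono)
        fix z :: real assume z: "0 \<le> z"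
        have "C * (tail z * (1 + ln (1 + z)) ^ (k - 1)) \<le> C * (tail z * (2 ^ (k - 1) * (1 + log_pow (k - 1) z)))"
          using C(1) z by (intro mult_left_mono one_plus_power_le less_imp_le[OF tail_pos]) auto
        also have "\<dots> = C' * (tail z * log_pow 0 z + tail z * log_pow (k - 1) z)"
          by (simp add: C'_def algebra_simps)
        finally show "\<bar>step_error k z\<bar> \<le> \<dots>"
          using C(2)[OF z] by linarith
      qed (use ih st(1) it[of k] it[of "k - 1"] it[of 0] in auto)
      also have "\<dots> = C' * (?I 0 n + ?I (k - 1) n)" using it[of "k - 1"] it[of 0] by simp
      finally show ?thesis .
    qed
    show "\<bar>(2 * real k + 1) * exit_moment k s m - (log_pow k s - ?H m)\<bar> \<le> C' * (exit_moment 0 s m + exit_moment (k - 1) s m)"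
    proof (induction m)
      case 0
      show ?case unfolding exit_moment_def killed_law_0[OF s] by (simp add: integral_return measure_return)
    next
      case (Suc m)
      have "(2 * real k + 1) * exit_moment k s (Suc m) - (log_pow k s - ?H (Suc m))
        = ((2 * real k + 1) * exit_moment k s m - (log_pow k s - ?H m)) + ((2 * real k + 1) * ?I k m - (?H m - ?H (Suc m)))"
        by (simp add: exit_moment_def algebra_simps)
      moreover have "C' * (exit_moment 0 s (Suc m) + exit_moment (k - 1) s (Suc m))
        = C' * (exit_moment 0 s m + exit_moment (k - 1) s m) + C' * (?I 0 m + ?I (k - 1) m)"
        by (simp add: exit_moment_def algebra_simps)
      ultimately show ?case using Suc one[of m] by linarith
    qed
  qed (use C in \<open>simp add: C'_def\<close>)
qed

text \<open>Induction on \<open>k\<close>: the error in the identity involves only the moments of order \<open>0\<close> and \<open>k - 1\<close>.\<close>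

lemma exit_moment_bounded:
  "\<exists>B. \<forall>s\<ge>0. \<forall>m. exit_moment k s m \<le> B * (1 + log_pow k s)"
proof (induction k)
  case 0
  show ?case by (rule exI[of _ 1]) (auto intro: order_trans[OF exit_moment_0_le_1])
next
  case (Suc k)
  then obtain B where B: "\<And>s m. 0 \<le> s \<Longrightarrow> exit_moment k s m \<le> B * (1 + log_pow k s)" by auto
  obtain C where C: "0 \<le> C"
    "\<And>s m. 0 \<le> s \<Longrightarrow> \<bar>(2 * real (Suc k) + 1) * exit_moment (Suc k) s m - (log_pow (Suc k) s - (\<integral>z. log_pow (Suc k) z \<partial>killed_law s m))\<bar>
      \<le> C * (exit_moment 0 s m + exit_moment (Suc k - 1) s m)"
    using exit_moment_identity[of "Suc k"] by auto
  have "exit_moment (Suc k) s m \<le> (1 + C * (1 + 2 * \<bar>B\<bar>)) * (1 + log_pow (Suc k) s)" if s: "0 \<le> s" for s m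
  proof -
    define l where "l = ln (1 + s)"
    have l: "0 \<le> l" using s by (simp add: l_def)
    have "B * (1 + l ^ k) \<le> \<bar>B\<bar> * (1 + (1 + l ^ Suc k))"
      using power_pred_le[OF l, of "Suc k"] l by (intro mult_mono) auto
    also have "\<dots> \<le> \<bar>B\<bar> * (2 * (1 + l ^ Suc k))" using l by (intro mult_left_mono) auto
    also have "\<dots> = 2 * \<bar>B\<bar> * (1 + l ^ Suc k)" by (simp only: ac_simps)
    finally have "exit_moment k s m \<le> 2 * \<bar>B\<bar> * (1 + l ^ Suc k)"
      by (rule order_trans[OF B[OF s, of m, folded l_def]])
    moreover have "exit_moment 0 s m \<le> 1 + l ^ Suc k" using exit_moment_0_le_1[OF s, of m] zero_le_power[OF l, of "Suc k"] by linarith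
    ultimately have "exit_moment 0 s m + exit_moment k s m \<le> (1 + 2 * \<bar>B\<bar>) * (1 + l ^ Suc k)"
      by (simp add: algebra_simps)
    then have "C * (exit_moment 0 s m + exit_moment k s m) \<le> C * ((1 + 2 * \<bar>B\<bar>) * (1 + l ^ Suc k))"
      using C(1) by (intro mult_left_mono) auto
    moreover have "0 \<le> (\<integral>z. log_pow (Suc k) z \<partial>killed_law s m)" by (rule killed_law_integral_nonneg) auto
    ultimately have "(2 * real (Suc k) + 1) * exit_moment (Suc k) s m \<le> l ^ Suc k + C * ((1 + 2 * \<bar>B\<bar>) * (1 + l ^ Suc k))"
      using C(2)[OF s, of m] unfolding l_def by simp
    moreover have "exit_moment (Suc k) s m \<le> (2 * real (Suc k) + 1) * exit_moment (Suc k) s m"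
      using exit_moment_nonneg[of "Suc k" s m] by (simp add: mult_le_cancel_right1)
    ultimately have "exit_moment (Suc k) s m \<le> l ^ Suc k + C * ((1 + 2 * \<bar>B\<bar>) * (1 + l ^ Suc k))" by linarith
    also have "\<dots> \<le> (1 + C * (1 + 2 * \<bar>B\<bar>)) * (1 + l ^ Suc k)" by (simp add: algebra_simps)
    finally show ?thesis by (simp add: l_def)
  qed
  then show ?case by blast
qed

lemma exit_moment_summable:
  assumes s: "0 \<le> s"
  shows "summable (\<lambda>n. \<integral>z. tail z * log_pow k z \<partial>killed_law s n)"
proof -
  obtain B where B: "\<And>m. exit_moment k s m \<le> B * (1 + log_pow k s)"
    using exit_moment_bounded[of k] s by blast
  show ?thesis
    by (rule summableI_nonneg_bounded[OF exit_moment_term_nonneg]) (use B in \<open>simp add: exit_moment_def\<close>)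
qed

text \<open>The moment of order \<open>k + 1\<close> is bounded in time, so large distances are negligible; bounded distances have
  a total mass that is summable in time, since from there the level is passed with a probability that is
  bounded below. For \<open>k = 0\<close> this says that the walk passes the level almost surely.\<close>

lemma killed_log_moment_vanishes:
  assumes s: "0 \<le> s"
  shows "(\<lambda>m. \<integral>z. log_pow k z \<partial>killed_law s m) \<longlonglongrightarrow> 0"
proof (rule tendstoI)
  fix e :: real assume e: "0 < e"
  obtain B0 where B0: "\<And>m. exit_moment k s m \<le> B0 * (1 + log_pow k s)"
    using exit_moment_bounded[of k] s by blast
  obtain C where C: "0 \<le> C"
    "\<And>s m. 0 \<le> s \<Longrightarrow> \<bar>(2 * real (Suc k) + 1) * exit_moment (Suc k) s m - (log_pow (Suc k) s - (\<integral>z. log_pow (Suc k) z \<partial>killed_law s m))\<bar>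
      \<le> C * (exit_moment 0 s m + exit_moment (Suc k - 1) s m)"
    using exit_moment_identity[of "Suc k"] by auto
  define B where "B = log_pow (Suc k) s + C * (1 + B0 * (1 + log_pow k s)) + 1"
  have B: "(\<integral>z. log_pow (Suc k) z \<partial>killed_law s m) \<le> B" for m
  proof -
    have "C * (exit_moment 0 s m + exit_moment k s m) \<le> C * (1 + B0 * (1 + log_pow k s))"
      using C(1) B0[of m] exit_moment_0_le_1[OF s, of m] by (intro mult_left_mono add_mono)
    moreover have "0 \<le> (2 * real (Suc k) + 1) * exit_moment (Suc k) s m"
      using exit_moment_nonneg[of "Suc k" s m] by simp
    ultimately show ?thesis using C(2)[OF s, of m] unfolding B_def by simp
  qed
  have B_pos: "0 \<le> B" using B[of 0] killed_law_integral_nonneg[of "log_pow (Suc k)" s 0] by simp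
  \<comment> \<open>large enough that distances with a logarithm above \<open>L\<close> contribute less than \<open>e / 2\<close>\<close>
  define L where "L = 2 * B / e + 1"
  have L: "0 < L" "B / L < e / 2"
  proof -
    show "0 < L" using B_pos e by (simp add: L_def add_nonneg_pos)
    have "e / 2 * L = B + e / 2" using e by (simp add: L_def distrib_left)
    then have "B < e / 2 * L" using e by linarith
    then show "B / L < e / 2" using \<open>0 < L\<close> by (simp only: pos_divide_less_eq)
  qed
  define c where "c = L ^ k / tail (exp L - 1)"
  have c: "0 \<le> c" using L by (simp add: c_def less_imp_le[OF tail_pos])
  have bound: "log_pow k z \<le> c * tail z + log_pow (Suc k) z / L" if z: "0 \<le> z" for z
  proof (cases "ln (1 + z) \<le> L")
    case True
    then have "exp (ln (1 + z)) \<le> exp L" by simp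
    then have "z \<le> exp L - 1" using z by simp
    then have "tail (exp L - 1) \<le> tail z" by (rule tail_antimono)
    then have "c * tail (exp L - 1) \<le> c * tail z" using L c by (intro mult_left_mono) auto
    moreover have "c * tail (exp L - 1) = L ^ k" using tail_pos[of "exp L - 1"] by (simp add: c_def)
    moreover have "log_pow k z \<le> L ^ k" using True z by (intro power_mono) auto
    moreover have "0 \<le> log_pow (Suc k) z / L" using z L by (intro divide_nonneg_pos zero_le_power) auto
    ultimately show ?thesis by linarith
  next
    case False
    then have "log_pow k z * L \<le> log_pow k z * ln (1 + z)" using z by (intro mult_left_mono) auto
    also have "\<dots> = log_pow (Suc k) z" by simp
    finally have "log_pow k z * L \<le> log_pow (Suc k) z" .
    then have "log_pow k z \<le> log_pow (Suc k) z / L" using L by (simp only: pos_le_divide_eq)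
    moreover have "0 \<le> c * tail z" using c by (simp add: less_imp_le[OF tail_pos])
    ultimately show ?thesis by linarith
  qed
  have "(\<lambda>m. \<integral>z. tail z \<partial>killed_law s m) \<longlonglongrightarrow> 0"
    using summable_LIMSEQ_zero[OF exit_moment_summable[OF s, of 0]] by simp
  then have "(\<lambda>m. c * (\<integral>z. tail z \<partial>killed_law s m)) \<longlonglongrightarrow> c * 0" by (intro tendsto_mult tendsto_const)
  then have "\<forall>\<^sub>F m in sequentially. c * (\<integral>z. tail z \<partial>killed_law s m) < e / 2"
    using e by (intro order_tendstoD(2)[of _ "c * 0"]) auto
  then show "\<forall>\<^sub>F m in sequentially. dist (\<integral>z. log_pow k z \<partial>killed_law s m) 0 < e"
  proof eventually_elim
    case (elim m)
    have it: "integrable (killed_law s m) tail" using killed_law_tail_log_pow_integrable[OF s, of m 0] by simp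
    have "(\<integral>z. log_pow k z \<partial>killed_law s m) \<le> (\<integral>z. c * tail z + log_pow (Suc k) z / L \<partial>killed_law s m)"
      using it killed_law_log_pow_integrable[OF s, of m "Suc k"]
      by (intro killed_law_integral_mono bound killed_law_log_pow_integrable[OF s]) auto
    also have "\<dots> = c * (\<integral>z. tail z \<partial>killed_law s m) + (\<integral>z. log_pow (Suc k) z \<partial>killed_law s m) / L"
      using it killed_law_log_pow_integrable[OF s, of m "Suc k"] by simp
    also have "\<dots> < e / 2 + e / 2"
    proof (rule add_less_le_mono[OF elim])
      have "(\<integral>z. log_pow (Suc k) z \<partial>killed_law s m) / L \<le> B / L" using L by (intro divide_right_mono B) auto
      then show "(\<integral>z. log_pow (Suc k) z \<partial>killed_law s m) / L \<le> e / 2" by (rule order_trans) (use L in auto)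
    qed
    finally show ?case using killed_law_integral_nonneg[of "log_pow k" s m] by (simp add: dist_real_def)
  qed
qed

lemma exit_moment_0_sums: "0 \<le> s \<Longrightarrow> (\<lambda>n. \<integral>z. tail z \<partial>killed_law s n) sums 1"
proof -
  assume s: "0 \<le> s"
  have "(\<lambda>m. 1 - (\<integral>z. log_pow 0 z \<partial>killed_law s m)) \<longlonglongrightarrow> 1 - 0"
    by (intro tendsto_diff tendsto_const killed_log_moment_vanishes s)
  then show ?thesis unfolding exit_moment_0[OF s, symmetric] by (simp add: exit_moment_def sums_def)
qed

text \<open>The distance to the level just before the first passage. Also on the null event without a
  passage this is non-negative, whatever index the least element of the empty set denotes.\<close>

definition undershoot :: "real \<Rightarrow> 'a \<Rightarrow> real" where
  "undershoot s \<omega> = s - S (LEAST n. s < S (Suc n) \<omega>) \<omega>"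

lemma first_passage_least:
  assumes "\<omega> \<in> first_passage s n"
  shows "(LEAST n. s < S (Suc n) \<omega>) = n"
proof (rule Least_equality)
  show "s < S (Suc n) \<omega>" using assms unfolding first_passage_iff by simp
  fix m assume m: "s < S (Suc m) \<omega>"
  show "n \<le> m"
  proof (rule ccontr)
    assume "\<not> n \<le> m"
    then have "S (Suc m) \<omega> \<le> s" using assms unfolding first_passage_iff alive_def by (simp del: S_Suc)
    then show False using m by simp
  qed
qed

lemma undershoot_first_passage: "\<omega> \<in> first_passage s n \<Longrightarrow> undershoot s \<omega> = s - S n \<omega>"
  unfolding undershoot_def by (simp only: first_passage_least)

lemma undershoot_nonneg:
  assumes "0 \<le> s"
  shows "0 \<le> undershoot s \<omega>"
proof -
  define n where "n = (LEAST n. s < S (Suc n) \<omega>)"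
  have "S n \<omega> \<le> s"
  proof (cases n)
    case (Suc m)
    then have "\<not> s < S (Suc m) \<omega>" unfolding n_def by (intro not_less_Least) auto
    then show ?thesis by (simp only: Suc not_less)
  qed (use assms in simp)
  then show ?thesis by (simp add: undershoot_def n_def)
qed

lemma undershoot_measurable [measurable]: "undershoot s \<in> borel_measurable M"
proof -
  have L: "(\<lambda>\<omega>. LEAST n. s < S (Suc n) \<omega>) \<in> measurable M (count_space UNIV)"
    by (rule measurable_Least) (simp del: S_Suc)
  have "(\<lambda>\<omega>. (\<lambda>n \<omega>. s - S n \<omega>) (LEAST n. s < S (Suc n) \<omega>) \<omega>) \<in> borel_measurable M"
    by (rule measurable_compose_countable[OF _ L]) simp
  then show ?thesis unfolding undershoot_def[abs_def] .
qed

lemma tail_integrable_killed_law: "0 \<le> s \<Longrightarrow> integrable (killed_law s n) tail"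
  using killed_law_tail_log_pow_integrable[of s n 0] by simp

lemma AE_first_passage:
  assumes s: "0 \<le> s"
  shows "AE \<omega> in M. \<exists>n. \<omega> \<in> first_passage s n"
proof -
  have e: "emeasure M (first_passage s n) = ennreal (\<integral>z. tail z \<partial>killed_law s n)" for n
  proof -
    have "emeasure M (first_passage s n) = emeasure M {\<omega>\<in>first_passage s n. (\<lambda>_ _. True) (s - S n \<omega>) (X (Suc n) \<omega>)}" by simp
    also have "\<dots> = (\<integral>\<^sup>+z. emeasure jump_law {x. z < x \<and> True} \<partial>killed_law s n)"
      by (rule emeasure_first_passage) simp
    also have "\<dots> = (\<integral>\<^sup>+z. ennreal (tail z) \<partial>killed_law s n)"
      by (intro nn_integral_cong) (simp add: emeasure_jump_law_greater[unfolded greaterThan_def])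
    also have "\<dots> = ennreal (\<integral>z. tail z \<partial>killed_law s n)"
      by (rule nn_integral_eq_integral[OF tail_integrable_killed_law[OF s]]) (simp add: less_imp_le[OF tail_pos])
    finally show ?thesis .
  qed
  have "emeasure M (\<Union>n. first_passage s n) = (\<Sum>n. emeasure M (first_passage s n))"
    by (rule suminf_emeasure[symmetric]) (auto simp: disjoint_first_passage)
  also have "\<dots> = ennreal (\<Sum>n. \<integral>z. tail z \<partial>killed_law s n)"
    unfolding e
    by (rule suminf_ennreal2)
       (auto intro!: killed_law_integral_nonneg less_imp_le[OF tail_pos] sums_summable[OF exit_moment_0_sums[OF s]])
  also have "\<dots> = 1" using sums_unique[OF exit_moment_0_sums[OF s]] by simp
  finally have "prob (\<Union>n. first_passage s n) = 1" by (simp add: measure_def)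
  then have "AE \<omega> in M. \<omega> \<in> (\<Union>n. first_passage s n)" by (intro AE_prob_1)
  then show ?thesis by simp
qed

lemma nn_integral_undershoot:
  assumes s: "0 \<le> s" and [measurable]: "g \<in> borel_measurable borel"
  shows "(\<integral>\<^sup>+\<omega>. g (undershoot s \<omega>) \<partial>M) = (\<Sum>n. \<integral>\<^sup>+z. ennreal (tail z) * g z \<partial>killed_law s n)"
proof -
  have "(\<integral>\<^sup>+\<omega>. g (undershoot s \<omega>) \<partial>M) = (\<integral>\<^sup>+\<omega>. (\<Sum>n. indicator (first_passage s n) \<omega> * g (s - S n \<omega>)) \<partial>M)"
  proof (rule nn_integral_cong_AE, use AE_first_passage[OF s] in eventually_elim)
    fix \<omega> assume "\<exists>n. \<omega> \<in> first_passage s n"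
    then obtain n where n: "\<omega> \<in> first_passage s n" by blast
    have "indicator (first_passage s m) \<omega> * g (s - S m \<omega>) = (if m = n then g (undershoot s \<omega>) else 0)" for m
    proof (cases "m = n")
      case True
      then show ?thesis using n undershoot_first_passage[OF n] by simp
    next
      case False
      have "\<omega> \<notin> first_passage s m"
        using False first_passage_least[OF n] first_passage_least[of \<omega> s m] by metis
      then show ?thesis using False by simp
    qed
    then show "g (undershoot s \<omega>) = (\<Sum>n. indicator (first_passage s n) \<omega> * g (s - S n \<omega>))"
      using sums_unique[OF sums_single[of n "\<lambda>_. g (undershoot s \<omega>)"]] by simp
  qed
  also have "\<dots> = (\<Sum>n. \<integral>\<^sup>+\<omega>. indicator (first_passage s n) \<omega> * g (s - S n \<omega>) \<partial>M)"
    by (rule nn_integral_suminf) measurable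
  also have "\<dots> = (\<Sum>n. \<integral>\<^sup>+z. ennreal (tail z) * g z \<partial>killed_law s n)"
  proof (rule suminf_cong)
    fix n
    have "(\<integral>\<^sup>+\<omega>. indicator (first_passage s n) \<omega> * g (s - S n \<omega>) \<partial>M)
        = (\<integral>\<^sup>+\<omega>. indicator (alive s n) \<omega> * (\<lambda>z x. indicator {z<..} x * g z) (s - S n \<omega>) (X (Suc n) \<omega>) \<partial>M)"
      by (intro nn_integral_cong) (auto simp: first_passage_iff indicator_def algebra_simps)
    also have "\<dots> = (\<integral>\<^sup>+z. (\<integral>\<^sup>+x. indicator {z<..} x * g z \<partial>jump_law) \<partial>killed_law s n)"
    proof (rule nn_integral_next_jump)
      have "(\<lambda>p. (if fst p < snd p then 1 else 0) * g (fst p)) \<in> borel_measurable (borel \<Otimes>\<^sub>M borel)" by measurable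
      then show "(\<lambda>(z, x). indicator {z<..} x * g z) \<in> borel_measurable (borel \<Otimes>\<^sub>M borel)"
        by (simp add: case_prod_beta' indicator_def)
    qed
    also have "\<dots> = (\<integral>\<^sup>+z. ennreal (tail z) * g z \<partial>killed_law s n)"
      by (intro nn_integral_cong) (simp add: nn_integral_multc emeasure_jump_law_greater)
    finally show "(\<integral>\<^sup>+\<omega>. indicator (first_passage s n) \<omega> * g (s - S n \<omega>) \<partial>M) = (\<integral>\<^sup>+z. ennreal (tail z) * g z \<partial>killed_law s n)" .
  qed
  finally show ?thesis .
qed

text \<open>The first passage happens at time \<open>n + 1\<close> from the distance \<open>z\<close> with probability \<open>tail z\<close>.\<close>

lemma undershoot_expectation:
  assumes s: "0 \<le> s" and [measurable]: "g \<in> borel_measurable borel"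
    and nonneg: "\<And>z. 0 \<le> z \<Longrightarrow> 0 \<le> g z"
    and int: "\<And>n. integrable (killed_law s n) (\<lambda>z. tail z * g z)"
    and sm: "summable (\<lambda>n. \<integral>z. tail z * g z \<partial>killed_law s n)"
  shows "integrable M (\<lambda>\<omega>. g (undershoot s \<omega>))"
    and "expectation (\<lambda>\<omega>. g (undershoot s \<omega>)) = (\<Sum>n. \<integral>z. tail z * g z \<partial>killed_law s n)"
proof -
  have "(\<integral>\<^sup>+\<omega>. ennreal (g (undershoot s \<omega>)) \<partial>M) = (\<Sum>n. \<integral>\<^sup>+z. ennreal (tail z) * ennreal (g z) \<partial>killed_law s n)"
    by (rule nn_integral_undershoot[OF s]) simp
  also have "\<dots> = (\<Sum>n. ennreal (\<integral>z. tail z * g z \<partial>killed_law s n))"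
  proof (rule suminf_cong)
    fix n
    have "(\<integral>\<^sup>+z. ennreal (tail z) * ennreal (g z) \<partial>killed_law s n) = (\<integral>\<^sup>+z. ennreal (tail z * g z) \<partial>killed_law s n)"
      by (intro nn_integral_cong) (simp add: ennreal_mult' less_imp_le[OF tail_pos])
    also have "\<dots> = ennreal (\<integral>z. tail z * g z \<partial>killed_law s n)"
    proof (rule nn_integral_eq_integral[OF int])
      show "AE z in killed_law s n. 0 \<le> tail z * g z"
        using AE_killed_law_nonneg by eventually_elim (simp add: nonneg less_imp_le[OF tail_pos])
    qed
    finally show "(\<integral>\<^sup>+z. ennreal (tail z) * ennreal (g z) \<partial>killed_law s n) = ennreal (\<integral>z. tail z * g z \<partial>killed_law s n)" .
  qed
  also have "\<dots> = ennreal (\<Sum>n. \<integral>z. tail z * g z \<partial>killed_law s n)"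
    by (rule suminf_ennreal2[OF _ sm]) (auto intro!: killed_law_integral_nonneg mult_nonneg_nonneg nonneg less_imp_le[OF tail_pos])
  finally have e: "(\<integral>\<^sup>+\<omega>. ennreal (g (undershoot s \<omega>)) \<partial>M) = ennreal (\<Sum>n. \<integral>z. tail z * g z \<partial>killed_law s n)" .
  have gn: "0 \<le> g (undershoot s \<omega>)" for \<omega> by (intro nonneg undershoot_nonneg s)
  have sn: "0 \<le> (\<Sum>n. \<integral>z. tail z * g z \<partial>killed_law s n)"
    by (rule suminf_nonneg[OF sm]) (auto intro!: killed_law_integral_nonneg mult_nonneg_nonneg nonneg less_imp_le[OF tail_pos])
  show "integrable M (\<lambda>\<omega>. g (undershoot s \<omega>))"
    by (rule integrableI_nonneg) (use gn e in auto)
  show "expectation (\<lambda>\<omega>. g (undershoot s \<omega>)) = (\<Sum>n. \<integral>z. tail z * g z \<partial>killed_law s n)"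
    using e sn by (subst integral_eq_nn_integral) (use gn in auto)
qed

abbreviation undershoot_moment :: "nat \<Rightarrow> real \<Rightarrow> real" where
  "undershoot_moment k s \<equiv> expectation (\<lambda>\<omega>. log_pow k (undershoot s \<omega>))"

abbreviation undershoot_below :: "real \<Rightarrow> real \<Rightarrow> 'a set" where
  "undershoot_below a s \<equiv> {\<omega>\<in>space M. ln (1 + undershoot s \<omega>) \<le> a * ln s}"

lemma undershoot_log_moment:
  assumes s: "0 \<le> s"
  shows "integrable M (\<lambda>\<omega>. log_pow k (undershoot s \<omega>))"
    and "exit_moment k s \<longlonglongrightarrow> undershoot_moment k s"
proof -
  show "integrable M (\<lambda>\<omega>. log_pow k (undershoot s \<omega>))"
    using killed_law_tail_log_pow_integrable[OF s] exit_moment_summable[OF s]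
    by (intro undershoot_expectation(1)[OF s, where g="log_pow k"]) simp_all
  have "undershoot_moment k s = (\<Sum>n. \<integral>z. tail z * log_pow k z \<partial>killed_law s n)"
    using killed_law_tail_log_pow_integrable[OF s] exit_moment_summable[OF s]
    by (intro undershoot_expectation(2)[OF s, where g="log_pow k"]) simp_all
  then show "exit_moment k s \<longlonglongrightarrow> undershoot_moment k s"
    using summable_LIMSEQ[OF exit_moment_summable[OF s, of k]] unfolding exit_moment_def[abs_def] by simp
qed

text \<open>The limit of \<open>exit_moment_identity\<close> for \<open>m\<close> tending to infinity.\<close>

lemma undershoot_log_moment_recursion:
  assumes k: "1 \<le> k"
  obtains C where "0 \<le> C"
    "\<And>s. 0 \<le> s \<Longrightarrow> \<bar>(2 * real k + 1) * undershoot_moment k s - log_pow k s\<bar>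
      \<le> C * (1 + undershoot_moment (k - 1) s)"
proof -
  obtain C where C: "0 \<le> C"
    "\<And>s m. 0 \<le> s \<Longrightarrow> \<bar>(2 * real k + 1) * exit_moment k s m - (log_pow k s - (\<integral>z. log_pow k z \<partial>killed_law s m))\<bar>
      \<le> C * (exit_moment 0 s m + exit_moment (k - 1) s m)"
    using exit_moment_identity[OF k] by blast
  show ?thesis
  proof (rule that[OF C(1)])
    fix s :: real assume s: "0 \<le> s"
    have "exit_moment 0 s \<longlonglongrightarrow> 1" using undershoot_log_moment(2)[OF s, of 0] by (simp add: prob_space)
    then have lim1: "(\<lambda>m. C * (exit_moment 0 s m + exit_moment (k - 1) s m))
        \<longlonglongrightarrow> C * (1 + undershoot_moment (k - 1) s)"
      by (intro tendsto_intros undershoot_log_moment s)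
    have lim2: "(\<lambda>m. \<bar>(2 * real k + 1) * exit_moment k s m - (log_pow k s - (\<integral>z. log_pow k z \<partial>killed_law s m))\<bar>)
        \<longlonglongrightarrow> \<bar>(2 * real k + 1) * undershoot_moment k s - (log_pow k s - 0)\<bar>"
      by (intro tendsto_intros undershoot_log_moment killed_log_moment_vanishes s)
    have "\<bar>(2 * real k + 1) * undershoot_moment k s - (log_pow k s - 0)\<bar>
        \<le> C * (1 + undershoot_moment (k - 1) s)"
      by (rule LIMSEQ_le[OF lim2 lim1]) (use C(2)[OF s] in blast)
    then show "\<bar>(2 * real k + 1) * undershoot_moment k s - log_pow k s\<bar>
        \<le> C * (1 + undershoot_moment (k - 1) s)" by simp
  qed
qed

text \<open>Induction on \<open>k\<close>: after division by the power of \<open>ln s\<close>, the error in the recursion vanishes.\<close>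

lemma undershoot_log_moment_limit:
  "((\<lambda>s. undershoot_moment k s / ln s ^ k) \<longlongrightarrow> 1 / (2 * real k + 1)) at_top"
proof (induction k)
  case 0
  show ?case by (simp add: prob_space)
next
  case (Suc k)
  let ?E = "\<lambda>k s. undershoot_moment k s"
  obtain C where C: "0 \<le> C"
    "\<And>s. 0 \<le> s \<Longrightarrow> \<bar>(2 * real (Suc k) + 1) * ?E (Suc k) s - log_pow (Suc k) s\<bar> \<le> C * (1 + ?E (Suc k - 1) s)"
    using undershoot_log_moment_recursion[of "Suc k"] by auto
  have ln_inv: "((\<lambda>s::real. inverse (ln s)) \<longlongrightarrow> 0) at_top" by real_asymp
  have "((\<lambda>s. C * (inverse (ln s) ^ Suc k + ?E k s / ln s ^ k * inverse (ln s))) \<longlongrightarrow> C * (0 ^ Suc k + 1 / (2 * real k + 1) * 0)) at_top"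
    by (intro tendsto_intros ln_inv Suc)
  then have lim0: "((\<lambda>s. C * (inverse (ln s) ^ Suc k + ?E k s / ln s ^ k * inverse (ln s))) \<longlongrightarrow> 0) at_top" by simp
  have "((\<lambda>s. (2 * real (Suc k) + 1) * ?E (Suc k) s / ln s ^ Suc k - (ln (1 + s) / ln s) ^ Suc k) \<longlongrightarrow> 0) at_top"
  proof (rule Lim_null_comparison[OF _ lim0])
    show "\<forall>\<^sub>F s in at_top. norm ((2 * real (Suc k) + 1) * ?E (Suc k) s / ln s ^ Suc k - (ln (1 + s) / ln s) ^ Suc k)
        \<le> C * (inverse (ln s) ^ Suc k + ?E k s / ln s ^ k * inverse (ln s))"
    proof (rule eventually_mono[OF eventually_gt_at_top[of 1]])
      fix s :: real assume s: "1 < s"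
      define l where "l = ln s"
      have l: "0 < l" using s by (simp add: l_def)
      have "norm ((2 * real (Suc k) + 1) * ?E (Suc k) s / l ^ Suc k - (ln (1 + s) / l) ^ Suc k)
        = \<bar>((2 * real (Suc k) + 1) * ?E (Suc k) s - log_pow (Suc k) s) / l ^ Suc k\<bar>"
        by (simp only: power_divide diff_divide_distrib real_norm_def)
      also have "\<dots> = \<bar>(2 * real (Suc k) + 1) * ?E (Suc k) s - log_pow (Suc k) s\<bar> / l ^ Suc k"
        using l by (simp only: abs_divide power_abs abs_of_pos)
      also have "\<dots> \<le> C * (1 + ?E (Suc k - 1) s) / l ^ Suc k"
        using l s by (intro divide_right_mono C(2)) auto
      also have "\<dots> = C * (inverse l ^ Suc k + ?E k s / l ^ k * inverse l)"
        using l by (simp add: field_simps power_inverse)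
      finally show "norm ((2 * real (Suc k) + 1) * ?E (Suc k) s / ln s ^ Suc k - (ln (1 + s) / ln s) ^ Suc k)
        \<le> C * (inverse (ln s) ^ Suc k + ?E k s / ln s ^ k * inverse (ln s))" by (simp only: l_def)
    qed
  qed
  moreover have "((\<lambda>s::real. ln (1 + s) / ln s) \<longlongrightarrow> 1) at_top" by real_asymp
  then have "((\<lambda>s::real. (ln (1 + s) / ln s) ^ Suc k) \<longlongrightarrow> 1 ^ Suc k) at_top" by (rule tendsto_power)
  ultimately have "((\<lambda>s. ((2 * real (Suc k) + 1) * ?E (Suc k) s / ln s ^ Suc k - (ln (1 + s) / ln s) ^ Suc k) + (ln (1 + s) / ln s) ^ Suc k) \<longlongrightarrow> 0 + 1 ^ Suc k) at_top"
    by (rule tendsto_add)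
  then have "((\<lambda>s. (2 * real (Suc k) + 1) * (?E (Suc k) s / ln s ^ Suc k)) \<longlongrightarrow> 1) at_top" by simp
  then have "((\<lambda>s. (2 * real (Suc k) + 1) * (?E (Suc k) s / ln s ^ Suc k) / (2 * real (Suc k) + 1)) \<longlongrightarrow> 1 / (2 * real (Suc k) + 1)) at_top"
    by (intro tendsto_divide tendsto_const) auto
  moreover have "(2 * real (Suc k) + 1) * x / (2 * real (Suc k) + 1) = x" for x
    by (rule nonzero_mult_div_cancel_left) linarith
  ultimately show ?case by simp
qed

text \<open>The undershoot is of the order \<open>s\<close> to the power of the square of a uniform variable.\<close>

theorem undershoot_limit_law:
  assumes a: "0 \<le> a"
  shows "((\<lambda>s. prob (undershoot_below a s)) \<longlongrightarrow> sqrt (min 1 a)) at_top"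
proof -
  have "((\<lambda>s. prob {\<omega>\<in>space M. ln (1 + undershoot s \<omega>) / ln s \<le> a}) \<longlongrightarrow> sqrt (min 1 a)) at_top"
  proof (rule square_root_law_from_moments)
    show "(\<lambda>\<omega>. ln (1 + undershoot s \<omega>) / ln s) \<in> borel_measurable M" for s by measurable
    show "\<forall>\<^sub>F s in at_top. \<forall>\<omega>\<in>space M. 0 \<le> ln (1 + undershoot s \<omega>) / ln s"
      by (rule eventually_mono[OF eventually_gt_at_top[of 1]]) (simp add: undershoot_nonneg)
    show "\<forall>\<^sub>F s in at_top. integrable M (\<lambda>\<omega>. (ln (1 + undershoot s \<omega>) / ln s) ^ k)" for k
      by (rule eventually_mono[OF eventually_gt_at_top[of 1]]) (simp add: power_divide undershoot_log_moment)
    show "((\<lambda>s. expectation (\<lambda>\<omega>. (ln (1 + undershoot s \<omega>) / ln s) ^ k)) \<longlongrightarrow> 1 / (2 * real k + 1)) at_top" for k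
      using undershoot_log_moment_limit[of k] by (simp add: power_divide)
  qed (rule a)
  moreover have "\<forall>\<^sub>F s in at_top. prob {\<omega>\<in>space M. ln (1 + undershoot s \<omega>) / ln s \<le> a} = prob (undershoot_below a s)"
    by (rule eventually_mono[OF eventually_gt_at_top[of 1]]) (simp add: pos_divide_le_eq)
  ultimately show ?thesis by (rule Lim_transform_eventually)
qed

text \<open>This quantity measures all the errors that come from small undershoots.\<close>

definition mean_inverse_undershoot :: "real \<Rightarrow> real" where
  "mean_inverse_undershoot s = expectation (\<lambda>\<omega>. 1 / (1 + undershoot s \<omega>))"

lemma inverse_undershoot_integrable: "0 \<le> s \<Longrightarrow> integrable M (\<lambda>\<omega>. 1 / (1 + undershoot s \<omega>))"
proof (rule integrable_const_bound[of _ 1])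
  assume s: "0 \<le> s"
  show "AE \<omega> in M. norm (1 / (1 + undershoot s \<omega>)) \<le> 1"
  proof (rule AE_I2)
    fix \<omega>
    have "0 \<le> undershoot s \<omega>" by (rule undershoot_nonneg[OF s])
    then show "norm (1 / (1 + undershoot s \<omega>)) \<le> 1" by simp
  qed
qed measurable

lemma mean_inverse_undershoot_nonneg: "0 \<le> s \<Longrightarrow> 0 \<le> mean_inverse_undershoot s"
  unfolding mean_inverse_undershoot_def by (rule Bochner_Integration.integral_nonneg) (simp add: undershoot_nonneg add_nonneg_nonneg)

lemma mean_inverse_undershoot_tendsto: "(mean_inverse_undershoot \<longlongrightarrow> 0) at_top"
proof (rule tendstoI)
  fix e :: real assume e: "0 < e"
  define a where "a = (e / 2)\<^sup>2"
  have a: "0 < a" using e by (simp add: a_def)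
  have "((\<lambda>s::real. s powr - a) \<longlongrightarrow> 0) at_top" using a by real_asymp
  then have "((\<lambda>s. prob (undershoot_below a s) + s powr - a) \<longlongrightarrow> sqrt (min 1 a) + 0) at_top"
    using a by (intro tendsto_add undershoot_limit_law) auto
  moreover have "sqrt (min 1 a) + 0 < e"
  proof -
    have "sqrt (min 1 a) \<le> sqrt a" by simp
    also have "\<dots> = e / 2" using e by (simp add: a_def)
    finally show ?thesis using e by simp
  qed
  ultimately have "\<forall>\<^sub>F s in at_top. prob (undershoot_below a s) + s powr - a < e"
    by (rule order_tendstoD(2))
  then show "\<forall>\<^sub>F s in at_top. dist (mean_inverse_undershoot s) 0 < e"
    using eventually_gt_at_top[of 1]
  proof eventually_elim
    case (elim s)
    then have s: "0 \<le> s" by simp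
    have "mean_inverse_undershoot s \<le> expectation (\<lambda>\<omega>. indicator (undershoot_below a s) \<omega> + s powr - a)"
      unfolding mean_inverse_undershoot_def
    proof (rule integral_mono)
      fix \<omega> assume \<omega>: "\<omega> \<in> space M"
      have z: "0 \<le> undershoot s \<omega>" by (rule undershoot_nonneg[OF s])
      show "1 / (1 + undershoot s \<omega>) \<le> indicator (undershoot_below a s) \<omega> + s powr - a"
      proof (cases "ln (1 + undershoot s \<omega>) \<le> a * ln s")
        case True
        have "1 / (1 + undershoot s \<omega>) \<le> 1" using z by (simp add: divide_le_eq_1)
        then show ?thesis using True \<omega> by (simp add: add_increasing2)
      next
        case False
        then have "exp (a * ln s) \<le> exp (ln (1 + undershoot s \<omega>))" by simp
        then have "s powr a \<le> 1 + undershoot s \<omega>" using z elim by (simp add: powr_def)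
        then have "1 / (1 + undershoot s \<omega>) \<le> 1 / s powr a" using elim z by (intro divide_left_mono mult_pos_pos) auto
        then show ?thesis using False by (simp add: powr_minus_divide)
      qed
    qed (use inverse_undershoot_integrable[OF s] in \<open>auto intro!: integrable_real_indicator simp: emeasure_eq_measure\<close>)
    also have "\<dots> = prob (undershoot_below a s) + s powr - a"
      by (subst Bochner_Integration.integral_add) (auto intro!: integrable_real_indicator simp: emeasure_eq_measure prob_space)
    finally show ?case using elim mean_inverse_undershoot_nonneg[OF s] by (simp add: dist_real_def)
  qed
qed

section \<open>Total reward and parity\<close>

lemma killed_law_reward_integrable:
  assumes s: "0 \<le> s" and b: "0 < b" "b \<le> 1" and c: "0 \<le> c"
  shows "integrable (killed_law s n) (exit_reward b c)"
  by (rule killed_law_integrable_bound[OF tail_integrable_killed_law[OF s]])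
     (simp_all add: exit_reward_nonneg exit_reward_le_tail b c)

lemma killed_law_reward_summable:
  assumes s: "0 \<le> s" and b: "0 < b" "b \<le> 1" and c: "0 \<le> c"
  shows "summable (\<lambda>n. \<integral>z. exit_reward b c z \<partial>killed_law s n)"
proof (rule summable_comparison_test'[OF sums_summable[OF exit_moment_0_sums[OF s]], of 0])
  fix n
  have "(\<integral>z. exit_reward b c z \<partial>killed_law s n) \<le> (\<integral>z. tail z \<partial>killed_law s n)"
    by (intro killed_law_integral_mono killed_law_reward_integrable tail_integrable_killed_law exit_reward_le_tail s b c)
  moreover have "0 \<le> (\<integral>z. exit_reward b c z \<partial>killed_law s n)"
    by (intro killed_law_integral_nonneg exit_reward_nonneg)
  ultimately show "norm (\<integral>z. exit_reward b c z \<partial>killed_law s n) \<le> (\<integral>z. tail z \<partial>killed_law s n)" by simp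
qed

text \<open>The conditional probability of the prescribed exit, given that the next jump passes the level.\<close>

definition exit_ratio :: "real \<Rightarrow> real \<Rightarrow> real \<Rightarrow> real" where
  "exit_ratio b c z = exit_reward b c z / tail z"

lemma exit_ratio_expectation:
  assumes s: "0 \<le> s" and b: "0 < b" "b \<le> 1" and c: "0 \<le> c"
  shows "integrable M (\<lambda>\<omega>. exit_ratio b c (undershoot s \<omega>))"
    and "expectation (\<lambda>\<omega>. exit_ratio b c (undershoot s \<omega>)) = (\<Sum>n. \<integral>z. exit_reward b c z \<partial>killed_law s n)"
proof -
  have m: "exit_ratio b c \<in> borel_measurable borel" unfolding exit_ratio_def[abs_def] by measurable
  have t: "tail z * exit_ratio b c z = exit_reward b c z" for z
    using tail_pos[of z] by (simp add: exit_ratio_def)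
  have n: "0 \<le> exit_ratio b c z" for z
    using tail_pos[of z] by (simp add: exit_ratio_def exit_reward_nonneg)
  show "integrable M (\<lambda>\<omega>. exit_ratio b c (undershoot s \<omega>))"
    by (rule undershoot_expectation(1)[OF s m n]) (simp_all only: t killed_law_reward_integrable[OF s b c] killed_law_reward_summable[OF s b c])
  show "expectation (\<lambda>\<omega>. exit_ratio b c (undershoot s \<omega>)) = (\<Sum>n. \<integral>z. exit_reward b c z \<partial>killed_law s n)"
    using undershoot_expectation(2)[OF s m n] killed_law_reward_integrable[OF s b c] killed_law_reward_summable[OF s b c]
    by (simp only: t)
qed

text \<open>A jump of size at most \<open>w\<close> that passes the level starts at a distance of at most \<open>w\<close>.\<close>

lemma exit_ratio_upper:
  assumes b: "0 < b" "b \<le> 1" and z: "0 \<le> z"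
  shows "exit_ratio b (tail w) z \<le> b\<^sup>2 * indicator {..w} z + 32 / (1 + z)"
proof (cases "z \<le> w")
  case True
  have "exit_reward b (tail w) z \<le> tail (z / b)"
    using tail_pos[of w] tail_pos[of "z / b"] by (simp add: exit_reward_def)
  also have "\<dots> \<le> b\<^sup>2 * tail z + 8 / (1 + z) ^ 3" using tail_scaling[OF z b] by linarith
  also have "8 / (1 + z) ^ 3 = 8 / (1 + z) * (1 / (1 + z)\<^sup>2)" by (simp add: power3_eq_cube power2_eq_square)
  also have "\<dots> \<le> 8 / (1 + z) * (4 * tail z)" using z by (intro mult_left_mono weight_le_tail) auto
  finally have "exit_reward b (tail w) z \<le> (b\<^sup>2 + 32 / (1 + z)) * tail z" by (simp add: algebra_simps)
  then show ?thesis using True tail_pos[of z] by (simp add: exit_ratio_def pos_divide_le_eq)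
next
  case False
  have "z \<le> z / b" using b z by (simp add: pos_le_divide_eq mult_left_le)
  then have "tail (z / b) \<le> tail w" using False by (intro tail_antimono) auto
  then have "exit_reward b (tail w) z = 0" by (simp add: exit_reward_def)
  then show ?thesis using z by (simp add: exit_ratio_def)
qed

text \<open>From a distance of at most \<open>s powr v\<close> with \<open>v < u\<close>, jumps beyond \<open>s powr u\<close> are negligible among those
  that pass the level.\<close>

lemma exit_ratio_lower:
  assumes b: "0 < b" "b \<le> 1" and z: "0 \<le> z" and s: "1 < s"
  shows "b\<^sup>2 * indicator {z. ln (1 + z) \<le> v * ln s} z - 32 / (1 + z) - 4 * s powr (2 * (v - u)) \<le> exit_ratio b (tail (s powr u)) z"
proof (cases "ln (1 + z) \<le> v * ln s")
  case True
  then have "exp (ln (1 + z)) \<le> exp (v * ln s)" by simp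
  then have zv: "1 + z \<le> s powr v" using z s by (simp add: powr_def)
  have w: "0 < s powr u" using s by simp
  have "tail (s powr u) \<le> 1 / (1 + s powr u)\<^sup>2" using w by (intro tail_le_weight) auto
  also have "\<dots> \<le> 1 / (s powr u)\<^sup>2" by (intro frac_le power_mono) (use w in auto)
  also have "\<dots> = s powr (2 * (v - u)) * (1 / (s powr v)\<^sup>2)"
  proof -
    have "s powr (2 * (v - u)) = (s powr v)\<^sup>2 / (s powr u)\<^sup>2"
      by (simp add: power2_eq_square powr_add[symmetric] powr_diff[symmetric] algebra_simps)
    then show ?thesis using s by simp
  qed
  also have "\<dots> \<le> s powr (2 * (v - u)) * (1 / (1 + z)\<^sup>2)"
    using zv z by (intro mult_left_mono divide_left_mono power_mono mult_pos_pos) auto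
  also have "\<dots> \<le> s powr (2 * (v - u)) * (4 * tail z)" by (intro mult_left_mono weight_le_tail z) auto
  finally have tw: "tail (s powr u) \<le> 4 * s powr (2 * (v - u)) * tail z" by simp
  have "8 / (1 + z) ^ 3 = 8 / (1 + z) * (1 / (1 + z)\<^sup>2)" by (simp add: power3_eq_cube power2_eq_square)
  also have "\<dots> \<le> 8 / (1 + z) * (4 * tail z)" using z by (intro mult_left_mono weight_le_tail) auto
  finally have e: "8 / (1 + z) ^ 3 \<le> 32 / (1 + z) * tail z" by simp
  have "(b\<^sup>2 - 32 / (1 + z) - 4 * s powr (2 * (v - u))) * tail z \<le> tail (z / b) - tail (s powr u)"
    using tail_scaling[OF z b] tw e unfolding left_diff_distrib by linarith
  also have "\<dots> \<le> exit_reward b (tail (s powr u)) z" by (simp add: exit_reward_def)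
  finally show ?thesis using True tail_pos[of z] by (simp add: exit_ratio_def pos_le_divide_eq)
next
  case False
  have "0 \<le> exit_ratio b (tail (s powr u)) z" using tail_pos[of z] by (simp add: exit_ratio_def exit_reward_nonneg)
  moreover have "0 \<le> 32 / (1 + z)" "0 \<le> 4 * s powr (2 * (v - u))" using z by auto
  moreover have "b\<^sup>2 * indicator {z. ln (1 + z) \<le> v * ln s} z = 0" using False by simp
  ultimately show ?thesis by linarith
qed

lemma undershoot_power_limit:
  assumes u: "0 \<le> u" "u \<le> 1" and e: "sqrt u < e"
  shows "\<forall>\<^sub>F s in at_top. prob {\<omega>\<in>space M. undershoot s \<omega> \<le> s powr u} < e"
proof -
  have e0: "0 < e" using e u real_sqrt_ge_zero[of u] by linarith
  \<comment> \<open>any exponent strictly between \<open>u\<close> and \<open>e\<^sup>2\<close>: the first gap absorbs the difference between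
    \<open>ln (1 + Z)\<close> and \<open>ln Z\<close>, the second one keeps the limit below \<open>e\<close>\<close>
  define a where "a = (u + e\<^sup>2) / 2"
  have "u < e\<^sup>2" using power_strict_mono[OF e real_sqrt_ge_zero[OF u(1)], of 2] u by simp
  then have a: "u < a" "a < e\<^sup>2" by (auto simp: a_def)
  have "sqrt (min 1 a) \<le> sqrt a" by simp
  also have "\<dots> < e" using a e0 by (intro real_less_lsqrt) (use u in auto)
  finally have "\<forall>\<^sub>F s in at_top. prob (undershoot_below a s) < e"
    using undershoot_limit_law[of a] a u by (intro order_tendstoD(2)[OF undershoot_limit_law]) auto
  moreover have "\<forall>\<^sub>F s in at_top. ln (1 + s powr u) \<le> a * ln s"
  proof -
    have "filterlim (\<lambda>s. (a - u) * ln s) at_top at_top"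
      using a by (intro filterlim_tendsto_pos_mult_at_top[OF tendsto_const _ ln_at_top]) auto
    then have "\<forall>\<^sub>F s in at_top. ln 2 \<le> (a - u) * ln s" unfolding filterlim_at_top by blast
    then show ?thesis using eventually_gt_at_top[of 1]
    proof eventually_elim
      case (elim s)
      have "1 \<le> s powr u" using elim u by (simp add: ge_one_powr_ge_zero)
      then have "ln (1 + s powr u) \<le> ln (2 * s powr u)" by (subst ln_le_cancel_iff) auto
      also have "\<dots> = ln 2 + u * ln s" using elim by (subst ln_mult_pos) (auto simp: ln_powr)
      also have "\<dots> \<le> a * ln s" using elim by (simp add: left_diff_distrib)
      finally show ?case .
    qed
  qed
  ultimately show ?thesis using eventually_gt_at_top[of 1]
  proof eventually_elim
    case (elim s)
    have "prob {\<omega>\<in>space M. undershoot s \<omega> \<le> s powr u} \<le> prob (undershoot_below a s)"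
    proof (rule finite_measure_mono)
      show "{\<omega>\<in>space M. undershoot s \<omega> \<le> s powr u} \<subseteq> undershoot_below a s"
      proof safe
        fix \<omega> assume "undershoot s \<omega> \<le> s powr u"
        then have "ln (1 + undershoot s \<omega>) \<le> ln (1 + s powr u)"
          using undershoot_nonneg[of s \<omega>] elim by (subst ln_le_cancel_iff) auto
        then show "ln (1 + undershoot s \<omega>) \<le> a * ln s" using elim by linarith
      qed
    qed measurable
    then show ?case using elim by linarith
  qed
qed

text \<open>Up to vanishing errors the conditional exit probability is \<open>b\<^sup>2\<close> if the undershoot is at most
  \<open>s powr u\<close> and \<open>0\<close> otherwise, so the square-root law of the undershoot applies.\<close>

theorem total_reward_limit:
  assumes b: "0 < b" "b \<le> 1" and u: "0 \<le> u" "u \<le> 1"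
  shows "((\<lambda>s. \<Sum>n. \<integral>z. exit_reward b (tail (s powr u)) z \<partial>killed_law s n) \<longlongrightarrow> b\<^sup>2 * sqrt u) at_top"
proof -
  let ?G = "\<lambda>s. \<Sum>n. \<integral>z. exit_reward b (tail (s powr u)) z \<partial>killed_law s n"
  have b2: "0 < b\<^sup>2" using b by simp
  have G: "?G s = expectation (\<lambda>\<omega>. exit_ratio b (tail (s powr u)) (undershoot s \<omega>))" if "0 \<le> s" for s
    using exit_ratio_expectation(2)[OF that b, of "tail (s powr u)"] tail_pos[of "s powr u"] by simp
  have Gint: "integrable M (\<lambda>\<omega>. exit_ratio b (tail (s powr u)) (undershoot s \<omega>))" if "0 \<le> s" for s
    using exit_ratio_expectation(1)[OF that b, of "tail (s powr u)"] tail_pos[of "s powr u"] by simp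
  have ii: "integrable M (indicator A :: 'a \<Rightarrow> real)" if "A \<in> sets M" for A
    using that by (intro integrable_real_indicator) (auto simp: emeasure_eq_measure)
  show ?thesis
  proof (rule order_tendstoI)
    fix e assume e: "b\<^sup>2 * sqrt u < e"
    define d where "d = e / b\<^sup>2 - sqrt u"
    have d: "0 < d" using e b2 by (simp add: d_def field_simps)
    have "\<forall>\<^sub>F s in at_top. prob {\<omega>\<in>space M. undershoot s \<omega> \<le> s powr u} < sqrt u + d / 2"
      by (rule undershoot_power_limit[OF u]) (use d in simp)
    moreover have "\<forall>\<^sub>F s in at_top. mean_inverse_undershoot s < b\<^sup>2 * d / 64"
      by (rule order_tendstoD(2)[OF mean_inverse_undershoot_tendsto]) (use d b2 in simp)
    ultimately show "\<forall>\<^sub>F s in at_top. ?G s < e" using eventually_gt_at_top[of 1]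
    proof eventually_elim
      case (elim s)
      then have s: "0 \<le> s" by simp
      have "?G s \<le> expectation (\<lambda>\<omega>. b\<^sup>2 * indicator {\<omega>\<in>space M. undershoot s \<omega> \<le> s powr u} \<omega> + 32 * (1 / (1 + undershoot s \<omega>)))"
        unfolding G[OF s]
      proof (rule integral_mono[OF Gint[OF s]])
        show "integrable M (\<lambda>\<omega>. b\<^sup>2 * indicator {\<omega>\<in>space M. undershoot s \<omega> \<le> s powr u} \<omega> + 32 * (1 / (1 + undershoot s \<omega>)))"
          by (intro Bochner_Integration.integrable_add integrable_mult_right ii inverse_undershoot_integrable s) measurable
        fix \<omega> assume "\<omega> \<in> space M"
        then show "exit_ratio b (tail (s powr u)) (undershoot s \<omega>) \<le> b\<^sup>2 * indicator {\<omega>\<in>space M. undershoot s \<omega> \<le> s powr u} \<omega> + 32 * (1 / (1 + undershoot s \<omega>))"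
          using exit_ratio_upper[OF b undershoot_nonneg[OF s, of \<omega>], of "s powr u"] by (simp add: indicator_def)
      qed
      also have "\<dots> = b\<^sup>2 * prob {\<omega>\<in>space M. undershoot s \<omega> \<le> s powr u} + 32 * mean_inverse_undershoot s"
      proof -
        have 1: "integrable M (\<lambda>\<omega>. b\<^sup>2 * indicator {\<omega>\<in>space M. undershoot s \<omega> \<le> s powr u} \<omega>)"
          by (intro integrable_mult_right ii) measurable
        have 2: "integrable M (\<lambda>\<omega>. 32 * (1 / (1 + undershoot s \<omega>)))"
          by (rule integrable_mult_right) (rule inverse_undershoot_integrable[OF s])
        have 3: "expectation (\<lambda>\<omega>. 32 * (1 / (1 + undershoot s \<omega>))) = 32 * mean_inverse_undershoot s"
          unfolding mean_inverse_undershoot_def by (rule integral_mult_right_zero)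
        show ?thesis unfolding Bochner_Integration.integral_add[OF 1 2] 3 by simp
      qed
      also have "\<dots> < b\<^sup>2 * (sqrt u + d / 2) + 32 * (b\<^sup>2 * d / 64)"
        using elim b2 by (intro add_strict_mono mult_strict_left_mono) auto
      also have "\<dots> = b\<^sup>2 * (sqrt u + d)" by (simp add: algebra_simps)
      also have "\<dots> = e" using b2 by (simp add: d_def)
      finally show ?case .
    qed
  next
    fix e assume e: "e < b\<^sup>2 * sqrt u"
    show "\<forall>\<^sub>F s in at_top. e < ?G s"
    proof (cases "e < 0")
      case True
      have "0 \<le> ?G s" if "0 \<le> s" for s unfolding G[OF that]
        by (rule Bochner_Integration.integral_nonneg)
           (simp add: exit_ratio_def exit_reward_nonneg less_imp_le[OF tail_pos])
      then show ?thesis using True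
        by (intro eventually_mono[OF eventually_ge_at_top[of 0]]) (auto intro: less_le_trans)
    next
      case False
      define d where "d = sqrt u - e / b\<^sup>2"
      have d: "0 < d" using e b2 by (simp add: d_def field_simps)
      have "0 \<le> e / b\<^sup>2" using False by simp
      \<comment> \<open>the exponent \<open>v = r\<^sup>2\<close> is slightly smaller than \<open>u\<close>; the total gap \<open>d\<close> is divided among the loss
        from \<open>u\<close> to \<open>v\<close> and three further errors\<close>
      define r where "r = sqrt u - d / 4"
      have r: "0 \<le> r" "r < sqrt u" using d \<open>0 \<le> e / b\<^sup>2\<close> by (auto simp: r_def d_def)
      define v where "v = r\<^sup>2"
      have "v < u" using power_strict_mono[OF r(2,1), of 2] u by (simp add: v_def)
      have v: "0 \<le> v" "sqrt (min 1 v) = r" using r \<open>v < u\<close> u by (auto simp: v_def min_def)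
      have "\<forall>\<^sub>F s in at_top. r - d / 4 < prob (undershoot_below v s)"
        by (rule order_tendstoD(1)[OF undershoot_limit_law[OF v(1)]]) (use d v in simp)
      moreover have "\<forall>\<^sub>F s in at_top. mean_inverse_undershoot s < b\<^sup>2 * d / 128"
        by (rule order_tendstoD(2)[OF mean_inverse_undershoot_tendsto]) (use d b2 in simp)
      moreover have "\<forall>\<^sub>F s::real in at_top. s powr (2 * (v - u)) < b\<^sup>2 * d / 16"
      proof (rule order_tendstoD(2))
        have "2 * (v - u) < 0" using \<open>v < u\<close> by simp
        then show "((\<lambda>s::real. s powr (2 * (v - u))) \<longlongrightarrow> 0) at_top" by (rule tendsto_neg_powr[OF _ filterlim_ident])
      qed (use d b2 in simp)
      ultimately show ?thesis using eventually_gt_at_top[of 1]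
      proof eventually_elim
        case (elim s)
        then have s: "0 \<le> s" by simp
        let ?A = "undershoot_below v s"
        have "e = b\<^sup>2 * (r - d / 4) - 32 * (b\<^sup>2 * d / 128) - 4 * (b\<^sup>2 * d / 16)"
        proof -
          have "e = b\<^sup>2 * (sqrt u - d)" using b2 by (simp add: d_def)
          then show ?thesis by (simp add: r_def algebra_simps)
        qed
        also have "\<dots> < b\<^sup>2 * prob ?A - 32 * mean_inverse_undershoot s - 4 * s powr (2 * (v - u))"
        proof -
          have "b\<^sup>2 * (r - d / 4) < b\<^sup>2 * prob ?A" using elim b2 by (intro mult_strict_left_mono) auto
          then show ?thesis using elim by linarith
        qed
        also have "\<dots> = expectation (\<lambda>\<omega>. b\<^sup>2 * indicator ?A \<omega> - 32 * (1 / (1 + undershoot s \<omega>)) - 4 * s powr (2 * (v - u)))"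
        proof -
          have 1: "integrable M (\<lambda>\<omega>. b\<^sup>2 * indicator ?A \<omega>)" by (intro integrable_mult_right ii) measurable
          have 2: "integrable M (\<lambda>\<omega>. 32 * (1 / (1 + undershoot s \<omega>)))"
            by (rule integrable_mult_right) (rule inverse_undershoot_integrable[OF s])
          have 3: "expectation (\<lambda>\<omega>. b\<^sup>2 * indicator ?A \<omega>) = b\<^sup>2 * prob ?A" by simp
          have 4: "expectation (\<lambda>\<omega>. 32 * (1 / (1 + undershoot s \<omega>))) = 32 * mean_inverse_undershoot s"
            unfolding mean_inverse_undershoot_def by (rule integral_mult_right_zero)
          show ?thesis
            unfolding Bochner_Integration.integral_diff[OF Bochner_Integration.integrable_diff[OF 1 2] integrable_const]
              Bochner_Integration.integral_diff[OF 1 2] 3 4 by (simp add: prob_space)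
        qed
        also have "\<dots> \<le> ?G s" unfolding G[OF s]
        proof (rule integral_mono[OF _ Gint[OF s]])
          show "integrable M (\<lambda>\<omega>. b\<^sup>2 * indicator ?A \<omega> - 32 * (1 / (1 + undershoot s \<omega>)) - 4 * s powr (2 * (v - u)))"
            by (intro Bochner_Integration.integrable_diff integrable_mult_right ii inverse_undershoot_integrable s integrable_const) measurable
          fix \<omega> assume "\<omega> \<in> space M"
          then show "b\<^sup>2 * indicator ?A \<omega> - 32 * (1 / (1 + undershoot s \<omega>)) - 4 * s powr (2 * (v - u)) \<le> exit_ratio b (tail (s powr u)) (undershoot s \<omega>)"
            using exit_ratio_lower[OF b undershoot_nonneg[OF s, of \<omega>] elim(4), of v u] by (simp add: indicator_def)
        qed
        finally show ?case .
      qed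
    qed
  qed
qed

text \<open>Since the reward is almost harmonic, its means at consecutive times differ by at most the mean of
  \<open>C / (1 + z) ^ 3\<close>, whose sum over time is a multiple of the mean of \<open>1 / (1 + Z)\<close>.\<close>

lemma alternating_reward_limit:
  assumes b: "0 < b" "b \<le> 1" and c: "\<And>s. 0 \<le> c s"
  shows "((\<lambda>s. \<Sum>n. (-1) ^ n * (\<integral>z. exit_reward b (c s) z \<partial>killed_law s n)) \<longlongrightarrow> 0) at_top"
proof -
  obtain C where C: "0 \<le> C"
    "\<And>c z. 0 \<le> c \<Longrightarrow> 0 \<le> z \<Longrightarrow> \<bar>exit_reward b c z - step (exit_reward b c) z\<bar> \<le> C / (1 + z) ^ 3"
    using exit_reward_almost_harmonic[OF b] by blast
  have "((\<lambda>s. (tail s + 4 * C * mean_inverse_undershoot s) / 2) \<longlongrightarrow> (0 + 4 * C * 0) / 2) at_top"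
    by (intro tendsto_intros mean_inverse_undershoot_tendsto tail_tendsto_0) simp
  then have lim: "((\<lambda>s. (tail s + 4 * C * mean_inverse_undershoot s) / 2) \<longlongrightarrow> 0) at_top" by simp
  show ?thesis
  proof (rule Lim_null_comparison[OF _ lim], rule eventually_mono[OF eventually_ge_at_top[of 0]])
    fix s :: real assume s: "0 \<le> s"
    let ?r = "exit_reward b (c s)"
    let ?x = "\<lambda>n. \<integral>z. ?r z \<partial>killed_law s n"
    \<comment> \<open>the division by \<open>tail z\<close> turns a sum over time into an expectation over the undershoot\<close>
    let ?g = "\<lambda>z. C * (1 / (1 + z) ^ 3) / tail z"
    have tg: "tail z * ?g z = C * (1 / (1 + z) ^ 3)" for z using tail_pos[of z] by simp
    have gt: "C * (1 / (1 + z) ^ 3) \<le> 4 * C * tail z" if "0 \<le> z" for z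
    proof -
      have "1 / (1 + z) ^ 3 \<le> 1 / (1 + z)\<^sup>2" using that by (intro frac_le power_increasing) auto
      then have "C * (1 / (1 + z) ^ 3) \<le> C * (4 * tail z)" using weight_le_tail[OF that] C(1)
        by (intro mult_left_mono) linarith+
      then show ?thesis by simp
    qed
    have gi: "integrable (killed_law s n) (\<lambda>z. C * (1 / (1 + z) ^ 3))" for n
      using gt C(1)
      by (intro killed_law_integrable_bound[OF integrable_mult_right[OF tail_integrable_killed_law[OF s]], of _ "4 * C"])
         (auto simp: abs_mult)
    have gs: "summable (\<lambda>n. \<integral>z. C * (1 / (1 + z) ^ 3) \<partial>killed_law s n)"
    proof (rule summable_comparison_test'[OF summable_mult[OF sums_summable[OF exit_moment_0_sums[OF s]], of "4 * C"], of 0])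
      fix n
      have "(\<integral>z. C * (1 / (1 + z) ^ 3) \<partial>killed_law s n) \<le> (\<integral>z. 4 * C * tail z \<partial>killed_law s n)"
        by (intro killed_law_integral_mono gi integrable_mult_right tail_integrable_killed_law s gt)
      also have "\<dots> = 4 * C * (\<integral>z. tail z \<partial>killed_law s n)" by simp
      finally show "norm (\<integral>z. C * (1 / (1 + z) ^ 3) \<partial>killed_law s n) \<le> 4 * C * (\<integral>z. tail z \<partial>killed_law s n)"
        using killed_law_integral_nonneg[of "\<lambda>z. C * (1 / (1 + z) ^ 3)" s n] C(1) by simp
    qed
    note u = undershoot_expectation[OF s, of ?g]
    have gE: "integrable M (\<lambda>\<omega>. ?g (undershoot s \<omega>))"
      "expectation (\<lambda>\<omega>. ?g (undershoot s \<omega>)) = (\<Sum>n. \<integral>z. C * (1 / (1 + z) ^ 3) \<partial>killed_law s n)"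
      using u(1) u(2) gi gs C(1) unfolding tg by (simp_all add: less_imp_le[OF tail_pos])
    have gsum: "(\<Sum>n. \<integral>z. C * (1 / (1 + z) ^ 3) \<partial>killed_law s n) \<le> 4 * C * mean_inverse_undershoot s"
    proof -
      have "expectation (\<lambda>\<omega>. ?g (undershoot s \<omega>)) \<le> expectation (\<lambda>\<omega>. 4 * C * (1 / (1 + undershoot s \<omega>)))"
      proof (rule integral_mono[OF gE(1)])
        show "integrable M (\<lambda>\<omega>. 4 * C * (1 / (1 + undershoot s \<omega>)))"
          by (rule integrable_mult_right) (rule inverse_undershoot_integrable[OF s])
        fix \<omega>
        define z where "z = undershoot s \<omega>"
        have z: "0 \<le> z" unfolding z_def by (rule undershoot_nonneg[OF s])
        have "C * (1 / (1 + z) ^ 3) = C * (1 / (1 + z)) * (1 / (1 + z)\<^sup>2)" by (simp add: power3_eq_cube power2_eq_square)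
        also have "\<dots> \<le> C * (1 / (1 + z)) * (4 * tail z)"
          using z C(1) by (intro mult_left_mono weight_le_tail) auto
        also have "\<dots> = 4 * C * (1 / (1 + z)) * tail z" by simp
        finally show "C * (1 / (1 + z) ^ 3) / tail z \<le> 4 * C * (1 / (1 + z))"
          by (simp only: pos_divide_le_eq[OF tail_pos])
      qed
      also have "\<dots> = 4 * C * mean_inverse_undershoot s" unfolding mean_inverse_undershoot_def by (rule integral_mult_right_zero)
      finally show ?thesis unfolding gE(2) .
    qed
    have ri: "integrable (killed_law s n) ?r" for n by (rule killed_law_reward_integrable[OF s b c])
    have jr: "integrable jump_law (\<lambda>x. indicator {..z} x * ?r (z - x))" for z
    proof (rule jump_law.integrable_const_bound[of _ 1])
      have "norm (indicator {..z} x * ?r (z - x)) \<le> 1" for x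
      proof (cases "x \<le> z")
        case True
        then have "?r (z - x) \<le> tail (z - x)" by (intro exit_reward_le_tail b c) auto
        then show ?thesis using tail_le_1[of "z - x"] True by (simp add: exit_reward_nonneg)
      qed simp
      then show "AE x in jump_law. norm (indicator {..z} x * ?r (z - x)) \<le> 1" by simp
    qed measurable
    have si: "integrable (killed_law s n) (step ?r)" for n
    proof (rule killed_law_integrable_bound[OF Bochner_Integration.integrable_add[OF ri gi]])
      fix z :: real assume z: "0 \<le> z"
      then show "\<bar>step ?r z\<bar> \<le> ?r z + C * (1 / (1 + z) ^ 3)"
        using C(2)[OF c z, of s] exit_reward_nonneg[of b "c s" z] by simp
    qed simp
    have xs: "?x (Suc n) = (\<integral>z. step ?r z \<partial>killed_law s n)" for n
      by (rule killed_law_Suc_integral(2)[OF _ _ jr si]) (auto simp: exit_reward_nonneg)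
    have "\<bar>\<Sum>n. (-1) ^ n * ?x n\<bar> \<le> (?x 0 + (\<Sum>n. \<integral>z. C * (1 / (1 + z) ^ 3) \<partial>killed_law s n)) / 2"
    proof (rule alternating_sum_bound[OF killed_law_reward_summable[OF s b c] _ gs])
      show "0 \<le> ?x n" for n by (intro killed_law_integral_nonneg exit_reward_nonneg)
      fix n
      have "\<bar>?x n - ?x (Suc n)\<bar> = \<bar>\<integral>z. ?r z - step ?r z \<partial>killed_law s n\<bar>"
        unfolding xs by (subst Bochner_Integration.integral_diff[OF ri si]) simp
      also have "\<dots> \<le> (\<integral>z. \<bar>?r z - step ?r z\<bar> \<partial>killed_law s n)" by (rule integral_abs_bound)
      also have "\<dots> \<le> (\<integral>z. C * (1 / (1 + z) ^ 3) \<partial>killed_law s n)"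
        using C(2)[OF c] by (intro killed_law_integral_mono gi integrable_abs Bochner_Integration.integrable_diff ri si) simp
      finally show "\<bar>?x n - ?x (Suc n)\<bar> \<le> (\<integral>z. C * (1 / (1 + z) ^ 3) \<partial>killed_law s n)" .
    qed
    moreover have "?x 0 \<le> tail s"
      unfolding killed_law_0[OF s] by (simp add: integral_return exit_reward_le_tail[OF b c s])
    ultimately show "norm (\<Sum>n. (-1) ^ n * ?x n) \<le> (tail s + 4 * C * mean_inverse_undershoot s) / 2"
      using gsum by (simp add: field_simps)
  qed
qed

section \<open>Limits of exit events\<close>

text \<open>The condition may depend on the number \<open>n\<close> of jumps before the passage, on the undershoot and on the
  jump that passes the level.\<close>

definition exit_event :: "(nat \<Rightarrow> real \<Rightarrow> real \<Rightarrow> bool) \<Rightarrow> real \<Rightarrow> 'a set" where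
  "exit_event \<phi> s = (\<Union>n. {\<omega>\<in>first_passage s n. \<phi> n (s - S n \<omega>) (X (Suc n) \<omega>)})"

lemma first_passage_part_measurable:
  assumes \<phi> [measurable]: "jump_pred \<phi>"
  shows "{\<omega>\<in>first_passage s n. \<phi> (s - S n \<omega>) (X (Suc n) \<omega>)} \<in> sets M"
proof -
  have [measurable]: "(\<lambda>\<omega>. \<phi> (s - S n \<omega>) (X (Suc n) \<omega>)) \<in> measurable M (count_space UNIV)"
    using measurable_compose[OF _ \<phi>, of "\<lambda>\<omega>. (s - S n \<omega>, X (Suc n) \<omega>)" M] by simp
  have "{\<omega>\<in>first_passage s n. \<phi> (s - S n \<omega>) (X (Suc n) \<omega>)} = first_passage s n \<inter> {\<omega>\<in>space M. \<phi> (s - S n \<omega>) (X (Suc n) \<omega>)}"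
    using sets.sets_into_space[OF first_passage_measurable] by auto
  then show ?thesis by simp
qed

lemma exit_event_measurable:
  assumes "\<And>n. jump_pred (\<phi> n)"
  shows "exit_event \<phi> s \<in> sets M"
  unfolding exit_event_def using first_passage_part_measurable[OF assms] by (intro sets.countable_UN) blast

text \<open>The sum over the times of one parity is the mean of the full sum and of plus or minus the alternating
  sum.\<close>

lemma exit_event_prob:
  assumes s: "0 \<le> s" and \<phi>: "\<And>n. jump_pred (\<phi> n)"
    and b: "0 < b" "b \<le> 1" and c: "0 \<le> c"
    and r: "\<And>n z. 0 \<le> z \<Longrightarrow> even n = q \<Longrightarrow> measure jump_law {x. z < x \<and> \<phi> n z x} = exit_reward b c z"
    and r0: "\<And>n z x. even n \<noteq> q \<Longrightarrow> \<not> \<phi> n z x"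
  shows "prob (exit_event \<phi> s) = ((\<Sum>n. \<integral>z. exit_reward b c z \<partial>killed_law s n)
     + (if q then 1 else - 1) * (\<Sum>n. (-1) ^ n * (\<integral>z. exit_reward b c z \<partial>killed_law s n))) / 2"
proof -
  let ?x = "\<lambda>n. \<integral>z. exit_reward b c z \<partial>killed_law s n"
  let ?A = "\<lambda>n. {\<omega>\<in>first_passage s n. \<phi> n (s - S n \<omega>) (X (Suc n) \<omega>)}"
  have xn: "0 \<le> ?x n" for n by (intro killed_law_integral_nonneg exit_reward_nonneg)
  have e: "emeasure M (?A n) = ennreal (if even n = q then ?x n else 0)" for n
  proof (cases "even n = q")
    case True
    have "emeasure M (?A n) = (\<integral>\<^sup>+z. emeasure jump_law {x. z < x \<and> \<phi> n z x} \<partial>killed_law s n)"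
      by (rule emeasure_first_passage[OF \<phi>])
    also have "\<dots> = (\<integral>\<^sup>+z. ennreal (exit_reward b c z) \<partial>killed_law s n)"
      by (rule nn_integral_cong_AE, use AE_killed_law_nonneg in eventually_elim)
         (simp add: jump_law.emeasure_eq_measure r[OF _ True])
    also have "\<dots> = ennreal (?x n)"
      by (rule nn_integral_eq_integral[OF killed_law_reward_integrable[OF s b c]]) (simp add: exit_reward_nonneg)
    finally show ?thesis using True by simp
  next
    case False
    then have empty: "?A n = {}" using r0 by auto
    show ?thesis unfolding empty using False by simp
  qed
  have p: "prob (?A n) = (if even n = q then ?x n else 0)" for n
    unfolding measure_def e using xn[of n] by simp
  have d: "disjoint_family ?A"
    using disjoint_first_passage[of s] unfolding disjoint_family_on_def by blast
  have "(\<lambda>n. prob (?A n)) sums prob (\<Union>n. ?A n)"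
    by (rule finite_measure_UNION[OF _ d]) (use first_passage_part_measurable[OF \<phi>] in auto)
  then have "prob (exit_event \<phi> s) = (\<Sum>n. if even n = q then ?x n else 0)"
    unfolding p exit_event_def by (simp add: sums_iff)
  also have "\<dots> = (\<Sum>n. (?x n + (if q then 1 else - 1) * ((-1) ^ n * ?x n)) / 2)"
    by (rule suminf_cong) (auto simp: minus_one_power_iff)
  also have "\<dots> = ((\<Sum>n. ?x n) + (if q then 1 else - 1) * (\<Sum>n. (-1) ^ n * ?x n)) / 2"
  proof -
    have s1: "summable ?x" by (rule killed_law_reward_summable[OF s b c])
    have s2: "summable (\<lambda>n. (-1) ^ n * ?x n)"
      by (rule summable_comparison_test'[OF s1, of 0]) (simp add: abs_mult xn)
    have "(\<lambda>n. (?x n + (if q then 1 else - 1) * ((-1) ^ n * ?x n)) / 2) sums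
       (((\<Sum>n. ?x n) + (if q then 1 else - 1) * (\<Sum>n. (-1) ^ n * ?x n)) / 2)"
      by (intro sums_divide sums_add sums_mult summable_sums s1 s2)
    then show ?thesis by (rule sums_unique[symmetric])
  qed
  finally show ?thesis .
qed

text \<open>Both parities receive half of the total reward in the limit.\<close>

lemma exit_ratio_event_limit:
  assumes \<phi>: "\<And>s n. jump_pred (\<phi> s n)"
    and b: "0 < b" "b \<le> 1" and u: "0 \<le> u" "u \<le> 1"
    and r: "\<And>s n z. 0 \<le> z \<Longrightarrow> even n = q \<Longrightarrow> measure jump_law {x. z < x \<and> \<phi> s n z x} = exit_reward b (tail (s powr u)) z"
    and r0: "\<And>s n z x. even n \<noteq> q \<Longrightarrow> \<not> \<phi> s n z x"
  shows "((\<lambda>s. prob (exit_event (\<phi> s) s)) \<longlongrightarrow> b\<^sup>2 * sqrt u / 2) at_top"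
proof -
  have c: "0 \<le> tail (s powr u)" for s by (rule less_imp_le[OF tail_pos])
  have "((\<lambda>s. ((\<Sum>n. \<integral>z. exit_reward b (tail (s powr u)) z \<partial>killed_law s n)
     + (if q then 1 else - 1) * (\<Sum>n. (-1) ^ n * (\<integral>z. exit_reward b (tail (s powr u)) z \<partial>killed_law s n))) / 2)
     \<longlongrightarrow> (b\<^sup>2 * sqrt u + (if q then 1 else - 1) * 0) / 2) at_top"
    by (intro tendsto_divide tendsto_add tendsto_mult tendsto_const total_reward_limit alternating_reward_limit b u c) auto
  moreover have "\<forall>\<^sub>F s in at_top. ((\<Sum>n. \<integral>z. exit_reward b (tail (s powr u)) z \<partial>killed_law s n)
     + (if q then 1 else - 1) * (\<Sum>n. (-1) ^ n * (\<integral>z. exit_reward b (tail (s powr u)) z \<partial>killed_law s n))) / 2 = prob (exit_event (\<phi> s) s)"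
    by (rule eventually_mono[OF eventually_ge_at_top[of 0]])
       (rule exit_event_prob[OF _ \<phi> b c r r0, symmetric], auto)
  ultimately show ?thesis by (auto intro: Lim_transform_eventually)
qed

lemma exit_event_iff:
  "\<omega> \<in> exit_event \<phi> s \<longleftrightarrow> (\<exists>n. \<omega> \<in> first_passage s n \<and> \<phi> n (s - S n \<omega>) (X (Suc n) \<omega>))"
  by (auto simp: exit_event_def)

lemma first_passage_unique: "\<omega> \<in> first_passage s m \<Longrightarrow> \<omega> \<in> first_passage s n \<Longrightarrow> m = n"
  using first_passage_least by metis

lemma first_passage_positions:
  "\<omega> \<in> first_passage s n \<Longrightarrow> 0 \<le> s - S n \<omega> \<and> s - S n \<omega> < X (Suc n) \<omega>"
  by (auto simp: first_passage_iff alive_def algebra_simps)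

lemma exit_event_mono:
  assumes "\<And>n z x. 0 \<le> z \<Longrightarrow> z < x \<Longrightarrow> \<phi> n z x \<Longrightarrow> \<psi> n z x"
  shows "exit_event \<phi> s \<subseteq> exit_event \<psi> s"
proof
  fix \<omega> assume "\<omega> \<in> exit_event \<phi> s"
  then obtain n where n: "\<omega> \<in> first_passage s n" "\<phi> n (s - S n \<omega>) (X (Suc n) \<omega>)"
    unfolding exit_event_iff by blast
  then have "\<psi> n (s - S n \<omega>) (X (Suc n) \<omega>)"
    using first_passage_positions[OF n(1)] by (intro assms) auto
  then show "\<omega> \<in> exit_event \<psi> s" using n(1) unfolding exit_event_iff by blast
qed

lemma exit_event_cong:
  assumes "\<And>n z x. 0 \<le> z \<Longrightarrow> z < x \<Longrightarrow> \<phi> n z x \<longleftrightarrow> \<psi> n z x"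
  shows "exit_event \<phi> s = exit_event \<psi> s"
  using assms by (intro equalityI exit_event_mono) auto

lemma exit_event_prob_diff:
  assumes "\<And>n. jump_pred (\<phi> n)"
    and "\<And>n. jump_pred (\<psi> n)"
    and "\<And>n z x. 0 \<le> z \<Longrightarrow> z < x \<Longrightarrow> \<psi> n z x \<Longrightarrow> \<phi> n z x"
    and "\<And>n z x. 0 \<le> z \<Longrightarrow> z < x \<Longrightarrow> \<rho> n z x \<longleftrightarrow> \<phi> n z x \<and> \<not> \<psi> n z x"
  shows "prob (exit_event \<rho> s) = prob (exit_event \<phi> s) - prob (exit_event \<psi> s)"
proof -
  have "exit_event \<rho> s = exit_event (\<lambda>n z x. \<phi> n z x \<and> \<not> \<psi> n z x) s"
    by (rule exit_event_cong) (rule assms(4))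
  also have "\<dots> = exit_event \<phi> s - exit_event \<psi> s"
  proof (intro set_eqI iffI)
    fix \<omega> assume "\<omega> \<in> exit_event (\<lambda>n z x. \<phi> n z x \<and> \<not> \<psi> n z x) s"
    then obtain n where n: "\<omega> \<in> first_passage s n"
      "\<phi> n (s - S n \<omega>) (X (Suc n) \<omega>)" "\<not> \<psi> n (s - S n \<omega>) (X (Suc n) \<omega>)"
      unfolding exit_event_iff by blast
    have "\<omega> \<notin> exit_event \<psi> s"
      using n(3) first_passage_unique[OF n(1)] unfolding exit_event_iff by blast
    then show "\<omega> \<in> exit_event \<phi> s - exit_event \<psi> s" using n unfolding exit_event_iff Diff_iff by blast
  qed (unfold exit_event_iff Diff_iff, blast)
  finally show ?thesis
    by (simp add: finite_measure_Diff exit_event_measurable assms exit_event_mono)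
qed

lemma exit_event_prob_union:
  assumes "\<And>n. jump_pred (\<phi> n)"
    and "\<And>n. jump_pred (\<psi> n)"
    and "\<And>n z x. \<not> (\<phi> n z x \<and> \<psi> n z x)"
    and "\<And>n z x. 0 \<le> z \<Longrightarrow> z < x \<Longrightarrow> \<rho> n z x \<longleftrightarrow> \<phi> n z x \<or> \<psi> n z x"
  shows "prob (exit_event \<rho> s) = prob (exit_event \<phi> s) + prob (exit_event \<psi> s)"
proof -
  have "exit_event \<rho> s = exit_event (\<lambda>n z x. \<phi> n z x \<or> \<psi> n z x) s"
    by (rule exit_event_cong) (rule assms(4))
  also have "\<dots> = exit_event \<phi> s \<union> exit_event \<psi> s"
    by (auto simp: exit_event_iff)
  finally have e: "exit_event \<rho> s = exit_event \<phi> s \<union> exit_event \<psi> s" .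
  show ?thesis unfolding e
  proof (rule finite_measure_Union)
    show "exit_event \<phi> s \<inter> exit_event \<psi> s = {}"
      using first_passage_unique assms(3) by (auto simp: exit_event_iff) metis
  qed (intro exit_event_measurable assms)+
qed

lemma measure_jump_law_Ioc: "measure jump_law {p<..w} = max 0 (tail p - tail w)"
proof (cases "p \<le> w")
  case True
  have "{p<..w} = {p<..} - {w<..}" by auto
  then have "measure jump_law {p<..w} = tail p - tail w"
    using True by (simp add: jump_law.finite_measure_Diff)
  then show ?thesis using tail_antimono[OF True] by simp
next
  case False
  then show ?thesis using tail_antimono[of w p] by simp
qed

lemma measure_ratio_less:
  assumes z: "0 \<le> z" and b: "0 < b" "b \<le> 1"
  shows "measure jump_law {x. z < x \<and> z < b * x \<and> x \<le> w} = exit_reward b (tail w) z"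
proof -
  have "z \<le> z / b" using b z by (simp add: pos_le_divide_eq mult_left_le)
  moreover have "z < b * x \<longleftrightarrow> z / b < x" for x
    using b by (simp add: pos_divide_less_eq mult.commute)
  ultimately have "z < x \<and> z < b * x \<and> x \<le> w \<longleftrightarrow> z / b < x \<and> x \<le> w" for x
    by (metis order.strict_trans1)
  then have "{x. z < x \<and> z < b * x \<and> x \<le> w} = {z / b<..w}"
    by (intro set_eqI) (simp only: mem_Collect_eq greaterThanAtMost_iff)
  then show ?thesis by (simp add: measure_jump_law_Ioc exit_reward_def)
qed

lemma measure_ratio_le:
  assumes z: "0 \<le> z" and b: "0 < b" "b \<le> 1"
  shows "measure jump_law {x. z < x \<and> z \<le> b * x \<and> x \<le> w} = exit_reward b (tail w) z"
proof -
  have "measure jump_law {x. z < x \<and> z \<le> b * x \<and> x \<le> w} = measure jump_law {x. z < x \<and> z < b * x \<and> x \<le> w}"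
  proof (rule measure_eq_AE)
    have "AE x in jump_law. x \<noteq> z / b"
      by (rule AE_I[of _ _ "{z / b}"]) auto
    then show "AE x in jump_law. x \<in> {x. z < x \<and> z \<le> b * x \<and> x \<le> w} \<longleftrightarrow> x \<in> {x. z < x \<and> z < b * x \<and> x \<le> w}"
      by eventually_elim (use b in \<open>auto simp: field_simps\<close>)
  qed measurable
  then show ?thesis using measure_ratio_less[OF assms] by simp
qed

abbreviation ratio_le :: "bool \<Rightarrow> real \<Rightarrow> real \<Rightarrow> nat \<Rightarrow> real \<Rightarrow> real \<Rightarrow> bool" where
  "ratio_le q b w \<equiv> \<lambda>n z x. even n = q \<and> z \<le> b * x \<and> x \<le> w"

abbreviation ratio_less :: "bool \<Rightarrow> real \<Rightarrow> real \<Rightarrow> nat \<Rightarrow> real \<Rightarrow> real \<Rightarrow> bool" where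
  "ratio_less q b w \<equiv> \<lambda>n z x. even n = q \<and> z < b * x \<and> x \<le> w"

text \<open>The exit height of an upward ray is \<open>z / x\<close> and that of a downward ray is \<open>1 - z / x\<close>, so a half-open
  interval of heights is closed at opposite ends for the two ratios.\<close>

abbreviation up_cell :: "bool \<Rightarrow> real \<Rightarrow> real \<Rightarrow> real \<Rightarrow> nat \<Rightarrow> real \<Rightarrow> real \<Rightarrow> bool" where
  "up_cell q a b w \<equiv> \<lambda>n z x. (even n = q \<and> a * x < z \<and> z \<le> b * x) \<and> x \<le> w"

abbreviation down_cell :: "bool \<Rightarrow> real \<Rightarrow> real \<Rightarrow> real \<Rightarrow> nat \<Rightarrow> real \<Rightarrow> real \<Rightarrow> bool" where
  "down_cell q a b w \<equiv> \<lambda>n z x. (even n = q \<and> a * x \<le> z \<and> z < b * x) \<and> x \<le> w"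

lemma ratio_le_limit:
  assumes b: "0 < b" "b \<le> 1" and u: "0 \<le> u" "u \<le> 1"
  shows "((\<lambda>s. prob (exit_event (ratio_le q b (s powr u)) s)) \<longlongrightarrow> b\<^sup>2 * sqrt u / 2) at_top"
proof (rule exit_ratio_event_limit[OF _ b u])
  fix s z :: real and n :: nat assume z: "0 \<le> z" and q: "even n = q"
  show "measure jump_law {x. z < x \<and> even n = q \<and> z \<le> b * x \<and> x \<le> s powr u} = exit_reward b (tail (s powr u)) z"
    using measure_ratio_le[OF z b] by (simp add: q)
qed (simp_all add: case_prod_beta')

text \<open>Here \<open>b = 0\<close> is admitted, as it occurs for downward rays that leave at the height \<open>y = 1\<close>.\<close>

lemma ratio_less_limit:
  assumes b: "0 \<le> b" "b \<le> 1" and u: "0 \<le> u" "u \<le> 1"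
  shows "((\<lambda>s. prob (exit_event (ratio_less q b (s powr u)) s)) \<longlongrightarrow> b\<^sup>2 * sqrt u / 2) at_top"
proof (cases "b = 0")
  case True
  have "exit_event (ratio_less q b (s powr u)) s = {}" for s
    using True first_passage_positions by (force simp: exit_event_iff)
  then show ?thesis using True by simp
next
  case False
  then have "0 < b" using b by simp
  note b' = this b(2)
  show ?thesis
  proof (rule exit_ratio_event_limit[OF _ b' u])
    fix s z :: real and n :: nat assume z: "0 \<le> z" and q: "even n = q"
    show "measure jump_law {x. z < x \<and> even n = q \<and> z < b * x \<and> x \<le> s powr u} = exit_reward b (tail (s powr u)) z"
      using measure_ratio_less[OF z b'] by (simp add: q)
  qed (simp_all add: case_prod_beta')
qed

lemma up_cell_limit:
  assumes a: "0 < a" "a \<le> b" "b \<le> 1" and u: "0 \<le> u" "u \<le> 1"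
  shows "((\<lambda>s. prob (exit_event (up_cell q a b (s powr u)) s))
    \<longlongrightarrow> (b\<^sup>2 - a\<^sup>2) * sqrt u / 2) at_top"
proof -
  have "prob (exit_event (up_cell q a b (s powr u)) s)
    = prob (exit_event (ratio_le q b (s powr u)) s)
    - prob (exit_event (ratio_le q a (s powr u)) s)" for s
  proof (rule exit_event_prob_diff)
    fix n :: nat and z x :: real assume "0 \<le> z" "z < x" "even n = q \<and> z \<le> a * x \<and> x \<le> s powr u"
    moreover from this have "a * x \<le> b * x" using a by (intro mult_right_mono) auto
    ultimately show "even n = q \<and> z \<le> b * x \<and> x \<le> s powr u" by linarith
  qed (auto simp: case_prod_beta')
  moreover have "((\<lambda>s. prob (exit_event (ratio_le q b (s powr u)) s)
    - prob (exit_event (ratio_le q a (s powr u)) s)) \<longlongrightarrow> b\<^sup>2 * sqrt u / 2 - a\<^sup>2 * sqrt u / 2) at_top"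
    using a u by (intro tendsto_diff ratio_le_limit) auto
  ultimately show ?thesis by (simp add: left_diff_distrib diff_divide_distrib)
qed

lemma down_cell_limit:
  assumes a: "0 \<le> a" "a \<le> b" "b \<le> 1" and u: "0 \<le> u" "u \<le> 1"
  shows "((\<lambda>s. prob (exit_event (down_cell q a b (s powr u)) s))
    \<longlongrightarrow> (b\<^sup>2 - a\<^sup>2) * sqrt u / 2) at_top"
proof -
  have "prob (exit_event (down_cell q a b (s powr u)) s)
    = prob (exit_event (ratio_less q b (s powr u)) s)
    - prob (exit_event (ratio_less q a (s powr u)) s)" for s
  proof (rule exit_event_prob_diff)
    fix n :: nat and z x :: real assume "0 \<le> z" "z < x" "even n = q \<and> z < a * x \<and> x \<le> s powr u"
    moreover from this have "a * x \<le> b * x" using a by (intro mult_right_mono) auto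
    ultimately show "even n = q \<and> z < b * x \<and> x \<le> s powr u" by linarith
  qed (auto simp: case_prod_beta')
  moreover have "((\<lambda>s. prob (exit_event (ratio_less q b (s powr u)) s)
    - prob (exit_event (ratio_less q a (s powr u)) s)) \<longlongrightarrow> b\<^sup>2 * sqrt u / 2 - a\<^sup>2 * sqrt u / 2) at_top"
    using a u by (intro tendsto_diff ratio_less_limit) auto
  ultimately show ?thesis by (simp add: left_diff_distrib diff_divide_distrib)
qed

text \<open>The probabilities of leaving with a jump of at most \<open>s\<close> add up to \<open>1\<close> in the limit over the two parities.\<close>

lemma long_jump_vanishes:
  "((\<lambda>s. prob (exit_event (\<lambda>n z x. \<not> x \<le> s powr 1) s)) \<longlongrightarrow> 0) at_top"
proof -
  let ?E = "\<lambda>q s. exit_event (ratio_less q 1 (s powr 1)) s"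
  have "((\<lambda>s. 1 - (prob (?E True s) + prob (?E False s))) \<longlongrightarrow> 1 - (1\<^sup>2 * sqrt 1 / 2 + 1\<^sup>2 * sqrt 1 / 2)) at_top"
    by (intro tendsto_diff tendsto_add tendsto_const ratio_less_limit) auto
  then have lim: "((\<lambda>s. 1 - (prob (?E True s) + prob (?E False s))) \<longlongrightarrow> 0) at_top" by simp
  show ?thesis
  proof (rule Lim_null_comparison[OF always_eventually lim], rule allI)
    fix s :: real
    have 1: "prob (exit_event (\<lambda>n z x. x \<le> s powr 1) s) = prob (?E True s) + prob (?E False s)"
      by (rule exit_event_prob_union) (auto simp: case_prod_beta')
    have "prob (exit_event (\<lambda>n z x. True) s) = prob (exit_event (\<lambda>n z x. x \<le> s powr 1) s) + prob (exit_event (\<lambda>n z x. \<not> x \<le> s powr 1) s)"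
      by (rule exit_event_prob_union) (auto simp: case_prod_beta')
    then show "norm (prob (exit_event (\<lambda>n z x. \<not> x \<le> s powr 1) s)) \<le> 1 - (prob (?E True s) + prob (?E False s))"
      using 1 prob_le_1[of "exit_event (\<lambda>n z x. True) s"] by simp
  qed
qed

text \<open>Leaving with a jump larger than \<open>s\<close> is negligible, so that the condition on the height alone is
  covered by the case \<open>u = 1\<close>.\<close>

lemma untruncated_limit:
  assumes \<phi>: "\<And>n. jump_pred (\<phi> n)"
    and lim: "((\<lambda>s. prob (exit_event (\<lambda>n z x. \<phi> n z x \<and> x \<le> s powr 1) s)) \<longlongrightarrow> l) at_top"
  shows "((\<lambda>s. prob (exit_event \<phi> s)) \<longlongrightarrow> l) at_top"
proof -
  have \<phi>' [measurable]: "Measurable.pred (borel \<Otimes>\<^sub>M borel) (\<lambda>p. \<phi> n (fst p) (snd p))" for n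
    using \<phi>[of n] by (simp add: case_prod_beta')
  have eq: "prob (exit_event \<phi> s) = prob (exit_event (\<lambda>n z x. \<phi> n z x \<and> x \<le> s powr 1) s) + prob (exit_event (\<lambda>n z x. \<phi> n z x \<and> \<not> x \<le> s powr 1) s)" for s
    by (rule exit_event_prob_union) (auto simp: case_prod_beta')
  have "((\<lambda>s. prob (exit_event (\<lambda>n z x. \<phi> n z x \<and> \<not> x \<le> s powr 1) s)) \<longlongrightarrow> 0) at_top"
  proof (rule Lim_null_comparison[OF always_eventually long_jump_vanishes], rule allI)
    fix s :: real
    have "prob (exit_event (\<lambda>n z x. \<phi> n z x \<and> \<not> x \<le> s powr 1) s) \<le> prob (exit_event (\<lambda>n z x. \<not> x \<le> s powr 1) s)"
      by (intro finite_measure_mono exit_event_mono exit_event_measurable) (auto simp: case_prod_beta')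
    then show "norm (prob (exit_event (\<lambda>n z x. \<phi> n z x \<and> \<not> x \<le> s powr 1) s)) \<le> prob (exit_event (\<lambda>n z x. \<not> x \<le> s powr 1) s)" by simp
  qed
  from tendsto_add[OF lim this] show ?thesis unfolding eq by simp
qed

section \<open>The ray as a function of the walk\<close>

text \<open>Events about the ray agree with exit events outside the null set of walks that never pass the level;
  on that set it suffices that the event is measurable.\<close>

lemma prob_eq_exit_event:
  assumes s: "0 \<le> s" and \<phi>: "\<And>n. jump_pred (\<phi> n)"
    and on: "\<And>\<omega> n. \<omega> \<in> first_passage s n \<Longrightarrow> P \<omega> \<longleftrightarrow> \<phi> n (s - S n \<omega>) (X (Suc n) \<omega>)"
    and off: "\<And>\<omega>. \<omega> \<in> space M \<Longrightarrow> (\<And>n. S n \<omega> \<le> s) \<Longrightarrow> P \<omega> \<longleftrightarrow> R \<omega>"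
    and R: "{\<omega>\<in>space M. R \<omega>} \<in> sets M"
  shows "prob {\<omega>\<in>space M. P \<omega>} = prob (exit_event \<phi> s)"
proof -
  let ?U = "\<Union>n. first_passage s n"
  have U: "?U \<in> sets M" by (intro sets.countable_UN) auto
  have never: "S n \<omega> \<le> s" if \<omega>: "\<omega> \<in> space M" "\<omega> \<notin> ?U" for \<omega> n
  proof -
    have "\<omega> \<in> alive s n"
    proof (induction n)
      case 0 show ?case using s \<omega> by (simp add: alive_def)
    next
      case (Suc n)
      have "\<omega> \<notin> first_passage s n" using \<omega> by blast
      then show ?case using Suc by (simp add: first_passage_def)
    qed
    then show ?thesis by (simp add: alive_def)
  qed
  have onU: "P \<omega> \<longleftrightarrow> \<omega> \<in> exit_event \<phi> s" if \<omega>: "\<omega> \<in> ?U" for \<omega>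
  proof -
    obtain n where n: "\<omega> \<in> first_passage s n" using \<omega> by blast
    show ?thesis unfolding on[OF n] exit_event_iff using first_passage_unique[OF n] n by blast
  qed
  have E_sub: "exit_event \<phi> s \<subseteq> ?U" unfolding exit_event_def by blast
  have U_sub: "?U \<subseteq> space M" using sets.sets_into_space[OF U] .
  have eq: "{\<omega>\<in>space M. P \<omega>} = exit_event \<phi> s \<union> ({\<omega>\<in>space M. R \<omega>} - ?U)"
  proof (intro set_eqI iffI)
    fix \<omega> assume \<omega>: "\<omega> \<in> {\<omega>\<in>space M. P \<omega>}"
    show "\<omega> \<in> exit_event \<phi> s \<union> ({\<omega>\<in>space M. R \<omega>} - ?U)"
      using \<omega> onU[of \<omega>] off[OF _ never, of \<omega>] by (cases "\<omega> \<in> ?U") auto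
  next
    fix \<omega> assume \<omega>: "\<omega> \<in> exit_event \<phi> s \<union> ({\<omega>\<in>space M. R \<omega>} - ?U)"
    then consider "\<omega> \<in> exit_event \<phi> s" | "R \<omega>" "\<omega> \<in> space M" "\<omega> \<notin> ?U" by blast
    then show "\<omega> \<in> {\<omega>\<in>space M. P \<omega>}"
    proof cases
      case 1
      then have "\<omega> \<in> ?U" using E_sub by blast
      then show ?thesis using 1 onU U_sub by blast
    next
      case 2
      then show ?thesis using off[OF 2(2) never[OF 2(2,3)]] by simp
    qed
  qed
  show ?thesis
  proof (rule finite_measure_eq_AE)
    show "AE \<omega> in M. \<omega> \<in> {\<omega>\<in>space M. P \<omega>} \<longleftrightarrow> \<omega> \<in> exit_event \<phi> s"
      using AE_first_passage[OF s]
    proof eventually_elim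
      case (elim \<omega>)
      then have "\<omega> \<in> ?U" by blast
      then show ?case using onU U_sub by blast
    qed
    show "{\<omega>\<in>space M. P \<omega>} \<in> sets M" unfolding eq using U R exit_event_measurable[OF \<phi>] by (intro sets.Un sets.Diff)
  qed (rule exit_event_measurable[OF \<phi>])
qed

text \<open>The exit height lies in \<open>(y - e, y]\<close>, expressed by the undershoot \<open>z\<close> and the jump \<open>x\<close> after \<open>n\<close> jumps:
  for even \<open>n\<close> the ray travels upward and the height is \<open>z / x\<close>, otherwise it is \<open>1 - z / x\<close>.\<close>

definition height_pred :: "real \<Rightarrow> real \<Rightarrow> nat \<Rightarrow> real \<Rightarrow> real \<Rightarrow> bool" where
  "height_pred y e n z x \<longleftrightarrow> (if even n then (y - e) * x < z \<and> z \<le> y * x else (1 - y) * x \<le> z \<and> z < (1 - y + e) * x)"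

lemma height_pred_iff:
  assumes "0 < x"
  shows "(if even n then z / x else 1 - z / x) \<in> {y - e<..y} \<longleftrightarrow> height_pred y e n z x"
  using assms by (auto simp: height_pred_def field_simps)

lemma height_pred_measurable: "jump_pred (height_pred y e n)"
  unfolding case_prod_beta' height_pred_def by measurable

lemma height_limit:
  assumes y: "0 \<le> y" "y \<le> 1" and e: "0 < e" "e < y"
  shows "((\<lambda>s. prob (exit_event (height_pred y e) s)) \<longlongrightarrow> e) at_top"
proof (rule untruncated_limit[OF height_pred_measurable])
  have "prob (exit_event (\<lambda>n z x. height_pred y e n z x \<and> x \<le> s powr 1) s)
    = prob (exit_event (up_cell True (y - e) y (s powr 1)) s)
    + prob (exit_event (down_cell False (1 - y) (1 - y + e) (s powr 1)) s)" for s
    by (rule exit_event_prob_union) (auto simp: case_prod_beta' height_pred_def)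
  moreover have "((\<lambda>s. prob (exit_event (up_cell True (y - e) y (s powr 1)) s)
    + prob (exit_event (down_cell False (1 - y) (1 - y + e) (s powr 1)) s))
    \<longlongrightarrow> (y\<^sup>2 - (y - e)\<^sup>2) * sqrt 1 / 2 + ((1 - y + e)\<^sup>2 - (1 - y)\<^sup>2) * sqrt 1 / 2) at_top"
    using assms by (intro tendsto_add up_cell_limit down_cell_limit) auto
  moreover have "(y\<^sup>2 - (y - e)\<^sup>2) * sqrt 1 / 2 + ((1 - y + e)\<^sup>2 - (1 - y)\<^sup>2) * sqrt 1 / 2 = e"
    by (simp add: power2_eq_square field_simps)
  ultimately show "((\<lambda>s. prob (exit_event (\<lambda>n z x. height_pred y e n z x \<and> x \<le> s powr 1) s)) \<longlongrightarrow> e) at_top"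
    by simp
qed

lemma upward_limit:
  assumes y: "0 \<le> y" "y \<le> 1" and e: "0 < e" "e < y" and t: "0 \<le> t" "t \<le> 1"
  shows "((\<lambda>s. prob (exit_event (\<lambda>n z x. (x \<le> s powr t\<^sup>2 \<and> even n) \<and> height_pred y e n z x) s)) \<longlongrightarrow> e * (t * (y - e / 2))) at_top"
proof -
  have "exit_event (\<lambda>n z x. (x \<le> s powr t\<^sup>2 \<and> even n) \<and> height_pred y e n z x) s
      = exit_event (up_cell True (y - e) y (s powr t\<^sup>2)) s" for s
    by (rule exit_event_cong) (auto simp: height_pred_def)
  moreover have "((\<lambda>s. prob (exit_event (up_cell True (y - e) y (s powr t\<^sup>2)) s))
      \<longlongrightarrow> (y\<^sup>2 - (y - e)\<^sup>2) * sqrt (t\<^sup>2) / 2) at_top"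
    using assms by (intro up_cell_limit) (auto simp: power_le_one)
  moreover have "(y\<^sup>2 - (y - e)\<^sup>2) * sqrt (t\<^sup>2) / 2 = e * (t * (y - e / 2))"
    using t by (simp add: power2_eq_square field_simps)
  ultimately show ?thesis by simp
qed

lemma downward_limit:
  assumes y: "0 \<le> y" "y \<le> 1" and e: "0 < e" "e < y" and t: "0 \<le> t" "t \<le> 1"
  shows "((\<lambda>s. prob (exit_event (\<lambda>n z x. (x \<le> s powr t\<^sup>2 \<and> odd n) \<and> height_pred y e n z x) s)) \<longlongrightarrow> e * (t * (1 - y + e / 2))) at_top"
proof -
  have "exit_event (\<lambda>n z x. (x \<le> s powr t\<^sup>2 \<and> odd n) \<and> height_pred y e n z x) s
      = exit_event (down_cell False (1 - y) (1 - y + e) (s powr t\<^sup>2)) s" for s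
    by (rule exit_event_cong) (auto simp: height_pred_def)
  moreover have "((\<lambda>s. prob (exit_event (down_cell False (1 - y) (1 - y + e) (s powr t\<^sup>2)) s))
      \<longlongrightarrow> ((1 - y + e)\<^sup>2 - (1 - y)\<^sup>2) * sqrt (t\<^sup>2) / 2) at_top"
    using assms by (intro down_cell_limit) (auto simp: power_le_one)
  moreover have "((1 - y + e)\<^sup>2 - (1 - y)\<^sup>2) * sqrt (t\<^sup>2) / 2 = e * (t * (1 - y + e / 2))"
    using t by (simp add: power2_eq_square field_simps)
  ultimately show ?thesis by simp
qed

end

theorem corollary4p15:
  fixes M :: "'a measure" and \<Theta> :: "nat \<Rightarrow> 'a \<Rightarrow> real"
    and t y \<epsilon> j :: real
  assumes "prob_space M"
    and "prob_space.indep_vars M (\<lambda>_. borel) \<Theta> {1..}"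
    and "\<And>n. n \<ge> 1 \<Longrightarrow> distributed M lborel (\<Theta> n) (\<lambda>\<theta>. ennreal (cosine_density \<theta>))"
    and "t \<in> {0..1}" and "y \<in> {0..1}" and "\<epsilon> \<in> {0<..<y}" and "j \<in> {-1, 1}"
  shows "((\<lambda>s. cond_prob M
             (\<lambda>\<omega>. sqrt (max 0 (ln (cot \<bar>exit_angle (\<lambda>n. \<Theta> n \<omega>) s\<bar>) / ln s)) \<le> t
                   \<and> j * exit_angle (\<lambda>n. \<Theta> n \<omega>) s \<le> 0)
             (\<lambda>\<omega>. exit_height (\<lambda>n. \<Theta> n \<omega>) s \<in> {y - \<epsilon><..y}))
          \<longlongrightarrow> (if j = 1 then t * (1 - y + \<epsilon> / 2) else t * (y - \<epsilon> / 2))) at_top"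
proof -
  interpret prob_space M by fact
  define X where "X = (\<lambda>n \<omega>. tan (\<Theta> n \<omega>))"
  interpret jump_walk M X
  proof unfold_locales
    have "(tan :: real \<Rightarrow> real) \<in> borel_measurable borel" unfolding tan_def[abs_def] by measurable
    then show "indep_vars (\<lambda>_. borel) X {1..}"
      unfolding X_def by (intro indep_vars_compose2[OF assms(2)]) auto
    show "distr M borel (X n) = jump_law" if "1 \<le> n" for n
      unfolding X_def by (rule distr_tan_cosine_density[OF assms(1) assms(3)[OF that]])
  qed
  have t: "0 \<le> t" "t \<le> 1" and y: "0 \<le> y" "y \<le> 1" and e: "0 < \<epsilon>" "\<epsilon> < y"
    using assms by auto
  define down where "down = (j = 1)"
  have j: "j = (if down then 1 else - 1)" using assms(7) by (auto simp: down_def)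
  let ?th = "\<lambda>\<omega> n. \<Theta> n \<omega>"
  let ?P = "\<lambda>s \<omega>. sqrt (max 0 (ln (cot \<bar>exit_angle (?th \<omega>) s\<bar>) / ln s)) \<le> t \<and> j * exit_angle (?th \<omega>) s \<le> 0"
  let ?Q = "\<lambda>s \<omega>. exit_height (?th \<omega>) s \<in> {y - \<epsilon><..y}"
  let ?\<psi> = "\<lambda>s n z x. (x \<le> s powr t\<^sup>2 \<and> (even n \<longleftrightarrow> \<not> down)) \<and> height_pred y \<epsilon> n z x"
  have SW: "walk (?th \<omega>) n = S n \<omega>" for n \<omega> unfolding walk_def S_def by (simp add: X_def)
  have on: "(?Q s \<omega> \<longleftrightarrow> height_pred y \<epsilon> n (s - S n \<omega>) (X (Suc n) \<omega>))
      \<and> (?P s \<omega> \<longleftrightarrow> X (Suc n) \<omega> \<le> s powr t\<^sup>2 \<and> (even n \<longleftrightarrow> \<not> down))"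
    if s: "1 < s" and \<omega>: "\<omega> \<in> first_passage s n" for s \<omega> n
  proof -
    have x: "0 < X (Suc n) \<omega>" using first_passage_positions[OF \<omega>] by linarith
    have le: "walk (?th \<omega>) k \<le> s" if "k \<le> n" for k
      using \<omega> that unfolding first_passage_iff alive_def SW by blast
    have gt: "s < walk (?th \<omega>) (Suc n)" using \<omega> unfolding first_passage_iff SW by blast
    have h: "exit_height (?th \<omega>) s = (if even n then (s - S n \<omega>) / X (Suc n) \<omega> else 1 - (s - S n \<omega>) / X (Suc n) \<omega>)"
      using ray_exit(1)[of n "?th \<omega>" s, OF le gt] by (simp add: SW X_def)
    have a: "exit_angle (?th \<omega>) s = (if even n then arctan (1 / X (Suc n) \<omega>) else - arctan (1 / X (Suc n) \<omega>))"
      using ray_exit(2)[of n "?th \<omega>" s, OF le gt] by (simp add: X_def)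
    have "?Q s \<omega> \<longleftrightarrow> height_pred y \<epsilon> n (s - S n \<omega>) (X (Suc n) \<omega>)"
      unfolding h by (rule height_pred_iff[OF x])
    moreover have "?P s \<omega> \<longleftrightarrow> X (Suc n) \<omega> \<le> s powr t\<^sup>2 \<and> (even n \<longleftrightarrow> \<not> down)"
      using ray_exit_angle_events[OF x s t(1) a] j by (cases down) simp_all
    ultimately show ?thesis by blast
  qed
  \<comment> \<open>the values of height and angle on the null event that the walk stays below the level\<close>
  let ?h = "\<lambda>s \<omega>. never_height (S (never_index - 1) \<omega> = s) (S never_index \<omega> = s)"
  let ?a = "\<lambda>\<omega>. never_angle (S never_index \<omega> - S (never_index - 1) \<omega>)"
  have off: "exit_height (?th \<omega>) s = ?h s \<omega>" "exit_angle (?th \<omega>) s = ?a \<omega>"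
    if "\<And>n. S n \<omega> \<le> s" for s \<omega>
    using ray_never_exits[of "?th \<omega>" s] that by (simp_all add: SW)
  have h_m: "{\<omega>\<in>space M. ?h s \<omega> \<in> {y - \<epsilon><..y}} \<in> sets M" for s
  proof -
    have "(\<lambda>\<omega>. ?h s \<omega>) = (\<lambda>\<omega>. if S (never_index - 1) \<omega> = s
        then (if S never_index \<omega> = s then never_height True True else never_height True False)
        else (if S never_index \<omega> = s then never_height False True else never_height False False))"
      by (auto simp: fun_eq_iff)
    also have "\<dots> \<in> borel_measurable M" by measurable
    finally have [measurable]: "(\<lambda>\<omega>. ?h s \<omega>) \<in> borel_measurable M" .
    show ?thesis by measurable
  qed
  have a_m: "{\<omega>\<in>space M. sqrt (max 0 (ln (cot \<bar>?a \<omega>\<bar>) / ln s)) \<le> t \<and> j * ?a \<omega> \<le> 0} \<in> sets M" for s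
    unfolding cot_def by measurable
  have \<psi>_m: "jump_pred (?\<psi> s n)" for s n
    unfolding case_prod_beta' height_pred_def by measurable
  have probQ: "prob {\<omega>\<in>space M. ?Q s \<omega>} = prob (exit_event (height_pred y \<epsilon>) s)" if s: "1 < s" for s
  proof (rule prob_eq_exit_event[OF _ height_pred_measurable _ _ h_m])
    show "?Q s \<omega> \<longleftrightarrow> ?h s \<omega> \<in> {y - \<epsilon><..y}" if "\<omega> \<in> space M" "\<And>n. S n \<omega> \<le> s" for \<omega>
      by (simp only: off[OF that(2)])
    show "?Q s \<omega> \<longleftrightarrow> height_pred y \<epsilon> n (s - S n \<omega>) (X (Suc n) \<omega>)" if "\<omega> \<in> first_passage s n" for \<omega> n
      using on[OF s that] by blast
  qed (use s in simp)
  have probPQ: "prob {\<omega>\<in>space M. ?P s \<omega> \<and> ?Q s \<omega>} = prob (exit_event (?\<psi> s) s)" if s: "1 < s" for s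
  proof (rule prob_eq_exit_event[OF _ \<psi>_m])
    show "?P s \<omega> \<and> ?Q s \<omega> \<longleftrightarrow> (sqrt (max 0 (ln (cot \<bar>?a \<omega>\<bar>) / ln s)) \<le> t \<and> j * ?a \<omega> \<le> 0) \<and> ?h s \<omega> \<in> {y - \<epsilon><..y}"
      if "\<omega> \<in> space M" "\<And>n. S n \<omega> \<le> s" for \<omega>
      by (simp only: off[OF that(2)])
    show "?P s \<omega> \<and> ?Q s \<omega> \<longleftrightarrow> ?\<psi> s n (s - S n \<omega>) (X (Suc n) \<omega>)" if "\<omega> \<in> first_passage s n" for \<omega> n
      using on[OF s that] by blast
    show "{\<omega>\<in>space M. (sqrt (max 0 (ln (cot \<bar>?a \<omega>\<bar>) / ln s)) \<le> t \<and> j * ?a \<omega> \<le> 0) \<and> ?h s \<omega> \<in> {y - \<epsilon><..y}} \<in> sets M"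
    proof -
      have "{\<omega>\<in>space M. (sqrt (max 0 (ln (cot \<bar>?a \<omega>\<bar>) / ln s)) \<le> t \<and> j * ?a \<omega> \<le> 0) \<and> ?h s \<omega> \<in> {y - \<epsilon><..y}}
        = {\<omega>\<in>space M. sqrt (max 0 (ln (cot \<bar>?a \<omega>\<bar>) / ln s)) \<le> t \<and> j * ?a \<omega> \<le> 0} \<inter> {\<omega>\<in>space M. ?h s \<omega> \<in> {y - \<epsilon><..y}}"
        by blast
      then show ?thesis using sets.Int[OF a_m[of s] h_m[of s]] by (simp only:)
    qed
  qed (use s in simp)
  have "((\<lambda>s. prob (exit_event (?\<psi> s) s)) \<longlongrightarrow> \<epsilon> * (if j = 1 then t * (1 - y + \<epsilon> / 2) else t * (y - \<epsilon> / 2))) at_top"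
    using upward_limit[OF y e t] downward_limit[OF y e t] by (cases down) (simp_all add: j)
  then have "((\<lambda>s. prob (exit_event (?\<psi> s) s) / prob (exit_event (height_pred y \<epsilon>) s))
      \<longlongrightarrow> (\<epsilon> * (if j = 1 then t * (1 - y + \<epsilon> / 2) else t * (y - \<epsilon> / 2))) / \<epsilon>) at_top"
    using e by (intro tendsto_divide height_limit[OF y e]) auto
  moreover have "(\<epsilon> * (if j = 1 then t * (1 - y + \<epsilon> / 2) else t * (y - \<epsilon> / 2))) / \<epsilon> = (if j = 1 then t * (1 - y + \<epsilon> / 2) else t * (y - \<epsilon> / 2))"
    using e by simp
  moreover have "\<forall>\<^sub>F s in at_top. prob (exit_event (?\<psi> s) s) / prob (exit_event (height_pred y \<epsilon>) s) = cond_prob M (?P s) (?Q s)"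
    by (rule eventually_mono[OF eventually_gt_at_top[of 1]]) (simp only: cond_prob_def probQ probPQ)
  ultimately show ?thesis by (simp only:) (rule Lim_transform_eventually)
qed

end
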